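(* Let $0 \leq \delta \leq 2$ be a constant and let $\mathbb{F}_q$ be a finite field. Then for every $\varepsilon > 0$ there is a randomized algorithm for $\mathrm{MMV}_{\mathbb{F}_q}^{n^\delta}$ that runs in $n^2 \cdot \mathrm{poly}(\log(nq/\varepsilon))$ time, succeeds with probability $1 - \varepsilon$, and uses at most $\lceil \frac{\delta}{2}\log_2(n) + \log_2(1/\varepsilon)\rceil$ bits of randomness.
   Context: For a ring $R$ and sparsity parameter $t = t(n) \geq 0$, the problem $\mathrm{MMV}_R^t$ is: given matrices $A, B, C \in R^{n\times n}$ (for some $n \in \mathbb{Z}^+$) with the promise that $AB - C$ has at most $t$ non-zero entries, decide whether $AB = C$. *)

theory Defs
  imports
    "HOL-Algebra.Ring"
    "HOL-Computational_Algebra.Polynomial"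
    "HOL-Library.Log_Nat"
    "HOL-Probability.Probability_Mass_Function"
begin

section \<open>Matrix multiplication verification\<close>

text \<open>
  An \<open>n \<times> n\<close> matrix is a function of a row and a column index, of which only the values at
  indices below \<open>n\<close> are ever used.
\<close>

type_synonym 'a matrix = "nat \<Rightarrow> nat \<Rightarrow> 'a"

definition square_matrices :: "('a, 'm) ring_scheme \<Rightarrow> nat \<Rightarrow> 'a matrix set" where
  "square_matrices R n = {A. \<forall>i<n. \<forall>j<n. A i j \<in> carrier R}"

definition mat_prod :: "('a, 'm) ring_scheme \<Rightarrow> nat \<Rightarrow> 'a matrix \<Rightarrow> 'a matrix \<Rightarrow> 'a matrix" where
  "mat_prod R n A B = (\<lambda>i j. \<Oplus>\<^bsub>R\<^esub>k\<in>{..<n}. A i k \<otimes>\<^bsub>R\<^esub> B k j)"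

definition mat_diff :: "('a, 'm) ring_scheme \<Rightarrow> 'a matrix \<Rightarrow> 'a matrix \<Rightarrow> 'a matrix" where
  "mat_diff R A B = (\<lambda>i j. A i j \<ominus>\<^bsub>R\<^esub> B i j)"

definition num_nonzero :: "('a, 'm) ring_scheme \<Rightarrow> nat \<Rightarrow> 'a matrix \<Rightarrow> nat" where
  "num_nonzero R n A = card {(i, j). i < n \<and> j < n \<and> A i j \<noteq> \<zero>\<^bsub>R\<^esub>}"

definition mat_eq :: "nat \<Rightarrow> 'a matrix \<Rightarrow> 'a matrix \<Rightarrow> bool" where
  "mat_eq n A B \<longleftrightarrow> (\<forall>i<n. \<forall>j<n. A i j = B i j)"

definition MMV_promise ::
  "('a, 'm) ring_scheme \<Rightarrow> (nat \<Rightarrow> real) \<Rightarrow> nat \<Rightarrow> ('a matrix \<times> 'a matrix \<times> 'a matrix) set" where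
  "MMV_promise R t n = {(A, B, C).
     A \<in> square_matrices R n \<and> B \<in> square_matrices R n \<and> C \<in> square_matrices R n \<and>
     real (num_nonzero R n (mat_diff R (mat_prod R n A B) C)) \<le> t n}"

definition MMV_answer ::
  "('a, 'm) ring_scheme \<Rightarrow> nat \<Rightarrow> 'a matrix \<Rightarrow> 'a matrix \<Rightarrow> 'a matrix \<Rightarrow> bool" where
  "MMV_answer R n A B C \<longleftrightarrow> mat_eq n (mat_prod R n A B) C"


section \<open>Random access machine with logarithmic cost\<close>

text \<open>
  Programs are structured while programs over finitely many directly addressed registers and
  an indirectly addressed memory, all cells holding natural numbers.  As in the logarithmic
  cost criterion of Cook--Reckhow and Aho--Hopcroft--Ullman, every access and every operation
  is charged the lengths of the binary representations of the addresses and operands involved,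
  so that the total cost measures bit complexity up to polylogarithmic factors.
\<close>

record state =
  regs :: "nat \<Rightarrow> nat"
  mem :: "nat \<Rightarrow> nat"

datatype binop = Add | Monus | Mult | Div | Less

datatype expr = Const nat | Reg nat | Load expr | Bin binop expr expr

datatype com =
    Skip
  | Assign nat expr
  | Store expr expr
  | Seq com com
  | Cond expr com com
  | While expr com

definition word_cost :: "nat \<Rightarrow> nat" where
  "word_cost a = 1 + floorlog 2 a"

fun apply_op :: "binop \<Rightarrow> nat \<Rightarrow> nat \<Rightarrow> nat" where
  "apply_op Add a b = a + b"
| "apply_op Monus a b = a - b"
| "apply_op Mult a b = a * b"
| "apply_op Div a b = a div b"
| "apply_op Less a b = of_bool (a < b)"

fun expr_val :: "expr \<Rightarrow> state \<Rightarrow> nat" where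
  "expr_val (Const a) s = a"
| "expr_val (Reg r) s = regs s r"
| "expr_val (Load e) s = mem s (expr_val e s)"
| "expr_val (Bin f d e) s = apply_op f (expr_val d s) (expr_val e s)"

fun expr_cost :: "expr \<Rightarrow> state \<Rightarrow> nat" where
  "expr_cost (Const a) s = word_cost a"
| "expr_cost (Reg r) s = word_cost r + word_cost (regs s r)"
| "expr_cost (Load e) s =
     expr_cost e s + word_cost (expr_val e s) + word_cost (mem s (expr_val e s))"
| "expr_cost (Bin f d e) s =
     expr_cost d s + expr_cost e s + word_cost (expr_val d s) + word_cost (expr_val e s)"

text \<open>\<open>exec c s T s'\<close>: program \<open>c\<close> started in \<open>s\<close> halts in \<open>s'\<close> after total cost \<open>T\<close>.\<close>

inductive exec :: "com \<Rightarrow> state \<Rightarrow> nat \<Rightarrow> state \<Rightarrow> bool" where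
  Skip: "exec Skip s 1 s"
| Assign: "exec (Assign r e) s (expr_cost e s + word_cost r + word_cost (expr_val e s))
     (s\<lparr>regs := (regs s)(r := expr_val e s)\<rparr>)"
| Store: "exec (Store d e) s
     (expr_cost d s + expr_cost e s + word_cost (expr_val d s) + word_cost (expr_val e s))
     (s\<lparr>mem := (mem s)(expr_val d s := expr_val e s)\<rparr>)"
| Seq: "exec c s T s' \<Longrightarrow> exec c' s' T' s'' \<Longrightarrow> exec (Seq c c') s (T + T') s''"
| CondTrue: "expr_val e s \<noteq> 0 \<Longrightarrow> exec c s T s' \<Longrightarrow>
     exec (Cond e c c') s (expr_cost e s + word_cost (expr_val e s) + T) s'"
| CondFalse: "expr_val e s = 0 \<Longrightarrow> exec c' s T s' \<Longrightarrow>
     exec (Cond e c c') s (expr_cost e s + word_cost (expr_val e s) + T) s'"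
| WhileFalse: "expr_val e s = 0 \<Longrightarrow>
     exec (While e c) s (expr_cost e s + word_cost (expr_val e s)) s"
| WhileTrue: "expr_val e s \<noteq> 0 \<Longrightarrow> exec c s T s' \<Longrightarrow> exec (While e c) s' T' s'' \<Longrightarrow>
     exec (While e c) s (expr_cost e s + word_cost (expr_val e s) + T + T') s''"

inductive_cases exec_SkipE: "exec Skip s T s'"
inductive_cases exec_AssignE: "exec (Assign r e) s T s'"
inductive_cases exec_StoreE: "exec (Store d e) s T s'"
inductive_cases exec_SeqE: "exec (Seq c c') s T s'"
inductive_cases exec_CondE: "exec (Cond e c c') s T s'"
inductive_cases exec_WhileE: "exec (While e c) s T s'"

lemma exec_deterministic:
  "exec c s T s' \<Longrightarrow> exec c s T' s'' \<Longrightarrow> T = T' \<and> s' = s''"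
proof (induction arbitrary: T' s'' rule: exec.induct)
  case Skip then show ?case by (auto elim: exec_SkipE)
next
  case Assign then show ?case by (auto elim: exec_AssignE)
next
  case Store then show ?case by (auto elim: exec_StoreE)
next
  case Seq then show ?case by (blast elim: exec_SeqE)
next
  case (CondTrue e s c T s' c')
  from CondTrue.prems CondTrue.hyps show ?case
    by (cases rule: exec_CondE) (auto dest: CondTrue.IH)
next
  case (CondFalse e s c' T s' c)
  from CondFalse.prems CondFalse.hyps show ?case
    by (cases rule: exec_CondE) (auto dest: CondFalse.IH)
next
  case WhileFalse then show ?case by (auto elim: exec_WhileE)
next
  case (WhileTrue e s c T s' T2 s2)
  from WhileTrue.prems WhileTrue.hyps show ?case
    by (cases rule: exec_WhileE) (auto dest!: WhileTrue.IH)
qed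

definition halts_within :: "com \<Rightarrow> state \<Rightarrow> real \<Rightarrow> bool" where
  "halts_within c s T \<longleftrightarrow> (\<exists>T' s'. exec c s T' s' \<and> real T' \<le> T)"

text \<open>The verdict (1 for yes, 0 for no) is left in register 0.\<close>

definition outputs :: "com \<Rightarrow> state \<Rightarrow> bool \<Rightarrow> bool" where
  "outputs c s b \<longleftrightarrow> (\<exists>T s'. exec c s T s' \<and> regs s' 0 = of_bool b)"


section \<open>Randomized algorithms for matrix multiplication verification\<close>

text \<open>
  A randomized algorithm is a program that receives, next to the problem instance, a string
  \<open>\<omega>\<close> of uniformly random bits.  The string is the only source of randomness, so its length
  bounds the number of random bits used; the program need not read all of it.

  A field with \<open>q\<close> elements is presented on the carrier \<open>{..<q}\<close>, in an arbitrary numbering of its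
  elements, so that field elements are words, one per memory cell.  The machine has no field
  operations: these have to be programmed and are charged like everything else.  Fixing the
  type \<open>nat\<close> for all finite fields makes it possible to quantify over them inside a formula,
  and so to ask for a time bound that is uniform in \<open>q\<close>.

  The memory initially holds \<open>n\<close>, the length of \<open>\<omega>\<close>, the entries of \<open>A\<close>, \<open>B\<close>, \<open>C\<close> in row-major
  order, and the bits of \<open>\<omega>\<close>, followed by zeros; all registers are zero.
\<close>

definition mat_words :: "nat \<Rightarrow> nat matrix \<Rightarrow> nat list" where
  "mat_words n A = [A i j. i \<leftarrow> [0..<n], j \<leftarrow> [0..<n]]"

definition initial_state ::
  "nat \<Rightarrow> nat matrix \<Rightarrow> nat matrix \<Rightarrow> nat matrix \<Rightarrow> bool list \<Rightarrow> state" where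
  "initial_state n A B C \<omega> =
     (let ws = [n, length \<omega>] @ mat_words n A @ mat_words n B @ mat_words n C @ map of_bool \<omega>
      in \<lparr>regs = (\<lambda>_. 0), mem = (\<lambda>a. if a < length ws then ws ! a else 0)\<rparr>)"

text \<open>
  In the next two definitions \<open>r n\<close> is the number of random bits available on \<open>n \<times> n\<close> matrices.
  The time bound is worst case, over all matrices (not only those satisfying the promise) and
  all random strings.
\<close>

definition runs_in_time :: "(nat, 'm) ring_scheme \<Rightarrow> (nat \<Rightarrow> nat) \<Rightarrow> com \<Rightarrow> (nat \<Rightarrow> real) \<Rightarrow> bool" where
  "runs_in_time R r c T \<longleftrightarrow>
     (\<forall>n\<ge>1. \<forall>A\<in>square_matrices R n. \<forall>B\<in>square_matrices R n. \<forall>C\<in>square_matrices R n.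
        \<forall>\<omega>. length \<omega> = r n \<longrightarrow> halts_within c (initial_state n A B C \<omega>) (T n))"

definition solves_MMV ::
  "(nat, 'm) ring_scheme \<Rightarrow> (nat \<Rightarrow> real) \<Rightarrow> (nat \<Rightarrow> nat) \<Rightarrow> com \<Rightarrow> real \<Rightarrow> bool" where
  "solves_MMV R t r c p \<longleftrightarrow>
     (\<forall>n\<ge>1. \<forall>(A, B, C) \<in> MMV_promise R t n.
        measure_pmf.prob (pmf_of_set {\<omega>. length \<omega> = r n})
          {\<omega>. outputs c (initial_state n A B C \<omega>) (MMV_answer R n A B C)} \<ge> p)"

end

(*
  Let D = AB - C. If D is nonzero with at most t nonzero entries, then some nonzero row or some
  nonzero column y of D has s <= sqrt t nonzero entries. For distinct elements u and v_0, ..., v_(n-1)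
  of an extension field, consider the Cauchy vector with entries 1 / (u - v_j), scaled by the product
  of all u - v_k so that no division is needed. Clearing denominators, its inner product with y is a
  nonzero polynomial in u of degree below s up to a nonzero factor, so fewer than s choices of u make
  it vanish. Hence checking both D x = 0 and x D = 0 for a uniformly random u among
  2^r >= sqrt t / epsilon candidates errs with probability at most epsilon; each check is done
  coordinatewise as A (B x) = C x.

  The extension field must be found deterministically and uniformly in n. The quadratic extension of
  F_q has q^2 elements, and q^2 - 1 is divisible by 8 if q is odd and by 3 if q is even. With l = 2 or
  l = 3 respectively, and gamma such that gamma^((q^2 - 1) / l) is not 1, the polynomial X^(l^k) - gamma
  is irreducible over it for every k. The program only has to choose k; it knows q, so the arithmetic
  of the field with q^2 elements is hard-coded in decision trees of depth O(log q).
*)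

theory Submission
  imports
    "HOL-Algebra.Algebraic_Closure"
    "HOL-Algebra.Sylow"
    "HOL-Algebra.Multiplicative_Group"
    "HOL-Number_Theory.Cong"
    Defs
begin

section \<open>Zeros of sums of partial fractions\<close>

text \<open>All random bits are spent on the choice of u, so the extension field may not cost any,
  and it has to grow with n although the program is fixed. Over F_q itself radical towers can fail:
  for q = 3 modulo 4 every X^4 - \<gamma> is reducible, and for q = 2 the only nonzero \<gamma> is
  1. After the quadratic extension l = 2 or l = 3 always works. That l is bounded also matters for
  the time, because the degree overshoots its target by up to a factor l. One \<gamma> serves all
  degrees N, and reduction modulo X^N - \<gamma> is a single multiplication by \<gamma>. Points of
  the extension are written with one bit per coordinate and not with base q^2 digits. Then N is of
  the order of log n + log (1 / \<epsilon>) whatever q is, and distinct bit strings are distinct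
  points as soon as the powers of the root are independent. Irreducibility is used only in this
  form, as independence of the powers of a root in an algebraic closure.\<close>

lemma (in field) inv_closed_nonzero: "x \<in> carrier R \<Longrightarrow> x \<noteq> \<zero> \<Longrightarrow> inv x \<in> carrier R"
  using field_Units by auto

lemma (in ring) diff_nonzero: "x \<in> carrier R \<Longrightarrow> y \<in> carrier R \<Longrightarrow> x \<noteq> y \<Longrightarrow> x \<ominus> y \<noteq> \<zero>"
  by simp

lemma (in field) inv_nonzero: "x \<in> carrier R \<Longrightarrow> x \<noteq> \<zero> \<Longrightarrow> inv x \<noteq> \<zero>"
  using field_Units Units_r_inv[of x] by (metis DiffI Units_closed Units_inv_closed r_null singletonD zero_not_one)

lemma (in field) inv_eq_imp_eq:
  "x \<in> carrier R \<Longrightarrow> x \<noteq> \<zero> \<Longrightarrow> y \<in> carrier R \<Longrightarrow> y \<noteq> \<zero> \<Longrightarrow> inv x = inv y \<Longrightarrow> x = y"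
  by (metis DiffI field_Units Units_inv_inv singletonD)

lemma (in ring) minus_cancel_left:
  assumes "a \<ominus> b = a \<ominus> c" "a \<in> carrier R" "b \<in> carrier R" "c \<in> carrier R"
  shows "b = c"
  using assms by (metis add.l_cancel a_inv_closed minus_eq minus_minus)

lemma (in field) partial_fractions:
  assumes c: "a \<in> carrier R" "b \<in> carrier R" "w \<in> carrier R" and n: "a \<noteq> w" "b \<noteq> w"
  shows "(a \<ominus> b) \<otimes> (inv (a \<ominus> w) \<otimes> inv (b \<ominus> w)) = inv (b \<ominus> w) \<ominus> inv (a \<ominus> w)"
proof -
  define i where "i = inv (a \<ominus> w)"
  define k where "k = inv (b \<ominus> w)"
  have ic: "i \<in> carrier R" "k \<in> carrier R"
    unfolding i_def k_def using c n by (auto intro!: inv_closed_nonzero)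
  have "a \<ominus> w \<in> Units R" "b \<ominus> w \<in> Units R" using c n field_Units by auto
  then have 1: "(a \<ominus> w) \<otimes> i = \<one>" "(b \<ominus> w) \<otimes> k = \<one>"
    by (simp_all add: i_def k_def)
  have "(a \<ominus> b) \<otimes> (i \<otimes> k) = ((a \<ominus> w) \<otimes> i) \<otimes> k \<ominus> ((b \<ominus> w) \<otimes> k) \<otimes> i"
    using c ic by algebra
  then show ?thesis using 1 ic by (simp add: i_def k_def)
qed

text \<open>
  If \<open>u\<^sub>0\<close> is a zero of \<open>\<Sum> y\<^sub>j / (u - v\<^sub>j)\<close>, then all other zeros are zeros of
  \<open>\<Sum> y\<^sub>j (1 / (u\<^sub>0 - v\<^sub>j) - 1 / (u\<^sub>0 - v\<^sub>i)) / (u - v\<^sub>j)\<close>, in which the term \<open>i\<close> has disappeared.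
\<close>

lemma (in field) card_zeros_partial_fractions:
  assumes "finite S" "S \<noteq> {}" "y \<in> S \<rightarrow> carrier R - {\<zero>}"
    and "v \<in> S \<rightarrow> carrier R" "inj_on v S"
    and "finite Z" "Z \<subseteq> carrier R" "Z \<inter> v ` S = {}"
    and "\<And>u. u \<in> Z \<Longrightarrow> (\<Oplus>j\<in>S. y j \<otimes> inv (u \<ominus> v j)) = \<zero>"
  shows "card Z < card S"
  using assms
proof (induction "card S" arbitrary: S y Z rule: less_induct)
  case less
  note S = less.prems(1,2) and y = less.prems(3) and v = less.prems(4,5)
    and Z = less.prems(6-8) and zero = less.prems(9)
  show ?case
  proof (cases "Z = {}")
    case True then show ?thesis using S by (simp add: card_gt_0_iff)
  next
    case False
    then obtain u0 where u0: "u0 \<in> Z" by auto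
    obtain i where i: "i \<in> S" using S by auto
    have yc: "y j \<in> carrier R" "y j \<noteq> \<zero>" "v j \<in> carrier R" if "j \<in> S" for j using y v that by auto
    have uv: "u \<in> carrier R" "u \<noteq> v j" if "u \<in> Z" "j \<in> S" for u j
      using Z that by auto
    have ic: "inv (u \<ominus> v j) \<in> carrier R" if "u \<in> Z" "j \<in> S" for u j
      using uv[OF that] yc[OF that(2)] by (intro inv_closed_nonzero) auto
    define y' where "y' j = y j \<otimes> (inv (u0 \<ominus> v j) \<ominus> inv (u0 \<ominus> v i))" for j
    have y'c: "y' j \<in> carrier R" if "j \<in> S" for j
      using ic[OF u0] i that yc by (simp add: y'_def)
    have y'n: "y' j \<noteq> \<zero>" if "j \<in> S - {i}" for j
    proof -
      have j: "j \<in> S" "j \<noteq> i" using that by auto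
      have "inv (u0 \<ominus> v j) \<noteq> inv (u0 \<ominus> v i)"
      proof
        assume "inv (u0 \<ominus> v j) = inv (u0 \<ominus> v i)"
        then have "u0 \<ominus> v j = u0 \<ominus> v i"
          by (rule inv_eq_imp_eq[rotated 4])
            (simp_all add: diff_nonzero uv[OF u0 i] uv[OF u0 j(1)] yc[OF i] yc[OF j(1)])
        then have "v j = v i"
          by (rule minus_cancel_left) (use uv(1)[OF u0 i] yc i j in auto)
        then show False using v i j by (auto dest: inj_onD)
      qed
      then show ?thesis using ic[OF u0] i j yc by (auto simp: y'_def integral_iff)
    qed
    have y'i: "y' i = \<zero>" using ic[OF u0 i] yc[OF i] by (simp add: y'_def r_neg minus_eq)
    have z: "(\<Oplus>j\<in>S - {i}. y' j \<otimes> inv (u \<ominus> v j)) = \<zero>" if u: "u \<in> Z - {u0}" for u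
    proof -
      have uZ: "u \<in> Z" and ne: "u \<noteq> u0" using u by auto
      have d: "u0 \<ominus> u \<in> carrier R" "u0 \<ominus> u \<noteq> \<zero>"
        using uv[OF uZ i] uv[OF u0 i] ne by (auto simp: diff_nonzero)
      let ?I = "\<lambda>j. inv (u0 \<ominus> v j)" and ?K = "\<lambda>j. inv (u \<ominus> v j)"
      have c: "?I j \<in> carrier R" "?K j \<in> carrier R" if "j \<in> S" for j using ic u0 uZ that by auto
      \<comment> \<open>Multiplying by u0 - u turns each product of two reciprocals into their
        difference, so the sum becomes the relation at u minus the relation at u0, both of which are
        zero.\<close>
      have "(u0 \<ominus> u) \<otimes> (\<Oplus>j\<in>S. y j \<otimes> (?I j \<otimes> ?K j)) = (\<Oplus>j\<in>S. (u0 \<ominus> u) \<otimes> (y j \<otimes> (?I j \<otimes> ?K j)))"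
        using S c yc d by (intro finsum_rdistr) auto
      also have "\<dots> = (\<Oplus>j\<in>S. y j \<otimes> ?K j \<oplus> (\<ominus> \<one>) \<otimes> (y j \<otimes> ?I j))"
      proof (intro finsum_cong' refl)
        fix j assume j: "j \<in> S"
        have "(u0 \<ominus> u) \<otimes> (y j \<otimes> (?I j \<otimes> ?K j)) = y j \<otimes> ((u0 \<ominus> u) \<otimes> (?I j \<otimes> ?K j))"
          using c[OF j] yc[OF j] d by algebra
        also have "\<dots> = y j \<otimes> (?K j \<ominus> ?I j)"
          using partial_fractions[of u0 u "v j"] uv u0 uZ j yc by auto
        also have "\<dots> = y j \<otimes> ?K j \<oplus> (\<ominus> \<one>) \<otimes> (y j \<otimes> ?I j)"
          using c[OF j] yc[OF j] by algebra
        finally show "(u0 \<ominus> u) \<otimes> (y j \<otimes> (?I j \<otimes> ?K j)) = y j \<otimes> ?K j \<oplus> (\<ominus> \<one>) \<otimes> (y j \<otimes> ?I j)" .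
      qed (use c yc in auto)
      also have "\<dots> = (\<Oplus>j\<in>S. y j \<otimes> ?K j) \<oplus> (\<Oplus>j\<in>S. (\<ominus> \<one>) \<otimes> (y j \<otimes> ?I j))"
        using c yc by (intro finsum_addf) auto
      also have "(\<Oplus>j\<in>S. (\<ominus> \<one>) \<otimes> (y j \<otimes> ?I j)) = (\<ominus> \<one>) \<otimes> (\<Oplus>j\<in>S. y j \<otimes> ?I j)"
        using S c yc by (intro finsum_rdistr[symmetric]) auto
      finally have "(u0 \<ominus> u) \<otimes> (\<Oplus>j\<in>S. y j \<otimes> (?I j \<otimes> ?K j)) = \<zero>"
        using zero[OF u0] zero[OF uZ] by simp
      then have 1: "(\<Oplus>j\<in>S. y j \<otimes> (?I j \<otimes> ?K j)) = \<zero>"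
        using d c yc integral_iff[of "u0 \<ominus> u" "\<Oplus>j\<in>S. y j \<otimes> (?I j \<otimes> ?K j)"] by auto
      \<comment> \<open>From the sum just shown to vanish, 1 / (u0 - v_i) times the relation at u is
        subtracted. The index \<open>i\<close> is still included; it drops out afterwards because
        \<open>y' i\<close> is zero.\<close>
      have "(\<Oplus>j\<in>S. y' j \<otimes> ?K j) = (\<Oplus>j\<in>S. y j \<otimes> (?I j \<otimes> ?K j) \<oplus> (\<ominus> ?I i) \<otimes> (y j \<otimes> ?K j))"
      proof (intro finsum_cong' refl)
        fix j assume j: "j \<in> S"
        show "y' j \<otimes> ?K j = y j \<otimes> (?I j \<otimes> ?K j) \<oplus> (\<ominus> ?I i) \<otimes> (y j \<otimes> ?K j)"
          unfolding y'_def using c[OF j] c[OF i] yc[OF j] by algebra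
      qed (use c yc i in auto)
      also have "\<dots> = (\<Oplus>j\<in>S. y j \<otimes> (?I j \<otimes> ?K j)) \<oplus> (\<Oplus>j\<in>S. (\<ominus> ?I i) \<otimes> (y j \<otimes> ?K j))"
        using c yc i by (intro finsum_addf) auto
      also have "(\<Oplus>j\<in>S. (\<ominus> ?I i) \<otimes> (y j \<otimes> ?K j)) = (\<ominus> ?I i) \<otimes> (\<Oplus>j\<in>S. y j \<otimes> ?K j)"
        using S c yc i by (intro finsum_rdistr[symmetric]) auto
      finally have 2: "(\<Oplus>j\<in>S. y' j \<otimes> ?K j) = \<zero>" using 1 zero[OF uZ] c i by simp
      have "(\<Oplus>j\<in>S. y' j \<otimes> ?K j) = (\<Oplus>j\<in>insert i (S - {i}). y' j \<otimes> ?K j)"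
        using i by (simp add: insert_absorb)
      also have "\<dots> = y' i \<otimes> ?K i \<oplus> (\<Oplus>j\<in>S - {i}. y' j \<otimes> ?K j)"
        using S i c y'c by (intro finsum_insert) auto
      also have "\<dots> = (\<Oplus>j\<in>S - {i}. y' j \<otimes> ?K j)"
        using c[OF i] finsum_closed[of "\<lambda>j. y' j \<otimes> ?K j" "S - {i}"] c y'c
        by (simp add: y'i Pi_def)
      finally show ?thesis using 2 by simp
    qed
    have card: "card (S - {i}) < card S" using S i by (intro psubset_card_mono) auto
    have Zc: "card Z = Suc (card (Z - {u0}))" using Z u0 by (simp only: card.remove)
    have Sc: "card S = Suc (card (S - {i}))" using S i by (simp only: card.remove)
    show ?thesis
    proof (cases "S - {i} = {}")
      \<comment> \<open>A single fraction y_i / (u0 - v_i) with nonzero numerator cannot vanish, so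
        with one term left there is no zero at all.\<close>
      case True
      then have "S = {i}" using i by auto
      moreover have "y i \<otimes> inv (u0 \<ominus> v i) \<noteq> \<zero>"
        using yc[OF i] ic[OF u0 i] uv[OF u0 i] by (auto simp: integral_iff inv_nonzero diff_nonzero)
      ultimately show ?thesis using zero[OF u0] yc[OF i] ic[OF u0 i] by simp
    next
      case False
      have "card (Z - {u0}) < card (S - {i})"
        by (rule less.hyps[OF card _ _ _ _ _ _ _ _ z])
          (use S False y'c y'n v Z z in \<open>auto simp: inj_on_diff\<close>)
      then show ?thesis using Zc Sc by simp
    qed
  qed
qed

text \<open>For u outside the points v_k, the cofactor sum is the nonzero product of all u - v_k
  times the sum of partial fractions, so both have the same zeros there. Dropping the indices with D
  j = 0 does not change the sum, which brings the bound down to the number of nonzero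
  entries.\<close>

lemma (in field) card_zeros_cofactor_sum:
  fixes v D :: "nat \<Rightarrow> 'a"
  assumes v: "v \<in> {..<n} \<rightarrow> carrier R" "inj_on v {..<n}"
    and D: "D \<in> {..<n} \<rightarrow> carrier R" "i < n" "D i \<noteq> \<zero>"
    and Z: "finite Z" "Z \<subseteq> carrier R" "Z \<inter> v ` {..<n} = {}"
    and zero: "\<And>u. u \<in> Z \<Longrightarrow> (\<Oplus>j\<in>{..<n}. D j \<otimes> (\<Otimes>k\<in>{..<n} - {j}. u \<ominus> v k)) = \<zero>"
  shows "card Z < card {j. j < n \<and> D j \<noteq> \<zero>}"
proof (rule card_zeros_partial_fractions[where v = v and y = D])
  let ?S = "{j. j < n \<and> D j \<noteq> \<zero>}"
  show "inj_on v ?S" by (rule inj_on_subset[OF v(2)]) auto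
  fix u assume u: "u \<in> Z"
  have uc: "u \<in> carrier R" "\<And>k. k < n \<Longrightarrow> u \<noteq> v k" using u Z by auto
  have f: "u \<ominus> v k \<in> carrier R" "u \<ominus> v k \<noteq> \<zero>" "inv (u \<ominus> v k) \<in> carrier R" "D k \<in> carrier R"
    if "k < n" for k
    using uc that v D by (auto intro!: inv_closed_nonzero simp: diff_nonzero Pi_def)
  define p where "p = (\<Otimes>k\<in>{..<n}. u \<ominus> v k)"
  have pc: "p \<in> carrier R" unfolding p_def using f by (intro finprod_closed) auto
  have nz: "(\<Otimes>k\<in>A. u \<ominus> v k) \<noteq> \<zero>" if "finite A" "A \<subseteq> {..<n}" for A
    using that
  proof (induction A rule: finite_induct)
    case (insert x A)
    then have "(\<Otimes>k\<in>insert x A. u \<ominus> v k) = (u \<ominus> v x) \<otimes> (\<Otimes>k\<in>A. u \<ominus> v k)"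
      using f by (intro finprod_insert) auto
    moreover have "(\<Otimes>k\<in>A. u \<ominus> v k) \<in> carrier R" using insert f by (intro finprod_closed) auto
    ultimately show ?case using insert f by (auto simp: integral_iff)
  qed auto
  have pn: "p \<noteq> \<zero>" unfolding p_def by (rule nz) auto
  have e: "(\<Otimes>k\<in>{..<n} - {j}. u \<ominus> v k) = p \<otimes> inv (u \<ominus> v j)" if j: "j < n" for j
  proof -
    let ?q = "\<Otimes>k\<in>{..<n} - {j}. u \<ominus> v k"
    have qc: "?q \<in> carrier R" using f by (intro finprod_closed) auto
    have "p = (\<Otimes>k\<in>insert j ({..<n} - {j}). u \<ominus> v k)" using j by (simp add: p_def insert_absorb)
    also have "\<dots> = (u \<ominus> v j) \<otimes> ?q" using f j by (intro finprod_insert) auto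
    finally have "p \<otimes> inv (u \<ominus> v j) = ((u \<ominus> v j) \<otimes> inv (u \<ominus> v j)) \<otimes> ?q"
      using f[OF j] qc by (simp add: m_ac)
    moreover have "(u \<ominus> v j) \<otimes> inv (u \<ominus> v j) = \<one>" using f[OF j] field_Units by (intro Units_r_inv) auto
    ultimately show ?thesis using qc by simp
  qed
  have "(\<Oplus>j\<in>{..<n}. D j \<otimes> (\<Otimes>k\<in>{..<n} - {j}. u \<ominus> v k)) = (\<Oplus>j\<in>{..<n}. p \<otimes> (D j \<otimes> inv (u \<ominus> v j)))"
    using e f pc by (intro finsum_cong') (auto simp: m_ac)
  also have "\<dots> = p \<otimes> (\<Oplus>j\<in>{..<n}. D j \<otimes> inv (u \<ominus> v j))"
    using f pc by (intro finsum_rdistr[symmetric]) auto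
  finally have "p \<otimes> (\<Oplus>j\<in>{..<n}. D j \<otimes> inv (u \<ominus> v j)) = \<zero>" using zero[OF u] by simp
  moreover have c: "(\<Oplus>j\<in>{..<n}. D j \<otimes> inv (u \<ominus> v j)) \<in> carrier R" using f by (intro finsum_closed) auto
  ultimately have "(\<Oplus>j\<in>{..<n}. D j \<otimes> inv (u \<ominus> v j)) = \<zero>"
    using pn pc by (auto simp: integral_iff)
  moreover have "(\<Oplus>j\<in>?S. D j \<otimes> inv (u \<ominus> v j)) = (\<Oplus>j\<in>{..<n}. D j \<otimes> inv (u \<ominus> v j))"
    by (rule add.finprod_mono_neutral_cong_left) (use f in \<open>auto simp: Pi_def\<close>)
  ultimately show "(\<Oplus>j\<in>?S. D j \<otimes> inv (u \<ominus> v j)) = \<zero>" by simp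
qed (use assms in \<open>auto simp: Pi_def\<close>)

section \<open>Radical extensions of finite fields\<close>

text \<open>Lifting the exponent: if D = l^j d with l not dividing d, then Q^D - 1 has exactly j
  more factors l than Q - 1, and D < l^k forces j < k. For l = 2 this relies on 4 dividing Q - 1;
  otherwise Q + 1 would contribute surplus factors 2.\<close>

lemma prime_power_factor_of_power_minus_one:
  fixes l Q D k :: nat
  assumes l: "prime l" "l dvd Q - 1" "l = 2 \<Longrightarrow> 4 dvd Q - 1" and Q: "Q \<ge> 2" and D: "D > 0" "D < l ^ k"
  shows "\<exists>j e. j < k \<and> Q ^ D - 1 = (Q - 1) * l ^ j * e \<and> \<not> l dvd e"
proof -
  obtain j d where d: "D = l ^ j * d" "\<not> l dvd d"
    using D l(1) by (metis multiplicity_decompose' not_prime_unit less_irrefl)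
  have l2: "l \<ge> 2" using l by (simp add: prime_ge_2_nat)
  have "l ^ j \<le> D" using d D by (simp add: Suc_leI)
  then have "l ^ j < l ^ k" using D by linarith
  then have jk: "j < k" using l2 by (simp add: power_strict_increasing_iff)
  have Q1: "[Q = 1] (mod l)" using l(2) Q by (simp add: cong_altdef_nat)
  have "\<exists>e. Q ^ (l ^ j * d) - 1 = (Q - 1) * l ^ j * e \<and> \<not> l dvd e"
  proof (induction j)
    case 0
    \<comment> \<open>The geometric sum has d terms, each congruent to 1 modulo l, and l does not
      divide d.\<close>
    have "Q ^ d - 1 = (Q - 1) * (\<Sum>i<d. Q ^ i)"
    proof -
      have "int (Q ^ d - 1) = int ((Q - 1) * (\<Sum>i<d. Q ^ i))"
        using Q power_diff_1_eq[of "int Q" d] by (simp add: of_nat_diff)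
      then show ?thesis using of_nat_eq_iff by blast
    qed
    moreover have "[(\<Sum>i<d. Q ^ i) = (\<Sum>i<d. 1 ^ i)] (mod l)"
      using Q1 by (intro cong_sum cong_pow)
    then have "\<not> l dvd (\<Sum>i<d. Q ^ i)" using d(2) by (simp add: cong_dvd_iff)
    ultimately show ?case by auto
  next
    case (Suc j)
    then obtain e where e: "Q ^ (l ^ j * d) - 1 = (Q - 1) * l ^ j * e" "\<not> l dvd e" by auto
    define R where "R = Q ^ (l ^ j * d)"
    define S where "S = (\<Sum>i<l. R ^ i)"
    have R1: "R \<ge> 1" using Q by (simp add: R_def)
    have Rl: "R ^ l - 1 = (R - 1) * S"
    proof -
      have "int (R ^ l - 1) = int ((R - 1) * S)"
        using R1 power_diff_1_eq[of "int R" l] by (simp add: of_nat_diff S_def)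
      then show ?thesis using of_nat_eq_iff by blast
    qed
    have "l dvd R - 1" using e l(2) by (simp add: R_def)
    then obtain h where h: "R = 1 + l * h" using R1 by (metis dvd_def le_add_diff_inverse)
    \<comment> \<open>Passing from j to j + 1 must add exactly one factor l. With R = 1 + l h and l
      = 2, the sum S is 2 (1 + h), where h is even because 4 divides R - 1.\<close>
    have "\<exists>f. S = l * f \<and> \<not> l dvd f"
    proof (cases "l = 2")
      case True
      have "4 dvd R - 1" using e l(3)[OF True] by (simp add: R_def)
      then have "even h" using h True by auto
      moreover have "S = l * (1 + h)"
        using h unfolding S_def True by (simp add: lessThan_nat_numeral)
      ultimately have "S = l * (1 + h) \<and> \<not> l dvd 1 + h"
        using True by simp
      then show ?thesis by blast
    next
      case False
      have odd: "odd l" using l(1) False prime_odd_nat l2 by auto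
      \<comment> \<open>Modulo l^2 the power R^i is 1 + l i h. The sum of all i < l is l (l - 1) /
        2, a multiple of the odd number l, so S is congruent to l modulo l^2.\<close>
      have pw: "\<exists>g. (1 + l * h) ^ i = 1 + l * (i * h) + l * l * g" for i
      proof (induction i)
        case 0 show ?case by simp
      next
        case (Suc i)
        then obtain g where "(1 + l * h) ^ i = 1 + l * (i * h) + l * l * g" by auto
        then have "(1 + l * h) ^ Suc i = 1 + l * (Suc i * h) + l * l * (i * h * h + g + l * h * g)"
          by (simp add: algebra_simps)
        then show ?case by blast
      qed
      then obtain g where g: "\<And>i. R ^ i = 1 + l * (i * h) + l * l * g i" using h by metis
      have "S = l + l * h * (\<Sum>i<l. i) + l * l * (\<Sum>i<l. g i)"
        unfolding S_def g sum.distrib by (simp add: sum_distrib_left mult_ac)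
      moreover obtain m where m: "l = 2 * m + 1" using odd by (auto elim: oddE)
      have "(\<Sum>i<l. i) = l * m"
      proof -
        have "(\<Sum>i<2*m+1. i) = (2 * m + 1) * m" for m :: nat by (induction m) auto
        then show ?thesis using m by simp
      qed
      ultimately have "S = l * (1 + l * (h * m + (\<Sum>i<l. g i)))" by (simp add: algebra_simps)
      moreover have "\<not> l dvd 1 + l * (h * m + (\<Sum>i<l. g i))"
      proof
        assume "l dvd 1 + l * (h * m + (\<Sum>i<l. g i))"
        then have "l dvd 1" using dvd_add_left_iff[of l "l * (h * m + (\<Sum>i<l. g i))" 1] by simp
        then show False using l2 by simp
      qed
      ultimately show ?thesis by blast
    qed
    then obtain f where f: "S = l * f" "\<not> l dvd f" by blast
    have "Q ^ (l ^ Suc j * d) = R ^ l" by (simp add: R_def power_mult[symmetric] mult_ac)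
    then have "Q ^ (l ^ Suc j * d) - 1 = (Q - 1) * l ^ Suc j * (e * f)"
      using Rl e(1) f by (simp add: R_def mult_ac)
    moreover have "\<not> l dvd e * f" using e(2) f(2) l(1) by (simp add: prime_dvd_mult_iff)
    ultimately show ?case by blast
  qed
  then show ?thesis using jk d by blast
qed

text \<open>Multiplication by b permutes the finite set G; comparing the products over G before and
  after gives the claim. The set G is merely closed under multiplication, since the span of the
  powers of a root is not yet known to be a field when the lemma is applied to it.\<close>

lemma (in field) power_card_eq_one:
  assumes G: "finite G" "G \<subseteq> carrier R - {\<zero>}" "b \<in> G" and m: "\<And>x y. x \<in> G \<Longrightarrow> y \<in> G \<Longrightarrow> x \<otimes> y \<in> G"
  shows "b [^] card G = \<one>"
proof -
  have bc: "b \<in> carrier R" "b \<noteq> \<zero>" using G by auto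
  have inj: "inj_on (\<lambda>x. b \<otimes> x) G"
  proof (rule inj_onI)
    fix x y assume "x \<in> G" "y \<in> G" "b \<otimes> x = b \<otimes> y"
    moreover from this have "x \<in> carrier R" "y \<in> carrier R" using G by auto
    ultimately show "x = y" using bc m_lcancel[of b x y] by blast
  qed
  have "(\<lambda>x. b \<otimes> x) ` G \<subseteq> G" using m G by auto
  then have img: "(\<lambda>x. b \<otimes> x) ` G = G" using endo_inj_surj G inj by blast
  define p where "p = (\<Otimes>x\<in>G. x)"
  have pc: "p \<in> carrier R" unfolding p_def using G by (intro finprod_closed) auto
  have pn: "p \<noteq> \<zero>"
  proof -
    have "(\<Otimes>x\<in>A. x) \<in> carrier R - {\<zero>}" if "A \<subseteq> G" for A
      using finite_subset[OF that G(1)] that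
    proof (induction A rule: finite_induct)
      case (insert x A)
      then have "(\<Otimes>x\<in>insert x A. x) = x \<otimes> (\<Otimes>x\<in>A. x)"
        using G by (intro finprod_insert) auto
      then show ?case using insert G by (auto simp: integral_iff)
    qed auto
    then show ?thesis by (simp add: p_def)
  qed
  have "p = (\<Otimes>x\<in>(\<lambda>x. b \<otimes> x) ` G. x)" using img by (simp add: p_def)
  also have "\<dots> = (\<Otimes>x\<in>G. b \<otimes> x)" using G bc inj by (subst finprod_reindex) auto
  also have "\<dots> = (\<Otimes>x\<in>G. b) \<otimes> p"
    unfolding p_def using G bc by (intro finprod_multf) auto
  also have "(\<Otimes>x\<in>G. b) = b [^] card G" using finprod_const[of b G] bc by simp
  finally have "\<one> \<otimes> p = b [^] card G \<otimes> p" using pc by simp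
  then show ?thesis using pc pn bc by (metis m_rcancel nat_pow_closed one_closed)
qed

text \<open>
  If \<open>D\<close> is the degree of \<open>b\<close> over \<open>K\<close>, then \<open>K(b)\<close> has \<open>Q\<^sup>D\<close> elements, so that the order of \<open>b\<close>
  divides \<open>Q\<^sup>D - 1\<close>.  For \<open>D < l\<^sup>k\<close> this number contains too few factors \<open>l\<close>.
\<close>

lemma (in field) independent_powers_of_root:
  fixes l k :: nat
  assumes K: "subfield K R" "finite K" "card K = Q"
    and l: "prime l" "l dvd Q - 1" "l = 2 \<Longrightarrow> 4 dvd Q - 1"
    and b: "b \<in> carrier R" "b [^] (l ^ k) = a" "a \<in> K" "a \<noteq> \<zero>" "a [^] ((Q - 1) div l) \<noteq> \<one>"
    and c: "c \<in> {..<l ^ k} \<rightarrow> K" "(\<Oplus>i\<in>{..<l ^ k}. c i \<otimes> b [^] i) = \<zero>"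
  shows "\<forall>i<l ^ k. c i = \<zero>"
proof -
  note Ksub = subfieldE[OF K(1)]
  have Kc: "x \<in> carrier R" if "x \<in> K" for x using Ksub(3) that by auto
  have Kcl: "\<zero> \<in> K" "\<one> \<in> K" "\<And>x y. x \<in> K \<Longrightarrow> y \<in> K \<Longrightarrow> x \<oplus> y \<in> K"
    "\<And>x y. x \<in> K \<Longrightarrow> y \<in> K \<Longrightarrow> x \<otimes> y \<in> K" "\<And>x. x \<in> K \<Longrightarrow> \<ominus> x \<in> K"
    using Ksub(1) by (auto dest: subringE)
  have Kinv: "inv x \<in> K" if "x \<in> K" "x \<noteq> \<zero>" for x
    using subfield_m_inv(1)[OF K(1)] that by auto
  have pc: "b [^] (i::nat) \<in> carrier R" for i :: nat using b by simp
  define s where "s c d = (\<Oplus>i\<in>{..<d}. c i \<otimes> b [^] i)" for c :: "nat \<Rightarrow> 'a" and d :: nat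
  have sS: "s c (Suc d) = c d \<otimes> b [^] d \<oplus> s c d" if "c \<in> {..<Suc d} \<rightarrow> K" for c d
    unfolding s_def lessThan_Suc using that Kc pc by (intro finsum_insert) (auto simp: Pi_def)
  have sc: "s c d \<in> carrier R" if "c \<in> {..<d} \<rightarrow> K" for c d
    unfolding s_def using that Kc pc by (intro finsum_closed) (auto simp: Pi_def)
  \<comment> \<open>\<open>V d\<close> is the span over K of the powers of b with exponent below
    d.\<close>
  define V where "V d = (\<lambda>c. s c d) ` ({..<d} \<rightarrow> K)" for d
  have Vc: "x \<in> carrier R" if "x \<in> V d" for x d using that sc by (auto simp: V_def)
  have Vadd: "x \<oplus> y \<in> V d" if xy: "x \<in> V d" "y \<in> V d" for x y d
  proof -
    obtain c c' where c: "c \<in> {..<d} \<rightarrow> K" "x = s c d" "c' \<in> {..<d} \<rightarrow> K" "y = s c' d"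
      using xy by (auto simp: V_def)
    have "s (\<lambda>i. c i \<oplus> c' i) d = (\<Oplus>i\<in>{..<d}. c i \<otimes> b [^] i \<oplus> c' i \<otimes> b [^] i)"
      unfolding s_def using c Kc pc by (intro finsum_cong') (auto simp: Pi_def l_distr)
    also have "\<dots> = s c d \<oplus> s c' d" unfolding s_def
      using c Kc pc by (intro finsum_addf) (auto simp: Pi_def)
    finally show ?thesis using c Kcl by (auto simp: V_def intro!: image_eqI[of _ _ "\<lambda>i. c i \<oplus> c' i"])
  qed
  have Vsc: "z \<otimes> x \<in> V d" if zx: "z \<in> K" "x \<in> V d" for z x d
  proof -
    obtain c where c: "c \<in> {..<d} \<rightarrow> K" "x = s c d" using zx by (auto simp: V_def)
    have "z \<otimes> s c d = (\<Oplus>i\<in>{..<d}. z \<otimes> (c i \<otimes> b [^] i))"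
      unfolding s_def using c Kc pc zx by (intro finsum_rdistr) (auto simp: Pi_def)
    also have "\<dots> = s (\<lambda>i. z \<otimes> c i) d"
      unfolding s_def using c Kc pc zx by (intro finsum_cong') (auto simp: Pi_def m_assoc)
    finally show ?thesis using c Kcl zx by (auto simp: V_def Pi_def intro!: image_eqI[of _ _ "\<lambda>i. z \<otimes> c i"])
  qed
  have Vz: "\<zero> \<in> V d" for d
  proof -
    have "s (\<lambda>_. \<zero>) d = \<zero>" unfolding s_def using pc by (simp add: finsum_zero)
    then show ?thesis using Kcl by (auto simp: V_def intro!: image_eqI[of _ _ "\<lambda>_. \<zero>"])
  qed
  have Vsum: "(\<Oplus>i\<in>A. f i) \<in> V d" if "finite A" "\<And>i. i \<in> A \<Longrightarrow> f i \<in> V d" for A :: "nat set" and f d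
    using that
  proof (induction A rule: finite_induct)
    case (insert x A)
    have "(\<Oplus>i\<in>insert x A. f i) = f x \<oplus> (\<Oplus>i\<in>A. f i)"
      using insert Vc by (intro finsum_insert) auto
    then show ?case using insert Vadd by auto
  qed (simp add: Vz)
  have Vpow: "b [^] i \<in> V d" if "i < d" for i d
  proof -
    have "s (\<lambda>j. if j = i then \<one> else \<zero>) d = (\<Oplus>j\<in>{..<d}. if i = j then b [^] j else \<zero>)"
      unfolding s_def using pc by (intro finsum_cong') auto
    also have "\<dots> = b [^] i" using that pc by (intro finsum_singleton) auto
    finally show ?thesis using Kcl
      by (auto simp: V_def intro!: image_eqI[of _ _ "\<lambda>j. if j = i then \<one> else \<zero>"])
  qed
  \<comment> \<open>The degree of b over K, without a minimal polynomial: the first power that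
    depends on the lower ones. It exists because b^(l^k) = a lies in
    \<open>V (l ^ k)\<close>.\<close>
  define D where "D = (LEAST d. b [^] d \<in> V d)"
  have lpos: "l ^ k > 0" using l(1) by (simp add: prime_gt_0_nat)
  have "b [^] (l ^ k) \<in> V (l ^ k)"
    using b Vsc[OF b(3) Vpow[OF lpos]] Kc[OF b(3)] by simp
  then have DV: "b [^] D \<in> V D" unfolding D_def by (rule LeastI)
  have less: "b [^] d \<notin> V d" if "d < D" for d using that not_less_Least unfolding D_def by blast
  have D0: "D > 0"
  proof (rule ccontr)
    assume "\<not> D > 0"
    then show False using DV by (simp add: V_def s_def)
  qed
  \<comment> \<open>Up to the degree the powers are independent: a nonzero top coefficient could be
    divided out, which would put b^d into \<open>V d\<close> for some d < D.\<close>
  have indep: "\<forall>i<d. c i = \<zero>" if "d \<le> D" "c \<in> {..<d} \<rightarrow> K" "s c d = \<zero>" for c d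
    using that
  proof (induction d)
    case (Suc d)
    have cK: "c d \<in> K" and cd: "c \<in> {..<d} \<rightarrow> K" using Suc.prems by auto
    have eq: "c d \<otimes> b [^] d \<oplus> s c d = \<zero>" using Suc.prems sS[of c d] by simp
    have "c d = \<zero>"
    proof (rule ccontr)
      assume nz: "c d \<noteq> \<zero>"
      have ic: "inv (c d) \<in> K" using Kinv cK nz by auto
      have u: "inv (c d) \<otimes> c d = \<one>" using Kc[OF cK] nz field_Units by auto
      have "c d \<otimes> b [^] d = \<ominus> s c d"
        using eq Kc[OF cK] pc sc[OF cd] by (intro minus_equality[symmetric]) auto
      then have "b [^] d = inv (c d) \<otimes> (\<ominus> s c d)"
        using u Kc[OF cK] Kc[OF ic] pc by (metis m_assoc l_one)
      also have "\<dots> = (\<ominus> (inv (c d))) \<otimes> s c d"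
        using Kc[OF ic] sc[OF cd] by (simp add: l_minus r_minus)
      also have "\<dots> \<in> V d" using ic cd Kcl by (intro Vsc) (auto simp: V_def)
      finally show False using less[of d] Suc.prems by auto
    qed
    moreover have "s c d = \<zero>" using eq \<open>c d = \<zero>\<close> pc sc[OF cd] by simp
    then have "\<forall>i<d. c i = \<zero>" using Suc.IH cd Suc.prems(1) by simp
    ultimately show ?case by (simp add: less_Suc_eq)
  qed simp
  have "l ^ k \<le> D"
  proof (rule ccontr)
    \<comment> \<open>If D were smaller, \<open>V D\<close> would be closed under multiplication and
      have Q^D elements, so that b^(Q^D - 1) = 1. This contradicts the choice of a.\<close>
    assume nD: "\<not> l ^ k \<le> D"
    have shift: "b \<otimes> x \<in> V D" if x: "x \<in> V D" for x
    proof -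
      obtain c where c: "c \<in> {..<D} \<rightarrow> K" "x = s c D" using x by (auto simp: V_def)
      have "b \<otimes> x = (\<Oplus>i\<in>{..<D}. b \<otimes> (c i \<otimes> b [^] i))"
        unfolding c s_def using c Kc pc b by (intro finsum_rdistr) (auto simp: Pi_def)
      also have "\<dots> = (\<Oplus>i\<in>{..<D}. c i \<otimes> b [^] Suc i)"
        using c Kc pc b by (intro finsum_cong') (auto simp: Pi_def m_ac)
      also have "\<dots> \<in> V D"
      proof (rule Vsum)
        fix i assume i: "i \<in> {..<D}"
        have "b [^] Suc i \<in> V D" using DV Vpow[of "Suc i" D] i by (cases "Suc i = D") auto
        then show "c i \<otimes> b [^] Suc i \<in> V D" using c i by (intro Vsc) auto
      qed simp
      finally show ?thesis .
    qed
    have shiftn: "b [^] i \<otimes> x \<in> V D" if x: "x \<in> V D" for x and i :: nat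
    proof (induction i)
      case 0 then show ?case using x Vc by simp
    next
      case (Suc i)
      have "b [^] Suc i \<otimes> x = b \<otimes> (b [^] i \<otimes> x)" using b pc Vc[OF x] by (simp add: m_ac)
      then show ?case using shift[OF Suc] by simp
    qed
    have Vm: "x \<otimes> y \<in> V D" if xy: "x \<in> V D" "y \<in> V D" for x y
    proof -
      obtain c where c: "c \<in> {..<D} \<rightarrow> K" "x = s c D" using xy by (auto simp: V_def)
      have "x \<otimes> y = (\<Oplus>i\<in>{..<D}. c i \<otimes> b [^] i \<otimes> y)"
        unfolding c s_def using c Kc pc Vc[OF xy(2)] by (intro finsum_ldistr) (auto simp: Pi_def)
      also have "\<dots> = (\<Oplus>i\<in>{..<D}. c i \<otimes> (b [^] i \<otimes> y))"
        using c Kc pc Vc[OF xy(2)] by (intro finsum_cong') (auto simp: Pi_def m_assoc)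
      also have "\<dots> \<in> V D"
        by (rule Vsum, simp, rule Vsc) (use c shiftn[OF xy(2)] in auto)
      finally show ?thesis .
    qed
    \<comment> \<open>Extensional coefficient functions are determined by their D values in K, so
      they can be counted.\<close>
    have VE: "V D = (\<lambda>c. s c D) ` ({..<D} \<rightarrow>\<^sub>E K)"
    proof -
      have "s c D \<in> (\<lambda>c. s c D) ` ({..<D} \<rightarrow>\<^sub>E K)" if "c \<in> {..<D} \<rightarrow> K" for c
      proof (rule image_eqI)
        show "restrict c {..<D} \<in> {..<D} \<rightarrow>\<^sub>E K" using that by auto
        show "s c D = s (restrict c {..<D}) D"
          unfolding s_def using that Kc pc by (intro finsum_cong') (auto simp: Pi_def)
      qed
      then have "V D \<subseteq> (\<lambda>c. s c D) ` ({..<D} \<rightarrow>\<^sub>E K)" unfolding V_def by blast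
      moreover have "(\<lambda>c. s c D) ` ({..<D} \<rightarrow>\<^sub>E K) \<subseteq> V D" unfolding V_def PiE_def by blast
      ultimately show ?thesis by (rule equalityI)
    qed
    have inj: "inj_on (\<lambda>c. s c D) ({..<D} \<rightarrow>\<^sub>E K)"
    proof (rule inj_onI)
      fix c c' assume c: "c \<in> {..<D} \<rightarrow>\<^sub>E K" "c' \<in> {..<D} \<rightarrow>\<^sub>E K" and eq: "s c D = s c' D"
      have cK: "c i \<in> K" "c' i \<in> K" if "i < D" for i using c that by auto
      have "s (\<lambda>i. c i \<oplus> (\<ominus> \<one>) \<otimes> c' i) D
          = (\<Oplus>i\<in>{..<D}. c i \<otimes> b [^] i \<oplus> (\<ominus> \<one>) \<otimes> (c' i \<otimes> b [^] i))"
        unfolding s_def using cK Kc pc by (intro finsum_cong') (auto simp: Pi_def l_distr m_assoc)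
      also have "\<dots> = s c D \<oplus> (\<Oplus>i\<in>{..<D}. (\<ominus> \<one>) \<otimes> (c' i \<otimes> b [^] i))"
        unfolding s_def using cK Kc pc by (intro finsum_addf) (auto simp: Pi_def)
      also have "(\<Oplus>i\<in>{..<D}. (\<ominus> \<one>) \<otimes> (c' i \<otimes> b [^] i)) = (\<ominus> \<one>) \<otimes> s c' D"
        unfolding s_def using cK Kc pc by (intro finsum_rdistr[symmetric]) (auto simp: Pi_def)
      also have "s c D \<oplus> (\<ominus> \<one>) \<otimes> s c' D = \<zero>"
        using eq sc[of c' D] cK by (simp add: l_minus r_neg Pi_def)
      finally have *: "\<forall>i<D. c i \<oplus> (\<ominus> \<one>) \<otimes> c' i = \<zero>"
        using cK Kcl by (intro indep) auto
      have "c i = c' i" if "i < D" for i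
      proof -
        have "c i \<oplus> (\<ominus> \<one>) \<otimes> c' i = \<zero>" using * that by blast
        then show ?thesis
          using cK[OF that] Kc[of "c i"] Kc[of "c' i"] r_right_minus_eq[of "c i" "c' i"]
          by (simp add: l_minus minus_eq)
      qed
      then show "c = c'" using PiE_ext[OF c] by auto
    qed
    have cardV: "card (V D) = Q ^ D"
      using K by (simp add: VE card_image[OF inj] card_PiE)
    have finV: "finite (V D)" using K by (auto simp: VE intro!: finite_PiE)
    have bV: "b \<in> V D"
      using Vpow[OF D0] shift[of \<one>] b by simp
    have b0: "b \<noteq> \<zero>"
      using b(2,4) lpos nat_pow_zero[of "l ^ k"] by auto
    have 1: "b [^] (Q ^ D - 1) = \<one>"
    proof -
      have "b [^] card (V D - {\<zero>}) = \<one>"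
        by (rule power_card_eq_one) (use finV Vc bV b0 Vm in \<open>auto simp: integral_iff\<close>)
      then show ?thesis using cardV finV Vz by simp
    qed
    have aK: "a [^] (Q - 1) = \<one>"
    proof -
      have "a [^] card (K - {\<zero>}) = \<one>"
        by (rule power_card_eq_one) (use K Kc Kcl b in \<open>auto simp: integral_iff\<close>)
      then show ?thesis using K Kcl by simp
    qed
    have "card {\<zero>, \<one>} \<le> card K" using K Kcl by (intro card_mono) auto
    then have Q2: "Q \<ge> 2" using K by simp
    obtain j e where je: "j < k" "Q ^ D - 1 = (Q - 1) * l ^ j * e" "\<not> l dvd e"
      using prime_power_factor_of_power_minus_one[OF l Q2 D0] nD by (metis not_le)
    obtain m where m: "Q - 1 = l * m" using l(2) by auto
    have mdef: "(Q - 1) div l = m" using m l(1) by (simp add: prime_gt_0_nat)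
    have ac: "a \<in> carrier R" using b Kc by auto
    \<comment> \<open>With Q - 1 = l m the exponent (Q^D - 1) l^(k-1-j) equals l^k m e, hence a^(m
      e) = 1. Also a^(m l) = a^(Q - 1) = 1, and l and e are coprime, so Bezout yields a^m = 1, which
      the choice of a excludes.\<close>
    have "l ^ k = l * l ^ j * l ^ (k - 1 - j)"
      using je(1) by (simp flip: power_add power_Suc)
    then have "(Q ^ D - 1) * l ^ (k - 1 - j) = l ^ k * (m * e)"
      unfolding je(2) m by (simp only: mult_ac)
    then have "b [^] (l ^ k * (m * e)) = (b [^] (Q ^ D - 1)) [^] (l ^ (k - 1 - j))"
      using b by (simp add: nat_pow_pow)
    then have "b [^] (l ^ k * (m * e)) = \<one>" using 1 by simp
    then have "a [^] (m * e) = \<one>" using nat_pow_pow[OF b(1), of "l ^ k" "m * e"] b(2) by simp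
    then have ae: "(a [^] m) [^] e = \<one>" using nat_pow_pow[OF ac, of m e] by simp
    have al: "(a [^] m) [^] l = \<one>" using aK nat_pow_pow[OF ac, of m l] m by (simp add: mult.commute)
    have "coprime l e" using l(1) je(3) by (simp add: prime_imp_coprime)
    then obtain x y where xy: "l * x = e * y + 1"
      using bezout_nat[of l e] l(1) by (auto simp: prime_gt_0_nat)
    have amc: "a [^] m \<in> carrier R" using ac by simp
    have "(a [^] m) [^] (l * x) = \<one>" using nat_pow_pow[OF amc, of l x] al by simp
    moreover have "(a [^] m) [^] (e * y + 1) = (a [^] m) [^] (e * y) \<otimes> a [^] m"
      using nat_pow_mult[OF amc, of "e * y" 1] amc by simp
    moreover have "(a [^] m) [^] (e * y) = \<one>" using nat_pow_pow[OF amc, of e y] ae by simp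
    ultimately have "a [^] m = \<one>" using xy amc by simp
    then show False using b(5) mdef by simp
  qed
  then show ?thesis using indep[of "l ^ k" c] c by (simp add: s_def)
qed

section \<open>Roots in the algebraic closure, the quadratic extension and its radical
  towers\<close>

lemma (in algebraically_closed) exists_root:
  assumes p: "p \<in> carrier (poly_ring L)" and d: "length p > 1"
  shows "\<exists>x\<in>carrier L. eval p x = \<zero>"
proof -
  have "size (roots p) = length p - 1" using roots_over_carrier[OF p] by (simp add: splitted_def)
  then obtain x where "x \<in># roots p" using d
    by (metis multiset_nonemptyE size_empty zero_less_diff less_irrefl)
  then have "is_root p x" using roots_mem_iff_is_root[OF p] by simp
  then show ?thesis by (auto simp: is_root_def)
qed

lemma (in algebraically_closed) exists_nat_root:
  assumes a: "a \<in> carrier L" and n: "n > (0 :: nat)"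
  shows "\<exists>x\<in>carrier L. x [^] n = a"
proof -
  obtain m where m: "n = Suc m" using n by (cases n) auto
  define p where "p = \<one> # replicate m \<zero> @ [\<ominus> a]"
  have "p \<in> carrier (poly_ring L)"
    using a by (auto simp: p_def univ_poly_carrier[symmetric] polynomial_def)
  moreover have "length p = Suc n" by (simp add: p_def m)
  ultimately obtain x where x: "x \<in> carrier L" "eval p x = \<zero>" using exists_root[of p] n by auto
  have "eval (replicate m \<zero> @ [\<ominus> a]) x = eval [\<ominus> a] x"
    using a x by (intro eval_replicate) auto
  then have "eval p x = x [^] n \<oplus> \<ominus> a" using x a by (simp add: p_def m)
  then have "x [^] n = a" using x a by (metis minus_eq nat_pow_closed r_right_minus_eq)
  then show ?thesis using x by blast
qed

text \<open>X^2 - X - a can serve for the quadratic extension in every characteristic. X^2 - a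
  cannot, as squaring is bijective on a finite field of characteristic 2.\<close>

lemma (in algebraically_closed) exists_artin_schreier_root:
  assumes a: "a \<in> carrier L"
  shows "\<exists>x\<in>carrier L. x \<otimes> x = x \<oplus> a"
proof -
  define p where "p = [\<one>, \<ominus> \<one>, \<ominus> a]"
  have "p \<in> carrier (poly_ring L)"
    using a by (auto simp: p_def univ_poly_carrier[symmetric] polynomial_def)
  then obtain x where x: "x \<in> carrier L" "eval p x = \<zero>" using exists_root[of p] by (auto simp: p_def)
  have "eval p x = x \<otimes> x \<ominus> (x \<oplus> a)"
    using x a by (simp add: p_def numeral_2_eq_2 l_minus minus_eq minus_add)
  then have "x \<otimes> x = x \<oplus> a" using x a r_right_minus_eq[of "x \<otimes> x" "x \<oplus> a"] by simp
  then show ?thesis using x by blast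
qed

text \<open>A Sylow subgroup of the additive group contains some x \<noteq> 0 that is annihilated by
  the order p^b of the subgroup; cancelling x leaves p^b times 1 = 0. This stands in for the theorem
  that the order of a finite field is a prime power.\<close>

lemma (in field) prime_divisor_of_card_imp_char:
  assumes fin: "finite (carrier R)" and p: "prime p" "p dvd card (carrier R)"
  shows "\<exists>b. add_pow R (p ^ b) \<one> = \<zero>"
proof -
  have pos: "card (carrier R) \<noteq> 0" using fin by auto
  define b where "b = multiplicity p (card (carrier R))"
  have b0: "b > 0" using p pos by (simp add: b_def prime_multiplicity_gt_zero_iff)
  obtain m where m: "card (carrier R) = p ^ b * m"
    using multiplicity_dvd[of p "card (carrier R)"] by (auto simp: b_def)
  have "\<exists>H. subgroup H (add_monoid R) \<and> card H = p ^ b"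
    by (rule sylow_thm[OF p(1) add.is_group _ ]) (use m fin in \<open>auto simp: Coset.order_def\<close>)
  then obtain H where H: "subgroup H (add_monoid R)" "card H = p ^ b" by blast
  have Hc: "H \<subseteq> carrier R" using H(1) subgroup.subset by force
  have "card H > 1" using H(2) b0 one_less_power[of p b] prime_gt_1_nat[OF p(1)] by simp
  then have "\<not> H \<subseteq> {\<zero>}" using card_mono[of "{\<zero>}" H] by auto
  then obtain x where x: "x \<in> H" "x \<noteq> \<zero>" by blast
  have "add_pow R (card H) x = \<zero>"
  proof -
    interpret H: group "(add_monoid R)\<lparr>carrier := H\<rparr>"
      using subgroup.subgroup_is_group[OF H(1) add.is_group] .
    have "pow ((add_monoid R)\<lparr>carrier := H\<rparr>) x (card H) = \<zero>"
      using H.pow_order_eq_1[of x] x by (simp add: Coset.order_def)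
    then show ?thesis by (simp add: add_pow_def nat_pow_def)
  qed
  then have "(add_pow R (p ^ b) \<one>) \<otimes> x = \<zero>" using Hc x H(2) add_pow_ldistr[of \<one> x "p ^ b"] by auto
  then have "add_pow R (p ^ b) \<one> = \<zero>" using x Hc by (auto simp: integral_iff)
  then show ?thesis by blast
qed

text \<open>Coprime powers of p and r would both annihilate 1, and Bezout gives 1 = 0. The case of
  interest is p = 2 and r = 3: an even q is not a multiple of 3.\<close>

lemma (in field) card_not_dvd_two_primes:
  assumes fin: "finite (carrier R)" and p: "prime p" "p dvd card (carrier R)"
    and r: "prime r" "r dvd card (carrier R)"
  shows "p = r"
proof (rule ccontr)
  assume ne: "p \<noteq> r"
  obtain a where a: "add_pow R (p ^ a) \<one> = \<zero>" using prime_divisor_of_card_imp_char[OF fin p] by blast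
  obtain b where b: "add_pow R (r ^ b) \<one> = \<zero>" using prime_divisor_of_card_imp_char[OF fin r] by blast
  have "coprime (p ^ a) (r ^ b)" using ne p r by (simp add: primes_coprime)
  then obtain x y where xy: "p ^ a * x = r ^ b * y + 1"
    using bezout_nat[of "p ^ a" "r ^ b"] p(1) by (auto simp: prime_gt_0_nat)
  have "add_pow R (p ^ a * x) \<one> = \<zero>" using a
    by (metis add.nat_pow_one add.nat_pow_pow mult.commute one_closed)
  moreover have "add_pow R (r ^ b * y) \<one> = \<zero>" using b
    by (metis add.nat_pow_one add.nat_pow_pow mult.commute one_closed)
  moreover have "add_pow R (r ^ b * y + 1) \<one> = add_pow R (r ^ b * y) \<one> \<oplus> \<one>" by simp
  ultimately show False using xy by simp
qed

text \<open>For k \<noteq> 0 some power k^(m+1) is 1, so k^m is the inverse of k and lies in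
  K.\<close>

lemma (in field) finite_subring_is_subfield:
  assumes K: "subring K R" "finite K"
  shows "subfield K R"
proof (rule subfieldI'[OF K(1)])
  fix k assume k: "k \<in> K - {\<zero>}"
  note S = subringE[OF K(1)]
  have kc: "k \<in> carrier R" using S k by auto
  have "k [^] card (K - {\<zero>}) = \<one>"
    by (rule power_card_eq_one) (use K k S in \<open>auto simp: integral_iff subset_iff\<close>)
  moreover have "card (K - {\<zero>}) > 0" using K k by (auto simp: card_gt_0_iff)
  ultimately obtain m :: nat where m: "k [^] Suc m = \<one>" by (metis Suc_pred)
  have "k [^] i \<in> K" for i :: nat by (induction i) (use S k in auto)
  then have km: "k [^] m \<in> K" .
  have "k [^] m \<otimes> k = \<one>" using m by simp
  then have "inv k = k [^] m" using kc S(1) km by (intro comm_inv_char) (auto simp: m_comm)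
  then show "inv k \<in> K" using km by simp
qed

text \<open>With d = (card K - 1) / l, the polynomial X^d - 1 has at most d roots, fewer than there
  are nonzero elements.\<close>

lemma (in field) exists_nonpower:
  assumes K: "subfield K R" "finite K" and l: "l dvd card K - 1" "l > 1"
  shows "\<exists>a\<in>K. a \<noteq> \<zero> \<and> a [^] ((card K - 1) div l) \<noteq> \<one>"
proof (rule ccontr)
  assume n: "\<not> ?thesis"
  interpret K: field "R\<lparr>carrier := K\<rparr>" using K(1) by (rule subfield_iff(2))
  have K01: "\<zero> \<in> K" "\<one> \<in> K" using subringE[OF subfieldE(1)[OF K(1)]] by auto
  have "card {\<zero>, \<one>} \<le> card K" using K K01 by (intro card_mono) auto
  then have c2: "card K \<ge> 2" by simp
  define d where "d = (card K - 1) div l"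
  obtain k where k: "card K - 1 = l * k" using l(1) by auto
  then have "k > 0" using c2 by (cases k) auto
  then have d: "d \<noteq> 0" "d < card K - 1" using l(2) k by (auto simp: d_def)
  have "card {x \<in> K. x [^] d = \<one>} \<le> d"
    using K.num_roots_le_deg[of d] d K by (simp flip: nat_pow_consistent)
  moreover have "K - {\<zero>} \<subseteq> {x \<in> K. x [^] d = \<one>}" using n by (auto simp: d_def)
  then have "card (K - {\<zero>}) \<le> card {x \<in> K. x [^] d = \<one>}" using K by (intro card_mono) auto
  ultimately show False using d K K01 by simp
qed

text \<open>L is an algebraic closure of F, so it contains the roots \<beta> for all k at once.
  \<open>\<pi>\<close> numbers the quadratic extension by the numbers below q^2 in such a way that
  on {..<q} it is the embedding of F; the input entries are then already elements of the extension
  and need no translation.\<close>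

lemma exists_field_with_root_towers:
  fixes F :: "nat ring"
  assumes F: "field F" "carrier F = {..<q}"
  shows "\<exists>(L :: ((nat list \<times> nat) multiset \<Rightarrow> nat) ring) \<pi> \<gamma> (l :: nat).
    field L \<and> (l = 2 \<or> l = 3) \<and> \<pi> \<in> ring_hom F L \<and> inj_on \<pi> {..<q\<^sup>2} \<and> subfield (\<pi> ` {..<q\<^sup>2}) L \<and>
    \<gamma> < q\<^sup>2 \<and> (\<forall>k. \<exists>\<beta>\<in>carrier L. \<beta> [^]\<^bsub>L\<^esub> (l ^ k) = \<pi> \<gamma> \<and>
      (\<forall>c\<in>{..<l ^ k} \<rightarrow> \<pi> ` {..<q\<^sup>2}.
        (\<Oplus>\<^bsub>L\<^esub>i\<in>{..<l ^ k}. c i \<otimes>\<^bsub>L\<^esub> \<beta> [^]\<^bsub>L\<^esub> i) = \<zero>\<^bsub>L\<^esub> \<longrightarrow> (\<forall>i<l ^ k. c i = \<zero>\<^bsub>L\<^esub>)))"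
proof -
  interpret F: field F by fact
  have fin: "finite (carrier F)" using F by simp
  have qc: "q = card (carrier F)" using F by simp
  have "card {\<zero>\<^bsub>F\<^esub>, \<one>\<^bsub>F\<^esub>} \<le> card (carrier F)" using fin by (intro card_mono) auto
  then have q2: "q \<ge> 2" using qc by simp
  define L where "L = F.alg_closure"
  define h :: "nat \<Rightarrow> (nat list \<times> nat) multiset \<Rightarrow> nat" where "h = F.indexed_const"
  interpret L: algebraic_closure L "h ` carrier F"
    unfolding L_def h_def by (rule F.alg_closureE)
  have hom: "h \<in> ring_hom F L" unfolding L_def h_def by (rule F.alg_closureE)
  interpret h: ring_hom_cring F L h
    using hom F.is_cring L.is_cring by (intro ring_hom_cringI) 
  have hinj: "inj_on h (carrier F)"
    using non_trivial_field_hom_is_inj[OF hom F.field_axioms L.field_axioms] by simp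
  \<comment> \<open>The map z^2 - z agrees at 0 and 1, so it is not injective and, F being finite,
    not onto. Hence some X^2 - X - c has no root in F.\<close>
  have "\<exists>c\<in>carrier F. \<forall>z\<in>carrier F. z \<otimes>\<^bsub>F\<^esub> z \<ominus>\<^bsub>F\<^esub> z \<noteq> c"
  proof (rule ccontr)
    assume n: "\<not> ?thesis"
    define g where "g z = z \<otimes>\<^bsub>F\<^esub> z \<ominus>\<^bsub>F\<^esub> z" for z
    have "carrier F \<subseteq> g ` carrier F" using n by (auto simp: g_def)
    then have "inj_on g (carrier F)" using fin by (metis card_image_le card_mono eq_card_imp_inj_on finite_imageI le_antisym)
    moreover have "g \<zero>\<^bsub>F\<^esub> = g \<one>\<^bsub>F\<^esub>" by (simp add: g_def F.minus_eq F.r_neg)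
    ultimately show False by (auto dest: inj_onD)
  qed
  then obtain c where c: "c \<in> carrier F" "\<And>z. z \<in> carrier F \<Longrightarrow> z \<otimes>\<^bsub>F\<^esub> z \<ominus>\<^bsub>F\<^esub> z \<noteq> c" by blast
  obtain \<xi> where x: "\<xi> \<in> carrier L" "\<xi> \<otimes>\<^bsub>L\<^esub> \<xi> = \<xi> \<oplus>\<^bsub>L\<^esub> h c"
    using L.exists_artin_schreier_root[of "h c"] c by auto
  have xF: "\<xi> \<notin> h ` carrier F"
  proof
    assume "\<xi> \<in> h ` carrier F"
    then obtain z where z: "z \<in> carrier F" "\<xi> = h z" by blast
    have "h (z \<otimes>\<^bsub>F\<^esub> z) = h (z \<oplus>\<^bsub>F\<^esub> c)" using x(2) z c by simp
    then have "z \<otimes>\<^bsub>F\<^esub> z = z \<oplus>\<^bsub>F\<^esub> c" by (rule inj_onD[OF hinj]) (use z c in auto)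
    then have "z \<otimes>\<^bsub>F\<^esub> z \<ominus>\<^bsub>F\<^esub> z = c" using z c
      by (metis F.a_comm F.minus_eq F.add.inv_closed F.a_assoc F.r_neg F.r_zero)
    then show False using c z by blast
  qed
  define f where "f a b = h a \<oplus>\<^bsub>L\<^esub> h b \<otimes>\<^bsub>L\<^esub> \<xi>" for a b
  have fc: "f a b \<in> carrier L" if "a \<in> carrier F" "b \<in> carrier F" for a b
    using that x by (simp add: f_def)
  \<comment> \<open>1 and \<xi> are independent over F: two representations with b \<noteq> b' would
    express \<xi> as a quotient of elements of F.\<close>
  have finj: "a = a' \<and> b = b'"
    if ab: "a \<in> carrier F" "b \<in> carrier F" "a' \<in> carrier F" "b' \<in> carrier F" and eq: "f a b = f a' b'"
    for a b a' b'
  proof -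
    have 1: "h (b \<ominus>\<^bsub>F\<^esub> b') \<otimes>\<^bsub>L\<^esub> \<xi> = h (a' \<ominus>\<^bsub>F\<^esub> a)"
    proof -
      have hc: "h a \<in> carrier L" "h b \<in> carrier L" "h a' \<in> carrier L" "h b' \<in> carrier L"
        using ab by auto
      have hd: "h (b \<ominus>\<^bsub>F\<^esub> b') = h b \<ominus>\<^bsub>L\<^esub> h b'" "h (a' \<ominus>\<^bsub>F\<^esub> a) = h a' \<ominus>\<^bsub>L\<^esub> h a"
        using ab by (simp_all add: F.minus_eq L.minus_eq)
      have "h (b \<ominus>\<^bsub>F\<^esub> b') \<otimes>\<^bsub>L\<^esub> \<xi> = (f a b \<ominus>\<^bsub>L\<^esub> h a) \<ominus>\<^bsub>L\<^esub> (f a' b' \<ominus>\<^bsub>L\<^esub> h a')"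
        unfolding hd f_def using hc x(1) by algebra
      also have "\<dots> = h (a' \<ominus>\<^bsub>F\<^esub> a)"
        unfolding hd eq using hc fc[OF ab(3,4)] by algebra
      finally show ?thesis .
    qed
    have bb: "b = b'"
    proof (rule ccontr)
      assume "b \<noteq> b'"
      define e where "e = b \<ominus>\<^bsub>F\<^esub> b'"
      have e: "e \<in> carrier F" "e \<noteq> \<zero>\<^bsub>F\<^esub>" using ab \<open>b \<noteq> b'\<close> by (auto simp: e_def)
      have ie: "inv\<^bsub>F\<^esub> e \<in> carrier F" using e by (rule F.inv_closed_nonzero)
      have "h (inv\<^bsub>F\<^esub> e \<otimes>\<^bsub>F\<^esub> e) = \<one>\<^bsub>L\<^esub>" using e F.field_Units by simp
      then have "h (inv\<^bsub>F\<^esub> e) \<otimes>\<^bsub>L\<^esub> h e = \<one>\<^bsub>L\<^esub>" using e ie by simp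
      then have "\<xi> = h (inv\<^bsub>F\<^esub> e) \<otimes>\<^bsub>L\<^esub> (h e \<otimes>\<^bsub>L\<^esub> \<xi>)"
        using e ie x by (simp flip: L.m_assoc)
      also have "\<dots> = h (inv\<^bsub>F\<^esub> e \<otimes>\<^bsub>F\<^esub> (a' \<ominus>\<^bsub>F\<^esub> a))"
        using 1 ie ab by (simp add: e_def)
      finally show False using xF ie ab by blast
    qed
    have "h a = h a'" using eq ab x unfolding f_def bb by simp
    then show ?thesis using bb hinj ab by (auto dest: inj_onD)
  qed
  have zq: "0 \<in> carrier F" using q2 F by simp
  \<comment> \<open>The base q digits are the coordinates. The 0 here is the element of F with
    number 0, which may differ from the zero of F; subtracting it makes the second coordinate vanish
    for a < q, so that \<open>\<pi>\<close> extends the embedding \<open>h\<close>.\<close>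
  define \<pi> where "\<pi> a = f (a mod q) (a div q \<ominus>\<^bsub>F\<^esub> 0)" for a
  have mq: "a mod q \<in> carrier F" for a using F q2 by simp
  have dq: "a div q \<in> carrier F" if "a < q\<^sup>2" for a
    using that F by (simp add: power2_eq_square less_mult_imp_div_less)
  have \<pi>c: "\<pi> a \<in> carrier L" if "a < q\<^sup>2" for a
    unfolding \<pi>_def using fc mq dq[OF that] zq by simp
  have \<pi>F: "\<pi> a = h a" if "a \<in> carrier F" for a
    using that F x h.hom_closed zq by (simp add: \<pi>_def f_def F.minus_eq F.r_neg)
  have \<pi>hom: "\<pi> \<in> ring_hom F L"
    using hom \<pi>F by (auto simp: ring_hom_def Pi_def)
  have \<pi>inj: "inj_on \<pi> {..<q\<^sup>2}"
  proof (rule inj_onI)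
    fix a b assume ab: "a \<in> {..<q\<^sup>2}" "b \<in> {..<q\<^sup>2}" "\<pi> a = \<pi> b"
    have "a mod q = b mod q \<and> a div q \<ominus>\<^bsub>F\<^esub> 0 = b div q \<ominus>\<^bsub>F\<^esub> 0"
      using finj[OF _ _ _ _ ab(3)[unfolded \<pi>_def]] mq dq ab zq by simp
    moreover from this have "a div q = b div q"
      using dq ab zq by (metis F.add.right_cancel F.a_inv_closed F.minus_eq lessThan_iff)
    ultimately show "a = b" by (metis div_mult_mod_eq)
  qed
  define K where "K = \<pi> ` {..<q\<^sup>2}"
  have KE: "K = {f a b | a b. a \<in> carrier F \<and> b \<in> carrier F}"
  proof
    show "K \<subseteq> {f a b | a b. a \<in> carrier F \<and> b \<in> carrier F}"
      using mq dq zq by (fastforce simp: K_def \<pi>_def)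
    show "{f a b | a b. a \<in> carrier F \<and> b \<in> carrier F} \<subseteq> K"
    proof clarify
      fix a b assume ab: "a \<in> carrier F" "b \<in> carrier F"
      define d where "d = b \<oplus>\<^bsub>F\<^esub> 0"
      have d: "d \<in> carrier F" using ab zq by (simp add: d_def)
      have lt: "a < q" "d < q" using d ab F by auto
      have "d \<ominus>\<^bsub>F\<^esub> 0 = b" using ab zq by (simp add: d_def F.minus_eq F.a_assoc F.r_neg)
      then have "\<pi> (d * q + a) = f a b" using lt by (simp add: \<pi>_def)
      moreover have "d * q + a < q\<^sup>2"
      proof -
        have "d * q + a < (d + 1) * q" using lt by simp
        also have "\<dots> \<le> q * q" using lt by (intro mult_right_mono) auto
        finally show ?thesis by (simp add: power2_eq_square)
      qed
      ultimately show "f a b \<in> K" unfolding K_def by (metis imageI lessThan_iff)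
    qed
  qed
  have Ksub: "subring K L"
  proof (rule L.subringI)
    show "K \<subseteq> carrier L" using fc by (auto simp: KE)
    have "f \<one>\<^bsub>F\<^esub> \<zero>\<^bsub>F\<^esub> = \<one>\<^bsub>L\<^esub>" using x by (simp add: f_def)
    then show "\<one>\<^bsub>L\<^esub> \<in> K" unfolding KE by (smt (verit, best) F.one_closed F.zero_closed mem_Collect_eq)
  next
    fix y assume "y \<in> K"
    then obtain a b where y: "a \<in> carrier F" "b \<in> carrier F" "y = f a b" by (auto simp: KE)
    have "\<ominus>\<^bsub>L\<^esub> y = f (\<ominus>\<^bsub>F\<^esub> a) (\<ominus>\<^bsub>F\<^esub> b)"
      using y x by (simp add: f_def L.minus_add L.l_minus)
    then show "\<ominus>\<^bsub>L\<^esub> y \<in> K" unfolding KE using y by blast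
  next
    fix y z assume "y \<in> K" "z \<in> K"
    then obtain a b a' b' where y: "a \<in> carrier F" "b \<in> carrier F" "y = f a b"
      and z: "a' \<in> carrier F" "b' \<in> carrier F" "z = f a' b'" by (auto simp: KE)
    have hc: "h a \<in> carrier L" "h b \<in> carrier L" "h a' \<in> carrier L" "h b' \<in> carrier L" "h c \<in> carrier L"
      using y z c by auto
    have "y \<oplus>\<^bsub>L\<^esub> z = f (a \<oplus>\<^bsub>F\<^esub> a') (b \<oplus>\<^bsub>F\<^esub> b')"
      using y(1,2) z(1,2) hc x(1) by (simp add: y(3) z(3) f_def L.l_distr L.a_ac)
    then show "y \<oplus>\<^bsub>L\<^esub> z \<in> K" unfolding KE using y z by blast
    have "y \<otimes>\<^bsub>L\<^esub> z = h a \<otimes>\<^bsub>L\<^esub> h a' \<oplus>\<^bsub>L\<^esub> (h a \<otimes>\<^bsub>L\<^esub> h b' \<oplus>\<^bsub>L\<^esub> h b \<otimes>\<^bsub>L\<^esub> h a') \<otimes>\<^bsub>L\<^esub> \<xi>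
        \<oplus>\<^bsub>L\<^esub> h b \<otimes>\<^bsub>L\<^esub> h b' \<otimes>\<^bsub>L\<^esub> (\<xi> \<otimes>\<^bsub>L\<^esub> \<xi>)"
      unfolding y(3) z(3) f_def using hc x(1) by algebra
    also have "\<dots> = (h a \<otimes>\<^bsub>L\<^esub> h a' \<oplus>\<^bsub>L\<^esub> h b \<otimes>\<^bsub>L\<^esub> h b' \<otimes>\<^bsub>L\<^esub> h c)
        \<oplus>\<^bsub>L\<^esub> (h a \<otimes>\<^bsub>L\<^esub> h b' \<oplus>\<^bsub>L\<^esub> h b \<otimes>\<^bsub>L\<^esub> h a' \<oplus>\<^bsub>L\<^esub> h b \<otimes>\<^bsub>L\<^esub> h b') \<otimes>\<^bsub>L\<^esub> \<xi>"
      unfolding x(2) using hc x(1) by algebra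
    also have "\<dots> = f (a \<otimes>\<^bsub>F\<^esub> a' \<oplus>\<^bsub>F\<^esub> b \<otimes>\<^bsub>F\<^esub> b' \<otimes>\<^bsub>F\<^esub> c)
        (a \<otimes>\<^bsub>F\<^esub> b' \<oplus>\<^bsub>F\<^esub> b \<otimes>\<^bsub>F\<^esub> a' \<oplus>\<^bsub>F\<^esub> b \<otimes>\<^bsub>F\<^esub> b')"
      using y z c by (simp add: f_def)
    finally show "y \<otimes>\<^bsub>L\<^esub> z \<in> K" unfolding KE using y z c by blast
  qed
  have Kfin: "finite K" by (simp add: K_def)
  have Kcard: "card K = q\<^sup>2" using \<pi>inj by (simp add: K_def card_image)
  have Kfield: "subfield K L" by (rule L.finite_subring_is_subfield[OF Ksub Kfin])
  \<comment> \<open>For odd q both q + 1 and q - 1 are even. For even q the number 3 does not divide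
    q, so it divides (q + 1) (q - 1).\<close>
  define l :: nat where "l = (if odd q then 2 else 3)"
  have l: "prime l" "l dvd card K - 1" "l = 2 \<Longrightarrow> 4 dvd card K - 1"
  proof -
    have q1: "q\<^sup>2 - 1 = (q + 1) * (q - 1)"
      using q2 by (simp add: power2_eq_square algebra_simps diff_mult_distrib2)
    show "prime l" by (simp add: l_def)
    show "l = 2 \<Longrightarrow> 4 dvd card K - 1"
    proof -
      assume "l = 2"
      then have "even (q + 1)" "even (q - 1)" using q2 by (auto simp: l_def split: if_splits)
      then have "2 * 2 dvd (q + 1) * (q - 1)" by (rule mult_dvd_mono)
      then show ?thesis using q1 Kcard by simp
    qed
    show "l dvd card K - 1"
    proof (cases "odd q")
      case True
      then show ?thesis using q2 Kcard q1 by (simp add: l_def)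
    next
      case False
      then have "\<not> 3 dvd q"
        using F.card_not_dvd_two_primes[OF fin, of 2 3] qc by auto
      then have "3 dvd (q + 1) * (q - 1)"
      proof -
        have "3 dvd q + 1 \<or> 3 dvd q - 1" using \<open>\<not> 3 dvd q\<close> by presburger
        then show ?thesis using dvd_mult[of 3 "q - 1" "q + 1"] dvd_mult2[of 3 "q + 1" "q - 1"] by blast
      qed
      then show ?thesis using False Kcard q1 by (simp add: l_def)
    qed
  qed
  obtain a where a: "a \<in> K" "a \<noteq> \<zero>\<^bsub>L\<^esub>" "a [^]\<^bsub>L\<^esub> ((card K - 1) div l) \<noteq> \<one>\<^bsub>L\<^esub>"
    using L.exists_nonpower[OF Kfield Kfin l(2)] prime_gt_1_nat[OF l(1)] by blast
  obtain \<gamma> where g: "\<gamma> < q\<^sup>2" "a = \<pi> \<gamma>" using a by (auto simp: K_def)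
  have tower: "\<exists>\<beta>\<in>carrier L. \<beta> [^]\<^bsub>L\<^esub> (l ^ k) = \<pi> \<gamma> \<and> (\<forall>c\<in>{..<l ^ k} \<rightarrow> K.
      (\<Oplus>\<^bsub>L\<^esub>i\<in>{..<l ^ k}. c i \<otimes>\<^bsub>L\<^esub> \<beta> [^]\<^bsub>L\<^esub> i) = \<zero>\<^bsub>L\<^esub> \<longrightarrow> (\<forall>i<l ^ k. c i = \<zero>\<^bsub>L\<^esub>))" for k
  proof -
    have "l ^ k > 0" using l(1) by (simp add: prime_gt_0_nat)
    then obtain \<beta> where b: "\<beta> \<in> carrier L" "\<beta> [^]\<^bsub>L\<^esub> (l ^ k) = a"
      using L.exists_nat_root[of a "l ^ k"] \<pi>c g by auto
    show ?thesis
    proof (rule bexI[OF _ b(1)], intro conjI ballI impI)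
      show "\<beta> [^]\<^bsub>L\<^esub> (l ^ k) = \<pi> \<gamma>" using b(2) g(2) by simp
    qed (rule L.independent_powers_of_root[OF Kfield Kfin refl l b a])
  qed
  have l23: "l = 2 \<or> l = 3" by (simp add: l_def)
  show ?thesis
    by (rule exI[of _ L], rule exI[of _ \<pi>], rule exI[of _ \<gamma>], rule exI[of _ l], intro conjI allI)
      (rule L.field_axioms l23 \<pi>hom \<pi>inj Kfield[unfolded K_def] g(1) tower[unfolded K_def])+
qed

section \<open>Step counts of programs\<close>

definition bounded_state :: "nat \<Rightarrow> state \<Rightarrow> bool" where
  "bounded_state M s \<longleftrightarrow> (\<forall>r. regs s r \<le> M) \<and> (\<forall>a. mem s a \<le> M)"

fun expr_size :: "expr \<Rightarrow> nat" where
  "expr_size (Const a) = 1"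
| "expr_size (Reg r) = 1"
| "expr_size (Load e) = expr_size e + 1"
| "expr_size (Bin f d e) = expr_size d + expr_size e + 1"

fun expr_consts :: "expr \<Rightarrow> nat set" where
  "expr_consts (Const a) = {a}"
| "expr_consts (Reg r) = {r}"
| "expr_consts (Load e) = expr_consts e"
| "expr_consts (Bin f d e) = expr_consts d \<union> expr_consts e"

text \<open>20 is a round bound on the sizes of the expressions in the program. Register numbers
  count among the constants, because accesses are charged for them too.\<close>

definition small_expr :: "nat \<Rightarrow> expr \<Rightarrow> bool" where
  "small_expr M e \<longleftrightarrow> expr_size e \<le> 20 \<and> (\<forall>a\<in>expr_consts e. a \<le> M)"

lemma expr_size_pos: "expr_size e > 0"
  by (induction e) auto

text \<open>Subexpressions may exceed M even if every cell respects it. A tree of size k stays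
  within M^k, whose length is at most k times that of M; M \<ge> 2 allows a sum to be bounded by a
  product.\<close>

lemma expr_val_le_power:
  assumes "bounded_state M s" "\<forall>a\<in>expr_consts e. a \<le> M" "M \<ge> 2"
  shows "expr_val e s \<le> M ^ expr_size e"
  using assms(2)
proof (induction e)
  case (Load e)
  have "mem s (expr_val e s) \<le> M" using assms(1) by (simp add: bounded_state_def)
  also have "M \<le> M ^ (expr_size e + 1)" using assms(3) by (intro self_le_power) auto
  finally show ?case by simp
next
  case (Bin f d e)
  have d: "expr_val d s \<le> M ^ expr_size d" and e: "expr_val e s \<le> M ^ expr_size e" using Bin by auto
  have M1: "1 \<le> M ^ k" for k using assms(3) by simp
  have m: "M ^ expr_size d * M ^ expr_size e * 2 \<le> M ^ expr_size (Bin f d e)"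
    using assms(3) by (simp add: power_add)
  have "x + y \<le> x * y * 2" if "1 \<le> x" "1 \<le> y" for x y :: nat
  proof -
    have "x \<le> x * y" "y \<le> x * y" using that by auto
    then show ?thesis by linarith
  qed
  from this[OF M1 M1] have a: "M ^ expr_size d + M ^ expr_size e \<le> M ^ expr_size (Bin f d e)"
    using m le_trans by blast
  show ?case
  proof (cases f)
    case Mult
    have "expr_val d s * expr_val e s \<le> M ^ expr_size d * M ^ expr_size e" using d e by (rule mult_mono) auto
    then show ?thesis using m Mult by simp
  next
    case Div
    have "expr_val d s div expr_val e s \<le> expr_val d s" by simp
    also have "\<dots> \<le> M ^ expr_size (Bin f d e)" using d a by linarith
    finally show ?thesis using Div by simp
  qed (use d e a M1[of "expr_size (Bin f d e)"] in auto)
qed (use assms in \<open>auto simp: bounded_state_def\<close>)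

lemma word_cost_mono: "a \<le> b \<Longrightarrow> word_cost a \<le> word_cost b"
  by (simp add: word_cost_def floorlog_mono)

lemma word_cost_power: "k > 0 \<Longrightarrow> word_cost (M ^ k) \<le> k * word_cost M"
proof -
  assume k: "k > 0"
  have "M < 2 ^ floorlog 2 M" by (rule floorlog_leD) auto
  then have "M ^ k < (2 ^ floorlog 2 M) ^ k" using k by (intro power_strict_mono) auto
  then have "floorlog 2 (M ^ k) \<le> k * floorlog 2 M"
    by (intro floorlog_leI) (simp_all add: power_mult[symmetric] mult.commute)
  then show ?thesis using k by (simp add: word_cost_def add_mult_distrib2)
qed

text \<open>Every node is charged the lengths of its operands, which are at most their sizes times
  the length of M. Summed over the tree this is quadratic in the size.\<close>

lemma expr_cost_le:
  assumes "bounded_state M s" "\<forall>a\<in>expr_consts e. a \<le> M" "M \<ge> 2"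
  shows "expr_cost e s \<le> 2 * (expr_size e)\<^sup>2 * word_cost M"
    and "word_cost (expr_val e s) \<le> expr_size e * word_cost M"
proof -
  have v: "word_cost (expr_val e s) \<le> expr_size e * word_cost M" if "\<forall>a\<in>expr_consts e. a \<le> M" for e
    using word_cost_mono[OF expr_val_le_power[OF assms(1) that assms(3)]]
      word_cost_power[OF expr_size_pos, of M e] by linarith
  then show "word_cost (expr_val e s) \<le> expr_size e * word_cost M" using assms(2) .
  have w: "word_cost (regs s r) \<le> word_cost M" "word_cost (mem s r) \<le> word_cost M" for r
    using assms(1) by (auto simp: bounded_state_def intro: word_cost_mono)
  show "expr_cost e s \<le> 2 * (expr_size e)\<^sup>2 * word_cost M"
    using assms(2)
  proof (induction e)
    case (Const a)
    then show ?case using word_cost_mono[of a M] by simp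
  next
    case (Reg r)
    then show ?case using word_cost_mono[of r M] w(1)[of r] by simp
  next
    case (Load e)
    then have "expr_cost (Load e) s \<le> (2 * (expr_size e)\<^sup>2 + expr_size e + 1) * word_cost M"
      using v[of e] w(2)[of "expr_val e s"] by (simp add: algebra_simps)
    also have "\<dots> \<le> (2 * (expr_size (Load e))\<^sup>2) * word_cost M"
      by (intro mult_right_mono) (auto simp: power2_eq_square)
    finally show ?case .
  next
    case (Bin f d e)
    then have "expr_cost (Bin f d e) s
        \<le> (2 * (expr_size d)\<^sup>2 + 2 * (expr_size e)\<^sup>2 + expr_size d + expr_size e) * word_cost M"
      using v[of e] v[of d] by (simp add: algebra_simps)
    also have "\<dots> \<le> (2 * (expr_size (Bin f d e))\<^sup>2) * word_cost M"
      by (intro mult_right_mono) (auto simp: power2_eq_square algebra_simps)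
    finally show ?case .
  qed
qed

text \<open>The dearest elementary step is a store: two expressions at 800 and two words at 20 make
  1640, rounded up to 2000.\<close>

definition step_cost :: "nat \<Rightarrow> nat" where
  "step_cost M = 2000 * word_cost M"

lemma small_expr_cost:
  assumes "bounded_state M s" "small_expr M e" "M \<ge> 2"
  shows "expr_cost e s \<le> 800 * word_cost M" "word_cost (expr_val e s) \<le> 20 * word_cost M"
proof -
  have sz: "expr_size e \<le> 20" and c: "\<forall>a\<in>expr_consts e. a \<le> M" using assms(2) by (auto simp: small_expr_def)
  have "(expr_size e)\<^sup>2 \<le> 20\<^sup>2" using sz by (rule power_mono) simp
  then have "2 * (expr_size e)\<^sup>2 * word_cost M \<le> 800 * word_cost M" by (intro mult_right_mono) auto
  then show "expr_cost e s \<le> 800 * word_cost M" using expr_cost_le(1)[OF assms(1) c assms(3)] by (rule order_trans[rotated])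
  have "expr_size e * word_cost M \<le> 20 * word_cost M" using sz by (intro mult_right_mono) auto
  then show "word_cost (expr_val e s) \<le> 20 * word_cost M" using expr_cost_le(2)[OF assms(1) c assms(3)] by (rule order_trans[rotated])
qed

text \<open>
  As long as all cells hold values at most \<open>M\<close>, every elementary step costs \<open>O(log M)\<close>, so that it
  suffices to count steps.
\<close>

definition runs :: "nat \<Rightarrow> com \<Rightarrow> state \<Rightarrow> nat \<Rightarrow> (state \<Rightarrow> bool) \<Rightarrow> bool" where
  "runs M c s k Q \<longleftrightarrow> (bounded_state M s \<longrightarrow>
     (\<exists>t s'. exec c s t s' \<and> t \<le> k * step_cost M \<and> bounded_state M s' \<and> Q s'))"

lemma runs_mono: "runs M c s k Q \<Longrightarrow> k \<le> k' \<Longrightarrow> (\<And>s'. bounded_state M s' \<Longrightarrow> Q s' \<Longrightarrow> Q' s') \<Longrightarrow> runs M c s k' Q'"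
  unfolding runs_def by (meson le_trans mult_right_mono zero_le)

lemma runs_bounded: "(bounded_state M s \<Longrightarrow> runs M c s k Q) \<Longrightarrow> runs M c s k Q"
  unfolding runs_def by blast

lemma runs_Skip: "Q s \<Longrightarrow> runs M Skip s 1 Q"
proof -
  assume "Q s"
  moreover have "1 \<le> 1 * step_cost M" by (simp add: step_cost_def word_cost_def)
  ultimately show ?thesis unfolding runs_def using exec.Skip by blast
qed

lemma runs_Assign:
  assumes "small_expr M e" "M \<ge> 2" "r \<le> M"
    and "bounded_state M s \<Longrightarrow> expr_val e s \<le> M"
    and "bounded_state M s \<Longrightarrow> Q (s\<lparr>regs := (regs s)(r := expr_val e s)\<rparr>)"
  shows "runs M (Assign r e) s 1 Q"
  unfolding runs_def
proof (intro impI exI conjI)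
  assume b: "bounded_state M s"
  show "exec (Assign r e) s (expr_cost e s + word_cost r + word_cost (expr_val e s))
     (s\<lparr>regs := (regs s)(r := expr_val e s)\<rparr>)" by (rule exec.Assign)
  show "expr_cost e s + word_cost r + word_cost (expr_val e s) \<le> 1 * step_cost M"
    using small_expr_cost[OF b assms(1,2)] word_cost_mono[OF assms(3)] by (simp add: step_cost_def)
  show "bounded_state M (s\<lparr>regs := (regs s)(r := expr_val e s)\<rparr>)"
    using b assms(4)[OF b] by (simp add: bounded_state_def)
qed (rule assms(5))

lemma runs_Store:
  assumes "small_expr M d" "small_expr M e" "M \<ge> 2"
    and "bounded_state M s \<Longrightarrow> expr_val e s \<le> M"
    and "bounded_state M s \<Longrightarrow> Q (s\<lparr>mem := (mem s)(expr_val d s := expr_val e s)\<rparr>)"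
  shows "runs M (Store d e) s 1 Q"
  unfolding runs_def
proof (intro impI exI conjI)
  assume b: "bounded_state M s"
  show "exec (Store d e) s (expr_cost d s + expr_cost e s + word_cost (expr_val d s) + word_cost (expr_val e s))
     (s\<lparr>mem := (mem s)(expr_val d s := expr_val e s)\<rparr>)" by (rule exec.Store)
  show "expr_cost d s + expr_cost e s + word_cost (expr_val d s) + word_cost (expr_val e s) \<le> 1 * step_cost M"
    using small_expr_cost[OF b assms(1,3)] small_expr_cost[OF b assms(2,3)] by (simp add: step_cost_def)
  show "bounded_state M (s\<lparr>mem := (mem s)(expr_val d s := expr_val e s)\<rparr>)"
    using b assms(4)[OF b] by (simp add: bounded_state_def)
qed (rule assms(5))

lemma runs_Seq:
  assumes "runs M c s k (\<lambda>s'. runs M c' s' k' Q)"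
  shows "runs M (Seq c c') s (k + k') Q"
  unfolding runs_def
proof
  assume b: "bounded_state M s"
  then obtain t s' where 1: "exec c s t s'" "t \<le> k * step_cost M" "bounded_state M s'" "runs M c' s' k' Q"
    using assms unfolding runs_def by blast
  then obtain t' s'' where 2: "exec c' s' t' s''" "t' \<le> k' * step_cost M" "bounded_state M s''" "Q s''"
    unfolding runs_def by blast
  have "exec (Seq c c') s (t + t') s''" using 1 2 by (blast intro: exec.Seq)
  moreover have "t + t' \<le> (k + k') * step_cost M" using 1 2 by (simp add: add_mult_distrib)
  ultimately show "\<exists>t s'. exec (Seq c c') s t s' \<and> t \<le> (k + k') * step_cost M \<and> bounded_state M s' \<and> Q s'"
    using 2 by blast
qed

lemma runs_Cond:
  assumes "small_expr M e" "M \<ge> 2"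
    and "expr_val e s \<noteq> 0 \<Longrightarrow> runs M c s k Q" "expr_val e s = 0 \<Longrightarrow> runs M c' s k Q"
  shows "runs M (Cond e c c') s (k + 1) Q"
  unfolding runs_def
proof
  assume b: "bounded_state M s"
  have c: "expr_cost e s + word_cost (expr_val e s) \<le> step_cost M"
    using small_expr_cost[OF b assms(1,2)] by (simp add: step_cost_def)
  show "\<exists>t s'. exec (Cond e c c') s t s' \<and> t \<le> (k + 1) * step_cost M \<and> bounded_state M s' \<and> Q s'"
  proof (cases "expr_val e s = 0")
    case True
    then obtain t s' where 1: "exec c' s t s'" "t \<le> k * step_cost M" "bounded_state M s'" "Q s'"
      using assms(4) b unfolding runs_def by blast
    show ?thesis using exec.CondFalse[OF True 1(1), of c] 1 c
      by (intro exI conjI) (assumption | simp)+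
  next
    case False
    then obtain t s' where 1: "exec c s t s'" "t \<le> k * step_cost M" "bounded_state M s'" "Q s'"
      using assms(3) b unfolding runs_def by blast
    show ?thesis using exec.CondTrue[OF False 1(1), of c'] 1 c
      by (intro exI conjI) (assumption | simp)+
  qed
qed

text \<open>Indexing the invariant by the number of completed iterations gives termination and the
  iteration count together. Each iteration pays one step for its test, and the final 1 is the
  failing test.\<close>

lemma runs_While:
  assumes e: "small_expr M e" "M \<ge> 2"
    and step: "\<And>i s. i < n \<Longrightarrow> I i s \<Longrightarrow> bounded_state M s \<Longrightarrow> expr_val e s \<noteq> 0 \<and> runs M c s k (I (Suc i))"
    and stop: "\<And>s. I n s \<Longrightarrow> bounded_state M s \<Longrightarrow> expr_val e s = 0"
    and I: "I 0 s"
  shows "runs M (While e c) s (n * (k + 1) + 1) (I n)"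
proof -
  have "runs M (While e c) s ((n - i) * (k + 1) + 1) (I n)" if "i \<le> n" "I i s" for i s
    using that
  proof (induction "n - i" arbitrary: i s)
    case 0
    show ?case
    proof (rule runs_bounded)
      assume b: "bounded_state M s"
      have I: "I n s" using 0 by simp
      have c: "expr_cost e s + word_cost (expr_val e s) \<le> step_cost M"
        using small_expr_cost[OF b e] by (simp add: step_cost_def)
      have x: "exec (While e c) s (expr_cost e s + word_cost (expr_val e s)) s"
        by (rule exec.WhileFalse) (rule stop[OF I b])
      show ?thesis unfolding runs_def
        by (intro impI exI conjI, rule x) (use c b I in \<open>auto simp: add_mult_distrib\<close>)
    qed
  next
    case (Suc m)
    have i: "i < n" using Suc by simp
    show ?case
    proof (rule runs_bounded)
      assume b: "bounded_state M s"
      have c: "expr_cost e s + word_cost (expr_val e s) \<le> step_cost M"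
        using small_expr_cost[OF b e] by (simp add: step_cost_def)
      have nz: "expr_val e s \<noteq> 0" and r: "runs M c s k (I (Suc i))" using step[OF i Suc.prems(2) b] by auto
      obtain t s' where 1: "exec c s t s'" "t \<le> k * step_cost M" "bounded_state M s'" "I (Suc i) s'"
        using r b unfolding runs_def by blast
      have "runs M (While e c) s' ((n - Suc i) * (k + 1) + 1) (I n)"
        using Suc.hyps(1)[of "Suc i" s'] Suc.hyps(2) i 1 by simp
      then obtain t' s'' where 2: "exec (While e c) s' t' s''"
        "t' \<le> ((n - Suc i) * (k + 1) + 1) * step_cost M" "bounded_state M s''" "I n s''"
        using 1 unfolding runs_def by blast
      have "exec (While e c) s (expr_cost e s + word_cost (expr_val e s) + t + t') s''"
        using nz 1 2 by (blast intro: exec.WhileTrue)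
      moreover have "expr_cost e s + word_cost (expr_val e s) + t + t' \<le> ((n - i) * (k + 1) + 1) * step_cost M"
      proof -
        have "n - i = Suc (n - Suc i)" using i by simp
        then have "((n - i) * (k + 1) + 1) * step_cost M
            = step_cost M + k * step_cost M + ((n - Suc i) * (k + 1) + 1) * step_cost M"
          by (simp add: algebra_simps)
        then show ?thesis using c 1 2 by linarith
      qed
      ultimately show ?thesis using 2 unfolding runs_def by blast
    qed
  qed
  from this[of 0 s] show ?thesis using I by simp
qed

definition For :: "nat \<Rightarrow> nat \<Rightarrow> com \<Rightarrow> com" where
  "For v b c = Seq (Assign v (Const 0))
     (While (Bin Less (Reg v) (Reg b)) (Seq c (Assign v (Bin Add (Reg v) (Const 1)))))"

text \<open>Each iteration pays for a test and an increment; the constant 2 is the initialisation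
  and the failing test. The invariant is asserted of states whose counter already has its next
  value, and the body has to preserve the counter and the register that holds the bound.\<close>

lemma runs_For:
  assumes M: "M \<ge> 2" "v \<le> M" "b \<le> M" and n: "regs s b = n" "n \<le> M" "v \<noteq> b"
    and I0: "I 0 (s\<lparr>regs := (regs s)(v := 0)\<rparr>)"
    and step: "\<And>i s. i < n \<Longrightarrow> I i s \<Longrightarrow> regs s v = i \<Longrightarrow> regs s b = n \<Longrightarrow>
      runs M c s k (\<lambda>s'. regs s' v = i \<and> regs s' b = n \<and> I (Suc i) (s'\<lparr>regs := (regs s')(v := Suc i)\<rparr>))"
    and fin: "\<And>s. I n s \<Longrightarrow> regs s v = n \<Longrightarrow> regs s b = n \<Longrightarrow> Q s"
  shows "runs M (For v b c) s (n * (k + 2) + 2) Q"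
proof -
  let ?J = "\<lambda>i s. I i s \<and> regs s v = i \<and> regs s b = n"
  have e: "small_expr M (Bin Less (Reg v) (Reg b))" using M by (simp add: small_expr_def)
  have "runs M (While (Bin Less (Reg v) (Reg b)) (Seq c (Assign v (Bin Add (Reg v) (Const 1)))))
      (s\<lparr>regs := (regs s)(v := 0)\<rparr>) (n * ((k + 1) + 1) + 1) (?J n)"
  proof (rule runs_While[OF e M(1), where I = ?J])
    fix i s assume i: "i < n" and J: "?J i s"
    have "runs M (Seq c (Assign v (Bin Add (Reg v) (Const 1)))) s (k + 1) (?J (Suc i))"
    proof (rule runs_Seq, rule runs_mono)
      show "runs M c s k (\<lambda>s'. regs s' v = i \<and> regs s' b = n \<and> I (Suc i) (s'\<lparr>regs := (regs s')(v := Suc i)\<rparr>))"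
        using step[OF i] J by blast
      fix s' assume h: "regs s' v = i \<and> regs s' b = n \<and> I (Suc i) (s'\<lparr>regs := (regs s')(v := Suc i)\<rparr>)"
      show "runs M (Assign v (Bin Add (Reg v) (Const 1))) s' 1 (?J (Suc i))"
        by (rule runs_Assign) (use M h i n in \<open>auto simp: small_expr_def\<close>)
    qed simp
    then show "expr_val (Bin Less (Reg v) (Reg b)) s \<noteq> 0 \<and>
        runs M (Seq c (Assign v (Bin Add (Reg v) (Const 1)))) s (k + 1) (?J (Suc i))"
      using J i by simp
  qed (use I0 n in auto)
  then have "runs M (While (Bin Less (Reg v) (Reg b)) (Seq c (Assign v (Bin Add (Reg v) (Const 1)))))
      (s\<lparr>regs := (regs s)(v := 0)\<rparr>) (n * (k + 2) + 1) Q"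
    by (rule runs_mono) (use fin in auto)
  then have "runs M (For v b c) s (1 + (n * (k + 2) + 1)) Q"
    unfolding For_def by (intro runs_Seq runs_Assign) (use M in \<open>auto simp: small_expr_def\<close>)
  then show ?thesis by simp
qed

text \<open>
  The time of a binary decision tree depends only on its depth, not on the size of the program.
  This is how the operations of a finite field are hard-coded.
\<close>

fun switch :: "nat \<Rightarrow> nat \<Rightarrow> nat \<Rightarrow> (nat \<Rightarrow> com) \<Rightarrow> com" where
  "switch r 0 lo f = f lo"
| "switch r (Suc d) lo f = Cond (Bin Less (Reg r) (Const (lo + 2 ^ d)))
     (switch r d lo f) (switch r d (lo + 2 ^ d) f)"

lemma runs_switch:
  assumes "lo \<le> regs s r" "regs s r < lo + 2 ^ d" "lo + 2 ^ d \<le> M" "r \<le> M" "M \<ge> 2"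
    and "runs M (f (regs s r)) s k Q"
  shows "runs M (switch r d lo f) s (k + d) Q"
  using assms(1-3)
proof (induction d arbitrary: lo)
  case 0
  then have "lo = regs s r" by simp
  then show ?case using assms(6) by simp
next
  case (Suc d)
  have "runs M (switch r (Suc d) lo f) s ((k + d) + 1) Q"
    unfolding switch.simps
  proof (rule runs_Cond)
    show "small_expr M (Bin Less (Reg r) (Const (lo + 2 ^ d)))"
      using Suc.prems assms(4) by (auto simp: small_expr_def)
  qed (use Suc assms(5) in \<open>auto split: if_splits\<close>)
  then show ?case by simp
qed

definition table_op :: "nat \<Rightarrow> (nat \<Rightarrow> nat \<Rightarrow> nat) \<Rightarrow> nat \<Rightarrow> nat \<Rightarrow> nat \<Rightarrow> com" where
  "table_op d f r a b = switch a d 0 (\<lambda>x. switch b d 0 (\<lambda>y. Assign r (Const (f x y))))"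

lemma runs_table_op:
  assumes "regs s a < 2 ^ d" "regs s b < 2 ^ d" "2 ^ d \<le> M" "a \<le> M" "b \<le> M" "r \<le> M" "M \<ge> 2"
    and "f (regs s a) (regs s b) \<le> M"
    and "Q (s\<lparr>regs := (regs s)(r := f (regs s a) (regs s b))\<rparr>)"
  shows "runs M (table_op d f r a b) s (1 + d + d) Q"
  unfolding table_op_def
  by (intro runs_switch runs_Assign) (use assms in \<open>auto simp: small_expr_def\<close>)

section \<open>The verification program\<close>

lemma runs_le: "runs M c s k Q \<Longrightarrow> k \<le> k' \<Longrightarrow> runs M c s k' Q"
  by (rule runs_mono)

lemma runs_Cond_max:
  assumes "small_expr M e" "M \<ge> 2"
    and "expr_val e s \<noteq> 0 \<Longrightarrow> runs M c s k Q" "expr_val e s = 0 \<Longrightarrow> runs M c' s k' Q"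
  shows "runs M (Cond e c c') s (max k k' + 1) Q"
  by (rule runs_Cond[OF assms(1,2)]) (auto intro: runs_le assms(3,4))

definition same_regs :: "nat set \<Rightarrow> (nat \<Rightarrow> nat) \<Rightarrow> (nat \<Rightarrow> nat) \<Rightarrow> bool" where
  "same_regs W f g \<longleftrightarrow> (\<forall>r. r \<notin> W \<longrightarrow> g r = f r)"

lemma same_regs_refl [simp]: "same_regs W f f"
  by (simp add: same_regs_def)

lemma same_regs_trans: "same_regs V f g \<Longrightarrow> same_regs W g h \<Longrightarrow> V \<union> W \<subseteq> U \<Longrightarrow> same_regs U f h"
  unfolding same_regs_def by (metis Un_iff subsetD)

lemma same_regs_upd [simp]: "r \<in> W \<Longrightarrow> same_regs W f (g(r := x)) = same_regs W f g"
  "r \<in> W \<Longrightarrow> same_regs W (f(r := x)) g = same_regs W f g"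
  by (auto simp: same_regs_def)

section \<open>The program text, fixed by the arithmetic tables of the quadratic extension\<close>

locale field_tables = field L for L (structure) +
  fixes \<pi> :: "nat \<Rightarrow> 'a" and Q e \<gamma> zero_cell one_cell :: nat and add sub mul :: "nat \<Rightarrow> nat \<Rightarrow> nat"
  assumes \<pi>_closed [simp]: "a < Q \<Longrightarrow> \<pi> a \<in> carrier L"
    and Q_le: "Q \<le> 2 ^ e" and Q_gt: "1 < Q" and \<gamma>_less [simp]: "\<gamma> < Q"
    and zero_cell [simp]: "zero_cell < Q" "\<pi> zero_cell = \<zero>" and one_cell [simp]: "one_cell < Q" "\<pi> one_cell = \<one>"
    and add: "a < Q \<Longrightarrow> b < Q \<Longrightarrow> add a b < Q \<and> \<pi> (add a b) = \<pi> a \<oplus> \<pi> b"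
    and sub: "a < Q \<Longrightarrow> b < Q \<Longrightarrow> sub a b < Q \<and> \<pi> (sub a b) = \<pi> a \<ominus> \<pi> b"
    and mul: "a < Q \<Longrightarrow> b < Q \<Longrightarrow> mul a b < Q \<and> \<pi> (mul a b) = \<pi> a \<otimes> \<pi> b"
begin

text \<open>
  Registers: 1 holds \<open>n\<close>, 2 the degree \<open>N\<close> of the extension, 3--6 the start addresses of the seed
  (\<open>N\<close> cells), of the vector \<open>x\<close> (\<open>n\<close> blocks of \<open>N\<close> coordinates), of a buffer for products
  (\<open>N\<close> cells) and of \<open>B x\<close> (\<open>n\<close> cells); 7 holds \<open>\<gamma>\<close>, 8 the number \<open>2 ^ N\<close>.  Registers 10--14
  are loop counters, 15 the address of the current block of \<open>x\<close>, 16 the unread bits of an index,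
  and 17--21 are temporary.
\<close>

definition fill :: "nat \<Rightarrow> com" where
  "fill b = For 12 2 (Store (Bin Add (Reg b) (Reg 12)) (Const zero_cell))"

definition copy :: com where
  "copy = For 12 2 (Store (Bin Add (Reg 15) (Reg 12)) (Load (Bin Add (Reg 5) (Reg 12))))"

text \<open>One step of schoolbook multiplication modulo X^N - \<gamma>. The product of coordinates
  c and d belongs at position c + d; since c + d < 2 N, a single wrap-around with a factor \<gamma>
  suffices.\<close>

definition add_product :: com where
  "add_product =
     Seq (Assign 18 (Load (Bin Add (Reg 15) (Reg 13))))
    (Seq (table_op e mul 18 18 17)
    (Seq (Assign 21 (Bin Add (Reg 12) (Reg 13)))
    (Seq (Cond (Bin Less (Reg 21) (Reg 2)) Skip
           (Seq (Assign 21 (Bin Monus (Reg 21) (Reg 2))) (table_op e mul 18 18 7)))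
    (Seq (Assign 19 (Load (Bin Add (Reg 5) (Reg 21))))
    (Seq (table_op e add 19 19 18)
         (Store (Bin Add (Reg 5) (Reg 21)) (Reg 19)))))))"

text \<open>The current block is multiplied by seed minus index. The binary digits of the index
  serve as its coordinates and are read off register 16 from the lowest on; as the machine has no
  remainder operation, a digit is computed as z - 2 (z div 2).\<close>

definition times_diff :: com where
  "times_diff =
     Seq (fill 5)
    (Seq (Assign 16 (Reg 11))
    (Seq (For 12 2
           (Seq (Assign 17 (Load (Bin Add (Reg 3) (Reg 12))))
           (Seq (Assign 18 (Bin Monus (Reg 16) (Bin Mult (Const 2) (Bin Div (Reg 16) (Const 2)))))
           (Seq (Assign 16 (Bin Div (Reg 16) (Const 2)))
           (Seq (table_op e sub 17 17 18)
                (For 13 2 add_product))))))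
         copy))"

text \<open>The block becomes the product of seed minus k over all k other than its own index, which
  is the Cauchy entry with its denominators cleared. The sum of two strict comparisons tests for
  inequality.\<close>

definition build_vector :: com where
  "build_vector =
     Seq (Assign 15 (Bin Add (Reg 4) (Bin Mult (Reg 10) (Reg 2))))
    (Seq (fill 15)
    (Seq (Store (Reg 15) (Const one_cell))
         (For 11 1 (Cond (Bin Add (Bin Less (Reg 10) (Reg 11)) (Bin Less (Reg 11) (Reg 10)))
            times_diff Skip))))"

definition build_vectors :: com where
  "build_vectors = For 10 1 build_vector"

text \<open>Register 20 is not reset, so that a second sum can be subtracted from a first
  one.\<close>

definition dot :: "(nat \<Rightarrow> nat \<Rightarrow> nat) \<Rightarrow> expr \<Rightarrow> expr \<Rightarrow> com" where
  "dot f d d' = For 13 1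
     (Seq (Assign 18 (Load d))
     (Seq (Assign 19 (Load d'))
     (Seq (table_op e mul 18 18 19)
          (table_op e f 20 20 18))))"

definition vector_addr :: expr where
  "vector_addr = Bin Add (Bin Add (Reg 4) (Bin Mult (Reg 13) (Reg 2))) (Reg 12)"

definition inner_products :: "expr \<Rightarrow> com" where
  "inner_products b = For 14 1
     (Seq (Assign 20 (Const zero_cell))
     (Seq (dot add b vector_addr)
          (Store (Bin Add (Reg 6) (Reg 14)) (Reg 20))))"

definition reject_if_nonzero :: com where
  "reject_if_nonzero = Cond (Bin Add (Bin Less (Reg 20) (Const zero_cell)) (Bin Less (Const zero_cell) (Reg 20)))
     (Assign 0 (Const 0)) Skip"

definition compare_rows :: "expr \<Rightarrow> expr \<Rightarrow> com" where
  "compare_rows a c = For 14 1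
     (Seq (Assign 20 (Const zero_cell))
     (Seq (dot add a (Bin Add (Reg 6) (Reg 13)))
     (Seq (dot sub c vector_addr) reject_if_nonzero)))"

text \<open>The matrices have entries in the quadratic extension, so they act on each of the N
  coordinates separately. No product in the large field is formed here, and only one coordinate of B
  x is stored at a time.\<close>

definition check :: "expr \<Rightarrow> expr \<Rightarrow> expr \<Rightarrow> com" where
  "check a b c = For 12 2 (Seq (inner_products b) (compare_rows a c))"

end

text \<open>This adds what varies from run to run: the matrix size n, the degree N with its root
  \<beta>, and a bound M for all cell contents. The program text is defined in the smaller locale,
  which knows none of them; this is how one program serves every n.\<close>

locale field_tower = field_tables L \<pi> Q e \<gamma> zero_cell one_cell add sub mul
  for L (structure) and \<pi> :: "nat \<Rightarrow> 'a" and Q e \<gamma> zero_cell one_cell add sub mul +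
  fixes N M n :: nat and \<beta> :: 'a
  assumes N_pos: "N > 0" and \<beta> [simp]: "\<beta> \<in> carrier L" and \<beta>_pow: "\<beta> [^] N = \<pi> \<gamma>"
    and M: "100 \<le> M" "2 ^ e \<le> M" "2 * N \<le> M" "n \<le> M"
begin

section \<open>Arithmetic of the extension field in memory\<close>

definition cells :: "(nat \<Rightarrow> nat) \<Rightarrow> nat \<Rightarrow> bool" where
  "cells m a \<longleftrightarrow> (\<forall>c<N. m (a + c) < Q)"

definition vec :: "(nat \<Rightarrow> nat) \<Rightarrow> nat \<Rightarrow> 'a" where
  "vec m a = (\<Oplus>c\<in>{..<N}. \<pi> (m (a + c)) \<otimes> \<beta> [^] c)"

lemma less_Q_imp_le_M: "a < Q \<Longrightarrow> a \<le> M"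
  using Q_le M by linarith

lemma less_Q_imp_less: "a < Q \<Longrightarrow> a < 2 ^ e"
  using Q_le by linarith

lemma vec_closed [simp]: "cells m a \<Longrightarrow> vec m a \<in> carrier L"
  unfolding vec_def cells_def by (intro finsum_closed) auto

lemma vec_cong: "(\<And>c. c < N \<Longrightarrow> m (a + c) = m' (a' + c)) \<Longrightarrow> cells m' a' \<Longrightarrow> vec m a = vec m' a'"
  unfolding vec_def cells_def by (intro finsum_cong') auto

lemma vec_const_zero: "(\<And>c. c < N \<Longrightarrow> m (a + c) = zero_cell) \<Longrightarrow> vec m a = \<zero>"
proof -
  assume "\<And>c. c < N \<Longrightarrow> m (a + c) = zero_cell"
  then have "vec m a = (\<Oplus>c\<in>{..<N}. \<zero>)" unfolding vec_def by (intro finsum_cong') auto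
  then show ?thesis by (simp add: finsum_zero)
qed

text \<open>The new content is described by the field element that it adds, which covers both the
  accumulation of products and the writing of a single coordinate over zeros.\<close>

lemma vec_upd:
  assumes m: "cells m a" and c: "c < N" and w: "w < Q" and y: "y \<in> carrier L"
    and v: "\<pi> w = \<pi> (m (a + c)) \<oplus> y"
  shows "cells (m(a + c := w)) a" "vec (m(a + c := w)) a = vec m a \<oplus> y \<otimes> \<beta> [^] c"
proof -
  show "cells (m(a + c := w)) a" using m w by (simp add: cells_def)
  have mc: "m (a + d) < Q" if "d < N" for d using m that by (simp add: cells_def)
  have ins: "{..<N} = insert c ({..<N} - {c})" using c by auto
  have "vec (m(a + c := w)) a = \<pi> w \<otimes> \<beta> [^] c \<oplus> (\<Oplus>d\<in>{..<N} - {c}. \<pi> ((m(a + c := w)) (a + d)) \<otimes> \<beta> [^] d)"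
    unfolding vec_def by (subst ins, subst finsum_insert) (use mc w in auto)
  also have "(\<Oplus>d\<in>{..<N} - {c}. \<pi> ((m(a + c := w)) (a + d)) \<otimes> \<beta> [^] d)
      = (\<Oplus>d\<in>{..<N} - {c}. \<pi> (m (a + d)) \<otimes> \<beta> [^] d)"
    using mc by (intro finsum_cong') auto
  finally have 1: "vec (m(a + c := w)) a = \<pi> w \<otimes> \<beta> [^] c \<oplus> (\<Oplus>d\<in>{..<N} - {c}. \<pi> (m (a + d)) \<otimes> \<beta> [^] d)" .
  have 2: "vec m a = \<pi> (m (a + c)) \<otimes> \<beta> [^] c \<oplus> (\<Oplus>d\<in>{..<N} - {c}. \<pi> (m (a + d)) \<otimes> \<beta> [^] d)"
    unfolding vec_def by (subst ins, subst finsum_insert) (use mc c in auto)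
  have "(\<Oplus>d\<in>{..<N} - {c}. \<pi> (m (a + d)) \<otimes> \<beta> [^] d) \<in> carrier L" "\<pi> (m (a + c)) \<in> carrier L"
    "\<beta> [^] c \<in> carrier L"
    using mc c by (auto intro!: finsum_closed)
  then show "vec (m(a + c := w)) a = vec m a \<oplus> y \<otimes> \<beta> [^] c"
    unfolding 1 2 v using y by (simp add: l_distr a_ac)
qed

lemma runs_fill:
  assumes s: "regs s b = p" "regs s 2 = N" "b \<noteq> 12" "b \<le> M"
  shows "runs M (fill b) s (N * 3 + 2)
    (\<lambda>s'. same_regs {12} (regs s) (regs s') \<and> mem s' = (\<lambda>a. if p \<le> a \<and> a < p + N then zero_cell else mem s a))"
proof -
  have "runs M (fill b) s (N * (1 + 2) + 2)
    (\<lambda>s'. same_regs {12} (regs s) (regs s') \<and> mem s' = (\<lambda>a. if p \<le> a \<and> a < p + N then zero_cell else mem s a))"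
    unfolding fill_def
  proof (rule runs_For[where I = "\<lambda>i s'. same_regs {12} (regs s) (regs s') \<and>
      mem s' = (\<lambda>a. if p \<le> a \<and> a < p + i then zero_cell else mem s a)"])
    fix i and s' :: state assume i: "i < N" and I: "same_regs {12} (regs s) (regs s') \<and>
      mem s' = (\<lambda>a. if p \<le> a \<and> a < p + i then zero_cell else mem s a)" "regs s' 12 = i" "regs s' 2 = N"
    have "regs s' b = p" using I s by (auto simp: same_regs_def)
    then show "runs M (Store (Bin Add (Reg b) (Reg 12)) (Const zero_cell)) s' 1
      (\<lambda>s'. regs s' 12 = i \<and> regs s' 2 = N \<and> same_regs {12} (regs s) (regs (s'\<lparr>regs := (regs s')(12 := Suc i)\<rparr>)) \<and>
        mem (s'\<lparr>regs := (regs s')(12 := Suc i)\<rparr>) = (\<lambda>a. if p \<le> a \<and> a < p + Suc i then zero_cell else mem s a))"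
      by (intro runs_Store) (use I M s less_Q_imp_le_M[of zero_cell] in \<open>auto simp: small_expr_def\<close>)
  qed (use s M in auto)
  then show ?thesis by (rule runs_le) simp
qed

lemma runs_copy:
  assumes s: "regs s 15 = p" "regs s 5 = t" "regs s 2 = N" "p + N \<le> t"
  shows "runs M copy s (N * 3 + 2)
    (\<lambda>s'. same_regs {12} (regs s) (regs s') \<and> mem s' = (\<lambda>a. if p \<le> a \<and> a < p + N then mem s (t + (a - p)) else mem s a))"
proof -
  have "runs M copy s (N * (1 + 2) + 2)
    (\<lambda>s'. same_regs {12} (regs s) (regs s') \<and> mem s' = (\<lambda>a. if p \<le> a \<and> a < p + N then mem s (t + (a - p)) else mem s a))"
    unfolding copy_def
  proof (rule runs_For[where I = "\<lambda>i s'. same_regs {12} (regs s) (regs s') \<and>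
      mem s' = (\<lambda>a. if p \<le> a \<and> a < p + i then mem s (t + (a - p)) else mem s a)"])
    fix i and s' :: state assume i: "i < N" and I: "same_regs {12} (regs s) (regs s') \<and>
      mem s' = (\<lambda>a. if p \<le> a \<and> a < p + i then mem s (t + (a - p)) else mem s a)"
      "regs s' 12 = i" "regs s' 2 = N"
    have r: "regs s' 15 = p" "regs s' 5 = t" using I s by (auto simp: same_regs_def)
    \<comment> \<open>The source begins behind the end of the target, so it still holds its original
      contents.\<close>
    have "mem s (t + i) = mem s' (t + i)" using I s(4) i by simp
    then have "mem s (t + i) \<le> M" if "bounded_state M s'" using that by (simp add: bounded_state_def)
    then show "runs M (Store (Bin Add (Reg 15) (Reg 12)) (Load (Bin Add (Reg 5) (Reg 12)))) s' 1
      (\<lambda>s'. regs s' 12 = i \<and> regs s' 2 = N \<and> same_regs {12} (regs s) (regs (s'\<lparr>regs := (regs s')(12 := Suc i)\<rparr>)) \<and>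
        mem (s'\<lparr>regs := (regs s')(12 := Suc i)\<rparr>)
          = (\<lambda>a. if p \<le> a \<and> a < p + Suc i then mem s (t + (a - p)) else mem s a))"
      by (intro runs_Store) (use I M r s(4) i in \<open>auto simp: small_expr_def\<close>)
  qed (use s M in auto)
  then show ?thesis by (rule runs_le) simp
qed

lemma runs_add_product:
  assumes s: "regs s 15 = p" "regs s 5 = t" "regs s 2 = N" "regs s 7 = \<gamma>" "regs s 17 = w"
    "regs s 12 = c" "regs s 13 = d" "w < Q" "c < N" "d < N" "cells (mem s) p" "cells (mem s) t"
  shows "runs M add_product s (6 * e + 10) (\<lambda>s'. same_regs {18, 19, 21} (regs s) (regs s') \<and>
    (\<forall>a. a \<notin> {t..<t + N} \<longrightarrow> mem s' a = mem s a) \<and> cells (mem s') t \<and>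
    vec (mem s') t = vec (mem s) t \<oplus> (\<pi> w \<otimes> \<beta> [^] c) \<otimes> (\<pi> (mem s (p + d)) \<otimes> \<beta> [^] d))"
proof -
  define x where "x = (if c + d < N then c + d else c + d - N)"
  define y where "y = mul (mem s (p + d)) w"
  define z where "z = (if c + d < N then y else mul y \<gamma>)"
  define v where "v = add (mem s (t + x)) z"
  have xN: "x < N" using s by (auto simp: x_def)
  have mp: "mem s (p + d) < Q" and mt: "mem s (t + x) < Q" using s xN by (auto simp: cells_def)
  have y: "y < Q" "\<pi> y = \<pi> (mem s (p + d)) \<otimes> \<pi> w" using mul mp s by (auto simp: y_def)
  have z: "z < Q" using y mul by (auto simp: z_def)
  have v: "v < Q" "\<pi> v = \<pi> (mem s (t + x)) \<oplus> \<pi> z" using add mt z by (auto simp: v_def)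
  \<comment> \<open>A wrapped position loses the factor \<beta>^N, which the factor \<gamma> in
    \<open>z\<close> restores.\<close>
  have zx: "\<pi> z \<otimes> \<beta> [^] x = (\<pi> w \<otimes> \<beta> [^] c) \<otimes> (\<pi> (mem s (p + d)) \<otimes> \<beta> [^] d)"
  proof -
    have "\<pi> z \<otimes> \<beta> [^] x = \<pi> y \<otimes> \<beta> [^] (c + d)"
    proof (cases "c + d < N")
      case False
      then have "\<beta> [^] (c + d) = \<beta> [^] N \<otimes> \<beta> [^] x"
        by (simp add: x_def nat_pow_mult)
      moreover have "\<pi> y \<in> carrier L" using y(1) by (rule \<pi>_closed)
      moreover have "mul y \<gamma> < Q" "\<pi> (mul y \<gamma>) = \<pi> y \<otimes> \<pi> \<gamma>" using mul y(1) by auto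
      ultimately show ?thesis using False by (simp add: z_def \<beta>_pow m_assoc)
    qed (simp add: z_def x_def)
    also have "\<dots> = (\<pi> w \<otimes> \<beta> [^] c) \<otimes> (\<pi> (mem s (p + d)) \<otimes> \<beta> [^] d)"
      using mp s by (simp add: y nat_pow_mult[symmetric] m_ac)
    finally show ?thesis .
  qed
  note u = vec_upd[OF \<open>cells (mem s) t\<close> xN v(1) \<pi>_closed[OF z] v(2), unfolded zx]
  let ?P = "\<lambda>s'. same_regs {18, 19, 21} (regs s) (regs s') \<and> mem s' = (mem s)(t + x := v)"
  \<comment> \<open>The bound repeats the nesting of the program, one summand for each command, so
    that the rules for \<open>runs\<close> match it directly; the \<open>max\<close> belongs to the
    conditional.\<close>
  have "runs M add_product s (1 + ((1 + e + e) + (1 + ((max 1 (1 + (1 + e + e)) + 1) + (1 + ((1 + e + e) + 1)))))) ?P"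
    unfolding add_product_def
    by (intro runs_Seq runs_Assign runs_table_op runs_Cond_max runs_Store runs_Skip)
      (use s M y z v mp mt less_Q_imp_less less_Q_imp_le_M in
        \<open>auto simp: small_expr_def bounded_state_def x_def y_def z_def v_def split: if_splits\<close>)
  then show ?thesis
    by (rule runs_mono) (use u xN in auto)
qed

end

lemma (in ring) finsum_lessThan_Suc:
  assumes "f \<in> {..<Suc i} \<rightarrow> carrier R"
  shows "(\<Oplus>j\<in>{..<Suc i}. f j) = (\<Oplus>j\<in>{..<i}. f j) \<oplus> f i"
proof -
  have "(\<Oplus>j\<in>{..<Suc i}. f j) = f i \<oplus> (\<Oplus>j\<in>{..<i}. f j)"
    unfolding lessThan_Suc by (rule finsum_insert) (use assms in auto)
  then show ?thesis using assms by (subst a_comm) (auto simp: Pi_def intro!: finsum_closed)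
qed

context field_tower
begin

text \<open>The points v_k of the Cauchy vector. The digits act as cells, so they stand for the
  elements numbered 0 and 1, whichever these are.\<close>

definition bitvec :: "nat \<Rightarrow> 'a" where
  "bitvec k = (\<Oplus>c\<in>{..<N}. \<pi> (k div 2 ^ c mod 2) \<otimes> \<beta> [^] c)"

lemma bit_less_Q [simp]: "k mod 2 < Q"
  using Q_gt by (metis less_2_cases_iff mod_less_divisor order_less_trans pos2 less_trans linorder_neqE_nat not_less_less_Suc_eq numeral_2_eq_2 One_nat_def)

lemma bitvec_closed [simp]: "bitvec k \<in> carrier L"
  unfolding bitvec_def by (intro finsum_closed) auto

lemma runs_add_products:
  assumes s: "regs s 15 = p" "regs s 5 = t" "regs s 2 = N" "regs s 7 = \<gamma>" "regs s 17 = w"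
    "regs s 12 = c" "w < Q" "c < N" "p + N \<le> t" "cells (mem s) p" "cells (mem s) t"
  shows "runs M (For 13 2 add_product) s (N * (6 * e + 10 + 2) + 2)
    (\<lambda>s'. same_regs {13, 18, 19, 21} (regs s) (regs s') \<and>
    (\<forall>a. a \<notin> {t..<t + N} \<longrightarrow> mem s' a = mem s a) \<and> cells (mem s') t \<and>
    vec (mem s') t = vec (mem s) t \<oplus> (\<pi> w \<otimes> \<beta> [^] c) \<otimes> vec (mem s) p)"
proof -
  define S where "S i = (\<Oplus>d\<in>{..<i}. \<pi> (mem s (p + d)) \<otimes> \<beta> [^] d)" for i
  have pc: "\<pi> (mem s (p + d)) \<in> carrier L" if "d < N" for d using s(10) that by (simp add: cells_def)
  have Sc: "S i \<in> carrier L" if "i \<le> N" for i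
    unfolding S_def using pc that by (intro finsum_closed) auto
  have SS: "S (Suc i) = S i \<oplus> \<pi> (mem s (p + i)) \<otimes> \<beta> [^] i" if "i < N" for i
    unfolding S_def using pc that by (subst finsum_lessThan_Suc) auto
  have S0: "S 0 = \<zero>" by (simp add: S_def)
  let ?I = "\<lambda>i s'. same_regs {13, 18, 19, 21} (regs s) (regs s') \<and>
    (\<forall>a. a \<notin> {t..<t + N} \<longrightarrow> mem s' a = mem s a) \<and> cells (mem s') t \<and>
    vec (mem s') t = vec (mem s) t \<oplus> (\<pi> w \<otimes> \<beta> [^] c) \<otimes> S i"
  show ?thesis
  proof (rule runs_For[where I = ?I])
    fix i and s' :: state
    assume i: "i < N" and I: "?I i s'" and v: "regs s' 13 = i" "regs s' 2 = N"
    have r: "regs s' r = regs s r" if "r \<notin> {13, 18, 19, 21}" for r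
      using I that by (simp add: same_regs_def)
    have mp: "mem s' (p + d) = mem s (p + d)" if "d < N" for d using I s(9) that by simp
    have "runs M add_product s' (6 * e + 10) (\<lambda>s''. same_regs {18, 19, 21} (regs s') (regs s'') \<and>
      (\<forall>a. a \<notin> {t..<t + N} \<longrightarrow> mem s'' a = mem s' a) \<and> cells (mem s'') t \<and>
      vec (mem s'') t = vec (mem s') t \<oplus> (\<pi> w \<otimes> \<beta> [^] c) \<otimes> (\<pi> (mem s' (p + i)) \<otimes> \<beta> [^] i))"
      by (rule runs_add_product) (use s r v i I mp in \<open>auto simp: cells_def\<close>)
    then show "runs M add_product s' (6 * e + 10) (\<lambda>s''. regs s'' 13 = i \<and> regs s'' 2 = N \<and>
      ?I (Suc i) (s''\<lparr>regs := (regs s'')(13 := Suc i)\<rparr>))"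
    proof (rule runs_mono[OF _ order_refl])
      fix s'' :: state assume A: "same_regs {18, 19, 21} (regs s') (regs s'') \<and>
        (\<forall>a. a \<notin> {t..<t + N} \<longrightarrow> mem s'' a = mem s' a) \<and> cells (mem s'') t \<and>
        vec (mem s'') t = vec (mem s') t \<oplus> (\<pi> w \<otimes> \<beta> [^] c) \<otimes> (\<pi> (mem s' (p + i)) \<otimes> \<beta> [^] i)"
      have "same_regs {13, 18, 19, 21} (regs s) (regs s'')"
        by (rule same_regs_trans[of _ _ "regs s'" "{18, 19, 21}"]) (use I A in auto)
      moreover have "vec (mem s) t \<oplus> \<pi> w \<otimes> \<beta> [^] c \<otimes> S i \<oplus> \<pi> w \<otimes> \<beta> [^] c \<otimes> (\<pi> (mem s (p + i)) \<otimes> \<beta> [^] i)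
          = vec (mem s) t \<oplus> \<pi> w \<otimes> \<beta> [^] c \<otimes> S (Suc i)"
        using s Sc[of i] i pc[OF i] by (simp add: SS a_assoc r_distr)
      moreover have "regs s'' 13 = i" "regs s'' 2 = N" using A v by (auto simp: same_regs_def)
      ultimately show "regs s'' 13 = i \<and> regs s'' 2 = N \<and> ?I (Suc i) (s''\<lparr>regs := (regs s'')(13 := Suc i)\<rparr>)"
        using A I mp[OF i] by simp
    qed
  next
    show "?I 0 (s\<lparr>regs := (regs s)(13 := 0)\<rparr>)" using s by (simp add: S0)
  next
    fix s' assume "?I N s'"
    then show "same_regs {13, 18, 19, 21} (regs s) (regs s') \<and>
      (\<forall>a. a \<notin> {t..<t + N} \<longrightarrow> mem s' a = mem s a) \<and> cells (mem s') t \<and>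
      vec (mem s') t = vec (mem s) t \<oplus> (\<pi> w \<otimes> \<beta> [^] c) \<otimes> vec (mem s) p"
      by (simp add: S_def vec_def)
  qed (use s M in auto)
qed

definition times_diff_steps :: nat where
  "times_diff_steps = (N * 3 + 2) + (1 + ((N * ((1 + (1 + (1 + ((1 + e + e) + (N * (6 * e + 10 + 2) + 2))))) + 2) + 2) + (N * 3 + 2)))"

text \<open>The products accumulate in the buffer while the old block is still being read, and the
  block is overwritten only by the final copy. This is why seed, block and buffer have to be
  disjoint.\<close>

lemma runs_times_diff:
  assumes s: "regs s 15 = p" "regs s 5 = t" "regs s 2 = N" "regs s 7 = \<gamma>" "regs s 3 = u"
    "regs s 11 = k" "u + N \<le> p" "p + N \<le> t" "cells (mem s) u" "cells (mem s) p" "k \<le> M"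
  shows "runs M times_diff s times_diff_steps
    (\<lambda>s'. same_regs {12, 13, 16, 17, 18, 19, 21} (regs s) (regs s') \<and>
    (\<forall>a. a \<notin> {p..<p + N} \<union> {t..<t + N} \<longrightarrow> mem s' a = mem s a) \<and> cells (mem s') p \<and>
    vec (mem s') p = (vec (mem s) u \<ominus> bitvec k) \<otimes> vec (mem s) p)"
proof -
  let ?W = "{12, 13, 16, 17, 18, 19, 21} :: nat set"
  let ?R = "\<lambda>s'. same_regs ?W (regs s) (regs s') \<and>
    (\<forall>a. a \<notin> {p..<p + N} \<union> {t..<t + N} \<longrightarrow> mem s' a = mem s a) \<and> cells (mem s') p \<and>
    vec (mem s') p = (vec (mem s) u \<ominus> bitvec k) \<otimes> vec (mem s) p"
  define g where "g c = \<pi> (mem s (u + c)) \<ominus> \<pi> (k div 2 ^ c mod 2)" for c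
  have uc: "\<pi> (mem s (u + c)) \<in> carrier L" "mem s (u + c) < Q" if "c < N" for c
    using s(9) that by (simp_all add: cells_def)
  have gc: "g c \<in> carrier L" if "c < N" for c using uc that by (simp add: g_def)
  \<comment> \<open>\<open>G i\<close> is seed minus index truncated to its lowest i coordinates;
    after i rounds the buffer holds \<open>G i\<close> times the old block.\<close>
  define G where "G i = (\<Oplus>c\<in>{..<i}. g c \<otimes> \<beta> [^] c)" for i :: nat
  have Gc: "G i \<in> carrier L" if "i \<le> N" for i
    unfolding G_def using gc that by (intro finsum_closed) auto
  have GS: "G (Suc i) = G i \<oplus> g i \<otimes> \<beta> [^] i" if "i < N" for i
    unfolding G_def using gc that by (subst finsum_lessThan_Suc) auto
  have G0: "G 0 = \<zero>" by (simp add: G_def)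
  have GN: "G N = vec (mem s) u \<ominus> bitvec k"
  proof -
    have "G N = (\<Oplus>c\<in>{..<N}. \<pi> (mem s (u + c)) \<otimes> \<beta> [^] c \<oplus> (\<ominus> \<one>) \<otimes> (\<pi> (k div 2 ^ c mod 2) \<otimes> \<beta> [^] c))"
      unfolding G_def g_def using uc by (intro finsum_cong') (auto simp: minus_eq l_distr l_minus)
    also have "\<dots> = vec (mem s) u \<oplus> (\<Oplus>c\<in>{..<N}. (\<ominus> \<one>) \<otimes> (\<pi> (k div 2 ^ c mod 2) \<otimes> \<beta> [^] c))"
      unfolding vec_def using uc by (intro finsum_addf) auto
    also have "(\<Oplus>c\<in>{..<N}. (\<ominus> \<one>) \<otimes> (\<pi> (k div 2 ^ c mod 2) \<otimes> \<beta> [^] c)) = (\<ominus> \<one>) \<otimes> bitvec k"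
      unfolding bitvec_def by (intro finsum_rdistr[symmetric]) auto
    finally show ?thesis by (simp add: minus_eq l_minus)
  qed
  let ?I = "\<lambda>i s'. same_regs ?W (regs s) (regs s') \<and> regs s' 16 = k div 2 ^ i \<and>
    (\<forall>a. a \<notin> {t..<t + N} \<longrightarrow> mem s' a = mem s a) \<and> cells (mem s') t \<and>
    vec (mem s') t = G i \<otimes> vec (mem s) p"
  let ?c = "Seq (Assign 17 (Load (Bin Add (Reg 3) (Reg 12))))
           (Seq (Assign 18 (Bin Monus (Reg 16) (Bin Mult (Const 2) (Bin Div (Reg 16) (Const 2)))))
           (Seq (Assign 16 (Bin Div (Reg 16) (Const 2)))
           (Seq (table_op e sub 17 17 18)
                (For 13 2 add_product))))"
  have loop: "runs M (For 12 2 ?c) s'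
      (N * ((1 + (1 + (1 + ((1 + e + e) + (N * (6 * e + 10 + 2) + 2))))) + 2) + 2) (?I N)"
    if I0: "?I 0 s'" for s' :: state
  proof (rule runs_For[where I = ?I])
    fix i and s' :: state
    assume i: "i < N" and I: "?I i s'" and v: "regs s' 12 = i" "regs s' 2 = N"
    have r: "regs s' r = regs s r" if "r \<notin> ?W" for r
      using I that by (simp add: same_regs_def)
    have mp: "mem s' (p + d) = mem s (p + d)" "mem s' (u + d) = mem s (u + d)" if "d < N" for d
      using I s(7,8) that by simp_all
    define b where "b = k div 2 ^ i"
    define w where "w = sub (mem s (u + i)) (b mod 2)"
    have w: "w < Q" "\<pi> w = g i" using sub[OF uc(2)[OF i], of "b mod 2"] by (simp_all add: w_def b_def g_def)
    define f where "f = (regs s')(17 := w, 18 := b mod 2, 16 := b div 2)"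
    have *: "runs M (For 13 2 add_product) (s'\<lparr>regs := f\<rparr>) (N * (6 * e + 10 + 2) + 2)
        (\<lambda>s''. regs s'' 12 = i \<and> regs s'' 2 = N \<and> ?I (Suc i) (s''\<lparr>regs := (regs s'')(12 := Suc i)\<rparr>))"
    proof (rule runs_mono[OF runs_add_products[of _ p t w i] order_refl])
      fix s'' :: state assume A: "same_regs {13, 18, 19, 21} (regs (s'\<lparr>regs := f\<rparr>)) (regs s'') \<and>
        (\<forall>a. a \<notin> {t..<t + N} \<longrightarrow> mem s'' a = mem (s'\<lparr>regs := f\<rparr>) a) \<and> cells (mem s'') t \<and>
        vec (mem s'') t = vec (mem (s'\<lparr>regs := f\<rparr>)) t \<oplus> (\<pi> w \<otimes> \<beta> [^] i) \<otimes> vec (mem (s'\<lparr>regs := f\<rparr>)) p"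
      have "same_regs ?W (regs s') f" by (simp add: f_def)
      then have "same_regs ?W (regs s) f"
        using I same_regs_trans[of ?W "regs s" "regs s'" ?W f ?W] by simp
      then have 1: "same_regs ?W (regs s) (regs s'')"
        by (rule same_regs_trans[of _ _ f "{13, 18, 19, 21}"]) (use A in auto)
      have 2: "vec (mem s') p = vec (mem s) p" using mp s(10) by (intro vec_cong) auto
      have "regs s'' 12 = i" "regs s'' 2 = N" "regs s'' 16 = b div 2"
        using A v by (auto simp: same_regs_def f_def)
      moreover have "b div 2 = k div 2 ^ Suc i" by (simp only: b_def power_Suc2 div_mult2_eq)
      moreover have "G i \<otimes> vec (mem s) p \<oplus> g i \<otimes> \<beta> [^] i \<otimes> vec (mem s) p = G (Suc i) \<otimes> vec (mem s) p"
        using s(10) Gc[of i] i gc[OF i] by (simp add: GS l_distr)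
      ultimately show "regs s'' 12 = i \<and> regs s'' 2 = N \<and> ?I (Suc i) (s''\<lparr>regs := (regs s'')(12 := Suc i)\<rparr>)"
        using A I 1 2 w by simp
    qed (use s r v i I mp w in \<open>auto simp: cells_def f_def\<close>)
    have bm: "b - 2 * (b div 2) = b mod 2" by (simp add: minus_mult_div_eq_mod)
    have kM: "b \<le> M" "b div 2 \<le> M" using s(11) div_le_dividend le_trans unfolding b_def by blast+
    have m2: "b mod 2 \<le> M" "b mod 2 < 2 ^ e" "mem s (u + i) \<le> M" "mem s (u + i) < 2 ^ e" "w \<le> M"
      using less_Q_imp_le_M[of "b mod 2"] less_Q_imp_less[of "b mod 2"] less_Q_imp_le_M[OF uc(2)[OF i]]
        less_Q_imp_less[OF uc(2)[OF i]] less_Q_imp_le_M[OF w(1)] by auto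
    have r': "regs s' 16 = b" "regs s' 3 = u" using I r[of 3] s by (simp_all add: b_def)
    show "runs M ?c s' (1 + (1 + (1 + ((1 + e + e) + (N * (6 * e + 10 + 2) + 2)))))
      (\<lambda>s''. regs s'' 12 = i \<and> regs s'' 2 = N \<and> ?I (Suc i) (s''\<lparr>regs := (regs s'')(12 := Suc i)\<rparr>))"
      apply (intro runs_Seq runs_Assign runs_table_op)
      using * r' v mp[OF i] bm kM m2 M
      apply (simp_all add: small_expr_def flip: w_def)
      apply (simp_all add: f_def fun_upd_twist)
      done
  qed (use I0 s M in \<open>auto simp: same_regs_def\<close>)
  have copy: "runs M copy s' (N * 3 + 2) ?R" if I: "?I N s'" for s' :: state
  proof (rule runs_mono[OF runs_copy[of _ p t] order_refl])
    fix s'' :: state assume A: "same_regs {12} (regs s') (regs s'') \<and>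
      mem s'' = (\<lambda>a. if p \<le> a \<and> a < p + N then mem s' (t + (a - p)) else mem s' a)"
    have 1: "same_regs ?W (regs s) (regs s'')"
      by (rule same_regs_trans[of ?W _ "regs s'" "{12}"]) (use A I in auto)
    have 2: "vec (mem s'') p = vec (mem s') t" using A I by (intro vec_cong) auto
    have 3: "cells (mem s'') p" using A I by (auto simp: cells_def)
    show "same_regs ?W (regs s) (regs s'') \<and>
      (\<forall>a. a \<notin> {p..<p + N} \<union> {t..<t + N} \<longrightarrow> mem s'' a = mem s a) \<and> cells (mem s'') p \<and>
      vec (mem s'') p = (vec (mem s) u \<ominus> bitvec k) \<otimes> vec (mem s) p"
      using A I 1 2 3 GN by auto
  qed (use I s in \<open>auto simp: same_regs_def\<close>)
  show ?thesis
    unfolding times_diff_def times_diff_steps_def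
  proof (rule runs_Seq, rule runs_mono[OF runs_fill order_refl])
    fix s1 :: state assume A: "same_regs {12} (regs s) (regs s1) \<and>
      mem s1 = (\<lambda>a. if t \<le> a \<and> a < t + N then zero_cell else mem s a)"
    have 1: "same_regs ?W (regs s) (regs s1)"
      by (rule same_regs_trans[of "{}" _ "regs s" "{12}"]) (use A in auto)
    have k1: "regs s1 11 = k" using A s by (auto simp: same_regs_def)
    have z: "vec (mem s1) t = \<zero>" using A by (intro vec_const_zero) auto
    have c: "cells (mem s1) t" using A by (auto simp: cells_def)
    show "runs M (Seq (Assign 16 (Reg 11)) (Seq (For 12 2 ?c) copy)) s1
      (1 + ((N * ((1 + (1 + (1 + ((1 + e + e) + (N * (6 * e + 10 + 2) + 2))))) + 2) + 2) + (N * 3 + 2)))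
      ?R"
    proof (intro runs_Seq runs_Assign)
      show "runs M (For 12 2 ?c) (s1\<lparr>regs := (regs s1)(16 := expr_val (Reg 11) s1)\<rparr>)
        (N * ((1 + (1 + (1 + ((1 + e + e) + (N * (6 * e + 10 + 2) + 2))))) + 2) + 2)
        (\<lambda>s'. runs M copy s' (N * 3 + 2) ?R)"
        by (rule runs_mono[OF loop order_refl], use A 1 k1 z c s(10) in \<open>simp add: G0\<close>, rule copy)
    qed (use k1 s M in \<open>auto simp: small_expr_def\<close>)
  qed (use s M in auto)
qed

end

section \<open>The scaled Cauchy vector in memory\<close>

lemma regs_mem_update: "regs (s\<lparr>mem := m\<rparr>) = regs s" "mem (s\<lparr>mem := m\<rparr>) = m"
  by simp_all

context field_tower
begin

abbreviation build_regs :: "nat set" where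
  "build_regs \<equiv> {11, 12, 13, 15, 16, 17, 18, 19, 21}"

definition build_vector_steps :: nat where
  "build_vector_steps = 1 + ((N * 3 + 2) + (1 + (n * ((max times_diff_steps 1 + 1) + 2) + 2)))"

lemma runs_build_vector:
  assumes s: "regs s 1 = n" "regs s 2 = N" "regs s 3 = u" "regs s 4 = x" "regs s 5 = t" "regs s 7 = \<gamma>"
    "regs s 10 = j" "j < n" "u + N \<le> x" "x + n * N \<le> t" "t \<le> M" "cells (mem s) u"
    and p: "p = x + j * N"
  shows "runs M build_vector s build_vector_steps (\<lambda>s'. same_regs build_regs (regs s) (regs s') \<and>
    (\<forall>a. a \<notin> {p..<p + N} \<union> {t..<t + N} \<longrightarrow> mem s' a = mem s a) \<and> cells (mem s') p \<and>
    vec (mem s') p = (\<Otimes>k\<in>{..<n} - {j}. vec (mem s) u \<ominus> bitvec k))"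
proof -
  define v where "v k = vec (mem s) u \<ominus> bitvec k" for k
  have vc: "v k \<in> carrier L" for k using s(12) by (simp add: v_def)
  define V where "V i = (\<Otimes>k\<in>{..<i} - {j}. v k)" for i
  have V0: "V 0 = \<one>" by (simp add: V_def)
  have VS: "V (Suc i) = (if i = j then V i else v i \<otimes> V i)" for i
  proof (cases "i = j")
    case True
    then have "{..<Suc i} - {j} = {..<i} - {j}" by auto
    then show ?thesis using True by (simp add: V_def)
  next
    case False
    then have "{..<Suc i} - {j} = insert i ({..<i} - {j})" by auto
    then show ?thesis using False vc unfolding V_def by (simp add: Pi_def)
  qed
  have pt: "p + N \<le> t"
  proof -
    have "j * N + N \<le> n * N" using s(8) mult_le_mono1[of "Suc j" n N] by simp
    then show ?thesis using s(10) p by linarith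
  qed
  let ?I = "\<lambda>i s'. same_regs build_regs (regs s) (regs s') \<and> regs s' 15 = p \<and>
    (\<forall>a. a \<notin> {p..<p + N} \<union> {t..<t + N} \<longrightarrow> mem s' a = mem s a) \<and> cells (mem s') p \<and> vec (mem s') p = V i"
  let ?loop = "For 11 1 (Cond (Bin Add (Bin Less (Reg 10) (Reg 11)) (Bin Less (Reg 11) (Reg 10))) times_diff Skip)"
  have loop: "runs M ?loop s' (n * ((max times_diff_steps 1 + 1) + 2) + 2) (?I n)" if I0: "?I 0 s'" for s' :: state
  proof (rule runs_For[where I = ?I])
    fix i and s' :: state
    assume i: "i < n" and I: "?I i s'" and w: "regs s' 11 = i" "regs s' 1 = n"
    have r: "regs s' r = regs s r" if "r \<notin> build_regs" for r
      using I that by (simp add: same_regs_def)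
    have mu: "mem s' (u + d) = mem s (u + d)" if "d < N" for d using I s(9) p pt that by simp
    have vu: "vec (mem s') u = vec (mem s) u" using mu s(12) by (intro vec_cong) auto
    let ?Q = "\<lambda>s''. regs s'' 11 = i \<and> regs s'' 1 = n \<and> ?I (Suc i) (s''\<lparr>regs := (regs s'')(11 := Suc i)\<rparr>)"
    show "runs M (Cond (Bin Add (Bin Less (Reg 10) (Reg 11)) (Bin Less (Reg 11) (Reg 10)))
      times_diff Skip) s' (max times_diff_steps 1 + 1) ?Q"
    proof (rule runs_Cond_max)
      assume "expr_val (Bin Add (Bin Less (Reg 10) (Reg 11)) (Bin Less (Reg 11) (Reg 10))) s' \<noteq> 0"
      then have ij: "i \<noteq> j" using w r[of 10] s(7) by auto
      show "runs M times_diff s' times_diff_steps ?Q"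
      proof (rule runs_mono[OF runs_times_diff[of _ p t u i] order_refl])
        fix s'' :: state
        assume A: "same_regs {12, 13, 16, 17, 18, 19, 21} (regs s') (regs s'') \<and>
          (\<forall>a. a \<notin> {p..<p + N} \<union> {t..<t + N} \<longrightarrow> mem s'' a = mem s' a) \<and> cells (mem s'') p \<and>
          vec (mem s'') p = (vec (mem s') u \<ominus> bitvec i) \<otimes> vec (mem s') p"
        have 1: "same_regs build_regs (regs s) (regs s'')"
          by (rule same_regs_trans[of build_regs _ "regs s'" "{12, 13, 16, 17, 18, 19, 21}"]) (use A I in auto)
        have 2: "regs s'' 11 = i" "regs s'' 1 = n" "regs s'' 15 = p"
          using A I w by (auto simp: same_regs_def)
        show "?Q s''" using A I 1 2 vu ij by (simp add: VS v_def)
      qed (use s r I w i p pt mu M in \<open>auto simp: cells_def\<close>)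
    next
      assume "expr_val (Bin Add (Bin Less (Reg 10) (Reg 11)) (Bin Less (Reg 11) (Reg 10))) s' = 0"
      then have "i = j" using w r[of 10] s(7) by (auto split: if_splits)
      then show "runs M Skip s' 1 ?Q"
        by (intro runs_Skip) (use I w in \<open>simp add: VS\<close>)
    qed (use M in \<open>auto simp: small_expr_def\<close>)
  qed (use I0 s M in \<open>auto simp: same_regs_def\<close>)
  have Vn: "V n = (\<Otimes>k\<in>{..<n} - {j}. vec (mem s) u \<ominus> bitvec k)" by (simp add: V_def v_def)
  let ?R = "\<lambda>s'. same_regs build_regs (regs s) (regs s') \<and>
    (\<forall>a. a \<notin> {p..<p + N} \<union> {t..<t + N} \<longrightarrow> mem s' a = mem s a) \<and> cells (mem s') p \<and> vec (mem s') p = V n"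
  let ?s = "s\<lparr>regs := (regs s)(15 := expr_val (Bin Add (Reg 4) (Bin Mult (Reg 10) (Reg 2))) s)\<rparr>"
  show ?thesis
    unfolding build_vector_def build_vector_steps_def Vn[symmetric]
  proof (rule runs_Seq, rule runs_Assign)
    show "runs M (Seq (fill 15) (Seq (Store (Reg 15) (Const one_cell))
       ?loop))
       ?s
       ((N * 3 + 2) + (1 + (n * ((max times_diff_steps 1 + 1) + 2) + 2)))
       ?R"
    proof (rule runs_Seq, rule runs_mono[OF runs_fill order_refl])
      fix s1 :: state
      assume A: "same_regs {12} (regs ?s) (regs s1) \<and>
        mem s1 = (\<lambda>a. if p \<le> a \<and> a < p + N then zero_cell
          else mem ?s a)"
      have sr: "same_regs build_regs (regs s) (regs s1)" and p1: "regs s1 15 = p"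
        using A s p by (auto simp: same_regs_def)
      have c: "cells (mem s1) p" and m0: "mem s1 p = zero_cell" using A N_pos by (auto simp: cells_def)
      have v0: "vec (mem s1) p = \<zero>" using A by (intro vec_const_zero) auto
      \<comment> \<open>The empty product, with which the block starts, is \<open>one_cell\<close>
        in coordinate 0 and \<open>zero_cell\<close> elsewhere.\<close>
      have up: "cells ((mem s1)(p := one_cell)) p" "vec ((mem s1)(p := one_cell)) p = \<one>"
        using vec_upd[OF c N_pos, of one_cell "\<one>"] m0 v0 by simp_all
      have m1: "\<forall>a. a \<notin> {p..<p + N} \<union> {t..<t + N} \<longrightarrow> ((mem s1)(p := one_cell)) a = mem s a"
        using A N_pos by auto
      have ini: "?I 0 (s1\<lparr>mem := (mem s1)(p := one_cell)\<rparr>)"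
        unfolding V0 regs_mem_update by (intro conjI sr p1 up m1)
      have "runs M ?loop (s1\<lparr>mem := (mem s1)(p := one_cell)\<rparr>) (n * ((max times_diff_steps 1 + 1) + 2) + 2)
        ?R"
        by (rule runs_mono[OF loop[OF ini] order_refl]) (elim conjE, intro conjI)
      then show "runs M (Seq (Store (Reg 15) (Const one_cell))
         ?loop)
         s1 (1 + (n * ((max times_diff_steps 1 + 1) + 2) + 2))
         ?R"
        by (intro runs_Seq runs_Store)
          (use p1 M less_Q_imp_le_M[of one_cell] less_Q_imp_le_M[of zero_cell] in \<open>auto simp: small_expr_def\<close>)
    qed (use s p M in auto)
  qed (use s p pt M in \<open>auto simp: small_expr_def\<close>)
qed

text \<open>These are the first i entries of the Cauchy vector for the point y, multiplied by the
  product of all y - v_k.\<close>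

definition good_vectors :: "nat \<Rightarrow> 'a \<Rightarrow> nat \<Rightarrow> (nat \<Rightarrow> nat) \<Rightarrow> bool" where
  "good_vectors i y x m \<longleftrightarrow> (\<forall>j<i. cells m (x + j * N) \<and>
    vec m (x + j * N) = (\<Otimes>k\<in>{..<n} - {j}. y \<ominus> bitvec k))"

lemma runs_build_vectors:
  assumes s: "regs s 1 = n" "regs s 2 = N" "regs s 3 = u" "regs s 4 = x" "regs s 5 = t" "regs s 7 = \<gamma>"
    "u + N \<le> x" "x + n * N \<le> t" "t \<le> M" "cells (mem s) u"
  shows "runs M build_vectors s (n * (build_vector_steps + 2) + 2)
    (\<lambda>s'. same_regs (insert 10 build_regs) (regs s) (regs s') \<and>
    (\<forall>a. a \<notin> {x..<t + N} \<longrightarrow> mem s' a = mem s a) \<and> good_vectors n (vec (mem s) u) x (mem s'))"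
  unfolding build_vectors_def
proof (rule runs_For[where I = "\<lambda>i s'. same_regs (insert 10 build_regs) (regs s) (regs s') \<and>
    (\<forall>a. a \<notin> {x..<t + N} \<longrightarrow> mem s' a = mem s a) \<and> good_vectors i (vec (mem s) u) x (mem s')"])
  let ?I = "\<lambda>i s'. same_regs (insert 10 build_regs) (regs s) (regs s') \<and>
    (\<forall>a. a \<notin> {x..<t + N} \<longrightarrow> mem s' a = mem s a) \<and> good_vectors i (vec (mem s) u) x (mem s')"
  fix i and s' :: state
  assume i: "i < n" and I: "?I i s'" and w: "regs s' 10 = i" "regs s' 1 = n"
  have r: "regs s' r = regs s r" if "r \<notin> insert 10 build_regs" for r
    using I that by (simp add: same_regs_def)
  have mu: "mem s' (u + d) = mem s (u + d)" if "d < N" for d using I s(7) that by simp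
  have vu: "vec (mem s') u = vec (mem s) u" using mu s(10) by (intro vec_cong) auto
  have iN: "i * N + N \<le> n * N" using i mult_le_mono1[of "Suc i" n N] by simp
  show "runs M build_vector s' build_vector_steps (\<lambda>s''. regs s'' 10 = i \<and> regs s'' 1 = n \<and>
    ?I (Suc i) (s''\<lparr>regs := (regs s'')(10 := Suc i)\<rparr>))"
  proof (rule runs_mono[OF runs_build_vector[of _ u x t i "x + i * N"] order_refl])
    fix s'' :: state
    assume A: "same_regs build_regs (regs s') (regs s'') \<and>
      (\<forall>a. a \<notin> {x + i * N..<x + i * N + N} \<union> {t..<t + N} \<longrightarrow> mem s'' a = mem s' a) \<and>
      cells (mem s'') (x + i * N) \<and>
      vec (mem s'') (x + i * N) = (\<Otimes>k\<in>{..<n} - {i}. vec (mem s') u \<ominus> bitvec k)"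
    have 1: "same_regs (insert 10 build_regs) (regs s) (regs s'')"
      by (rule same_regs_trans[of "insert 10 build_regs" _ "regs s'" build_regs]) (use A I in auto)
    have 2: "regs s'' 10 = i" "regs s'' 1 = n" using A w by (auto simp: same_regs_def)
    have 3: "mem s'' a = mem s a" if "a \<notin> {x..<t + N}" for a
    proof -
      have "a \<notin> {x + i * N..<x + i * N + N} \<union> {t..<t + N}" using that iN s(8) by auto
      then show ?thesis using A I that by simp
    qed
    \<comment> \<open>Earlier blocks end at or before the start of block i, and all blocks lie
      before the buffer, so finished blocks are left alone.\<close>
    have old: "mem s'' (x + j * N + c) = mem s' (x + j * N + c)" if "j < i" "c < N" for j c
    proof -
      have "j * N + N \<le> i * N" using that mult_le_mono1[of "Suc j" i N] by simp
      then have "x + j * N + c \<notin> {x + i * N..<x + i * N + N} \<union> {t..<t + N}"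
        using that s(8) iN by auto
      then show ?thesis using A by blast
    qed
    have "good_vectors (Suc i) (vec (mem s) u) x (mem s'')"
      unfolding good_vectors_def
    proof (intro allI impI)
      fix j assume "j < Suc i"
      then consider "j = i" | "j < i" by linarith
      then show "cells (mem s'') (x + j * N) \<and>
        vec (mem s'') (x + j * N) = (\<Otimes>k\<in>{..<n} - {j}. vec (mem s) u \<ominus> bitvec k)"
      proof cases
        case 1 then show ?thesis using A vu by simp
      next
        case 2
        then have c: "cells (mem s') (x + j * N)"
          and v: "vec (mem s') (x + j * N) = (\<Otimes>k\<in>{..<n} - {j}. vec (mem s) u \<ominus> bitvec k)"
          using I by (auto simp: good_vectors_def)
        have "vec (mem s'') (x + j * N) = vec (mem s') (x + j * N)" using old[OF 2] c by (intro vec_cong) auto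
        moreover have "cells (mem s'') (x + j * N)" using c old[OF 2] by (simp add: cells_def)
        ultimately show ?thesis using v by simp
      qed
    qed
    then show "regs s'' 10 = i \<and> regs s'' 1 = n \<and> ?I (Suc i) (s''\<lparr>regs := (regs s'')(10 := Suc i)\<rparr>)"
      using 1 2 3 by simp
  qed (use s r w i mu in \<open>auto simp: cells_def\<close>)
qed (use s M in \<open>auto simp: good_vectors_def\<close>)

section \<open>Coordinatewise matrix-vector products and their comparison\<close>

definition dot_steps :: nat where
  "dot_steps = n * ((1 + (1 + ((1 + e + e) + (1 + e + e)))) + 2) + 2"

text \<open>The factor \<open>sg\<close> is 1 for \<open>add\<close> and -1 for \<open>sub\<close>,
  so that one lemma covers both uses. The address expressions may read any register that the loop
  preserves, hence the frame condition in their premises.\<close>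

lemma runs_dot:
  assumes f: "\<And>a b. a < Q \<Longrightarrow> b < Q \<Longrightarrow> f a b < Q \<and> \<pi> (f a b) = \<pi> a \<oplus> sg \<otimes> \<pi> b" "sg \<in> carrier L"
    and s: "regs s 1 = n" "regs s 20 = b" "b < Q"
    and d: "small_expr M d" "\<And>s' j. same_regs {13, 18, 19, 20} (regs s) (regs s') \<Longrightarrow> regs s' 13 = j \<Longrightarrow>
      j < n \<Longrightarrow> expr_val d s' = h j" "\<And>j. j < n \<Longrightarrow> mem s (h j) < Q"
    and d': "small_expr M d'" "\<And>s' j. same_regs {13, 18, 19, 20} (regs s) (regs s') \<Longrightarrow> regs s' 13 = j \<Longrightarrow>
      j < n \<Longrightarrow> expr_val d' s' = h' j" "\<And>j. j < n \<Longrightarrow> mem s (h' j) < Q"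
    and small: "small_expr M (Load d)" "small_expr M (Load d')"
  shows "runs M (dot f d d') s dot_steps (\<lambda>s'. same_regs {13, 18, 19, 20} (regs s) (regs s') \<and> mem s' = mem s \<and>
    regs s' 20 < Q \<and>
    \<pi> (regs s' 20) = \<pi> b \<oplus> sg \<otimes> (\<Oplus>j\<in>{..<n}. \<pi> (mem s (h j)) \<otimes> \<pi> (mem s (h' j))))"
proof -
  define S where "S i = (\<Oplus>j\<in>{..<i}. \<pi> (mem s (h j)) \<otimes> \<pi> (mem s (h' j)))" for i
  have Sc: "S i \<in> carrier L" if "i \<le> n" for i
    unfolding S_def using d(3) d'(3) that by (intro finsum_closed) auto
  have SS: "S (Suc i) = S i \<oplus> \<pi> (mem s (h i)) \<otimes> \<pi> (mem s (h' i))" if "i < n" for i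
    unfolding S_def using d(3) d'(3) that by (subst finsum_lessThan_Suc) auto
  have S0: "S 0 = \<zero>" by (simp add: S_def)
  let ?I = "\<lambda>i s'. same_regs {13, 18, 19, 20} (regs s) (regs s') \<and> mem s' = mem s \<and> regs s' 20 < Q \<and>
    \<pi> (regs s' 20) = \<pi> b \<oplus> sg \<otimes> S i"
  show ?thesis
    unfolding dot_def dot_steps_def S_def[symmetric]
  proof (rule runs_For[where I = ?I])
    fix i and s' :: state
    assume i: "i < n" and I: "?I i s'" and w: "regs s' 13 = i" "regs s' 1 = n"
    define a where "a = mem s (h i)"
    define a' where "a' = mem s (h' i)"
    define y where "y = mul a a'"
    define z where "z = f (regs s' 20) y"
    have a: "a < Q" "a' < Q" using d(3) d'(3) i by (auto simp: a_def a'_def)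
    have y: "y < Q" "\<pi> y = \<pi> a \<otimes> \<pi> a'" using mul a by (auto simp: y_def)
    have z: "z < Q" "\<pi> z = \<pi> b \<oplus> sg \<otimes> S (Suc i)"
      using f(1)[of "regs s' 20" y] I y s(3) f(2) Sc[of i] i a SS[OF i]
      by (simp_all add: z_def a_assoc r_distr a_def a'_def)
    have e1: "expr_val d s' = h i" using I w i by (intro d(2)) auto
    have e2: "expr_val d' (s'\<lparr>regs := (regs s')(18 := a)\<rparr>) = h' i" using I w i by (intro d'(2)) auto
    have bd: "regs s' 20 < 2 ^ e" "a < 2 ^ e" "a' < 2 ^ e" "y < 2 ^ e" "a \<le> M" "a' \<le> M" "y \<le> M" "z \<le> M"
      using I a y z less_Q_imp_less less_Q_imp_le_M by auto
    show "runs M (Seq (Assign 18 (Load d)) (Seq (Assign 19 (Load d'))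
       (Seq (table_op e mul 18 18 19) (table_op e f 20 20 18)))) s' (1 + (1 + ((1 + e + e) + (1 + e + e))))
       (\<lambda>s''. regs s'' 13 = i \<and> regs s'' 1 = n \<and> ?I (Suc i) (s''\<lparr>regs := (regs s'')(13 := Suc i)\<rparr>))"
      by (intro runs_Seq runs_Assign runs_table_op)
        (use I w i e1 e2 a bd z M small in \<open>simp_all add: a_def[symmetric] a'_def[symmetric] y_def[symmetric] z_def[symmetric]\<close>)
  qed (use s f(2) M in \<open>auto simp: S0\<close>)
qed

end

context field_tower
begin

abbreviation check_regs :: "nat set" where
  "check_regs \<equiv> {0, 12, 13, 14, 18, 19, 20}"

text \<open>As long as only check registers change, the address is a function of the counters 14 and
  13 alone. A matrix and its transpose differ just in how h uses the two. The size condition is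
  repeated for \<open>Load d\<close>, which is one larger than d.\<close>

definition addresses :: "state \<Rightarrow> expr \<Rightarrow> (nat \<Rightarrow> nat \<Rightarrow> nat) \<Rightarrow> bool" where
  "addresses s d h \<longleftrightarrow> small_expr M d \<and> small_expr M (Load d) \<and>
    (\<forall>s'. same_regs check_regs (regs s) (regs s') \<longrightarrow> expr_val d s' = h (regs s' 14) (regs s' 13)) \<and>
    (\<forall>i<n. \<forall>j<n. mem s (h i j) < Q)"

definition row_product :: "(nat \<Rightarrow> nat) \<Rightarrow> (nat \<Rightarrow> nat \<Rightarrow> nat) \<Rightarrow> nat \<Rightarrow> nat \<Rightarrow> nat \<Rightarrow> 'a" where
  "row_product m h x c i = (\<Oplus>j\<in>{..<n}. \<pi> (m (h i j)) \<otimes> \<pi> (m (x + j * N + c)))"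

definition row_agrees :: "(nat \<Rightarrow> nat) \<Rightarrow> (nat \<Rightarrow> nat \<Rightarrow> nat) \<Rightarrow> (nat \<Rightarrow> nat \<Rightarrow> nat) \<Rightarrow> (nat \<Rightarrow> nat \<Rightarrow> nat) \<Rightarrow>
    nat \<Rightarrow> nat \<Rightarrow> nat \<Rightarrow> bool" where
  "row_agrees m f g h x c i \<longleftrightarrow>
    (\<Oplus>j\<in>{..<n}. \<pi> (m (f i j)) \<otimes> row_product m g x c j) = row_product m h x c i"

lemma addressesD:
  assumes "addresses s d h"
  shows "small_expr M d" "small_expr M (Load d)"
    "same_regs check_regs (regs s) (regs s') \<Longrightarrow> expr_val d s' = h (regs s' 14) (regs s' 13)"
    "i < n \<Longrightarrow> j < n \<Longrightarrow> mem s (h i j) < Q"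
  using assms by (auto simp: addresses_def)

lemma addresses_cong:
  assumes "addresses s d h" "same_regs check_regs (regs s) (regs s')"
    and "\<And>i j. i < n \<Longrightarrow> j < n \<Longrightarrow> mem s' (h i j) = mem s (h i j)"
  shows "addresses s' d h"
proof -
  have "same_regs check_regs (regs s) (regs s'')" if "same_regs check_regs (regs s') (regs s'')" for s'' :: state
    using same_regs_trans[OF assms(2) that] by simp
  then show ?thesis using assms(1,3) by (simp add: addresses_def)
qed

lemma row_product_closed:
  assumes "\<And>j. j < n \<Longrightarrow> m (h i j) < Q" "\<And>j. j < n \<Longrightarrow> m (x + j * N + c) < Q"
  shows "row_product m h x c i \<in> carrier L"
  unfolding row_product_def using assms by (intro finsum_closed) auto

lemma runs_inner_products:
  assumes s: "regs s 1 = n" "regs s 2 = N" "regs s 4 = x" "regs s 6 = y" "regs s 12 = c"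
    and x: "x + n * N \<le> y" "c < N" "\<And>j. j < n \<Longrightarrow> mem s (x + j * N + c) < Q"
    and d: "addresses s d h" "\<And>i j. i < n \<Longrightarrow> j < n \<Longrightarrow> h i j < y"
  shows "runs M (inner_products d) s (n * ((1 + (dot_steps + 1)) + 2) + 2)
    (\<lambda>s'. same_regs {13, 14, 18, 19, 20} (regs s) (regs s') \<and>
      (\<forall>a. a \<notin> {y..<y + n} \<longrightarrow> mem s' a = mem s a) \<and>
      (\<forall>i<n. mem s' (y + i) < Q \<and> \<pi> (mem s' (y + i)) = row_product (mem s) h x c i))"
proof -
  let ?I = "\<lambda>i s'. same_regs {13, 14, 18, 19, 20} (regs s) (regs s') \<and>
      (\<forall>a. a \<notin> {y..<y + n} \<longrightarrow> mem s' a = mem s a) \<and>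
      (\<forall>j<i. mem s' (y + j) < Q \<and> \<pi> (mem s' (y + j)) = row_product (mem s) h x c j)"
  have xy: "x + j * N + c < y" if "j < n" for j
  proof -
    have "j * N + N \<le> n * N" using that mult_le_mono1[of "Suc j" n N] by simp
    then show ?thesis using x by linarith
  qed
  show ?thesis
    unfolding inner_products_def
  proof (rule runs_For[where I = ?I])
    fix i and s' :: state
    assume i: "i < n" and I: "?I i s'" and w: "regs s' 14 = i" "regs s' 1 = n"
    let ?Q = "\<lambda>s''. regs s'' 14 = i \<and> regs s'' 1 = n \<and> ?I (Suc i) (s''\<lparr>regs := (regs s'')(14 := Suc i)\<rparr>)"
    let ?s = "s'\<lparr>regs := (regs s')(20 := zero_cell)\<rparr>"
    have m: "mem s' a = mem s a" if "a < y" for a using I that by simp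
    have sr: "same_regs check_regs (regs s) (regs s'')"
      if "same_regs {13, 18, 19, 20} (regs ?s) (regs s'')" for s''
      by (rule same_regs_trans[of "{13, 14, 18, 19, 20}" _ "regs ?s" "{13, 18, 19, 20}"]) (use that I in auto)
    have rr: "regs s'' r = regs s r" if "same_regs {13, 18, 19, 20} (regs ?s) (regs s'')" "r \<notin> check_regs" for s'' r
      using sr[OF that(1)] that(2) by (simp add: same_regs_def)
    have r14: "regs s'' 14 = i" if "same_regs {13, 18, 19, 20} (regs ?s) (regs s'')" for s''
      using that w by (simp add: same_regs_def)
    have r12: "regs s'' 12 = c" if "same_regs {13, 18, 19, 20} (regs ?s) (regs s'')" for s''
      using that I s by (simp add: same_regs_def)
    let ?d = "\<Oplus>j\<in>{..<n}. \<pi> (mem ?s (h i j)) \<otimes> \<pi> (mem ?s (x + j * N + c))"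
    have dot: "runs M (dot add d vector_addr) ?s dot_steps (\<lambda>s''. same_regs {13, 18, 19, 20} (regs ?s) (regs s'') \<and>
      mem s'' = mem ?s \<and> regs s'' 20 < Q \<and>
      \<pi> (regs s'' 20) = \<pi> zero_cell \<oplus> \<one> \<otimes> ?d)"
    proof (rule runs_dot)
      fix s'' :: state and j
      assume A: "same_regs {13, 18, 19, 20} (regs ?s) (regs s'')" and j: "regs s'' 13 = j"
      show "expr_val d s'' = h i j" using addressesD(3)[OF d(1) sr[OF A]] r14[OF A] j by simp
      show "expr_val vector_addr s'' = x + j * N + c"
        using rr[OF A, of 2] rr[OF A, of 4] r12[OF A] j s by (simp add: vector_addr_def)
    next
      fix a b assume "a < Q" "b < Q"
      then show "add a b < Q \<and> \<pi> (add a b) = \<pi> a \<oplus> \<one> \<otimes> \<pi> b" using add by simp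
    next
      show "small_expr M vector_addr" "small_expr M (Load vector_addr)"
        using M by (auto simp: vector_addr_def small_expr_def)
    next
      fix j assume j: "j < n"
      show "mem ?s (h i j) < Q" using addressesD(4)[OF d(1) i j] m[OF d(2)[OF i j]] by simp
      show "mem ?s (x + j * N + c) < Q" using x(3)[OF j] m[OF xy[OF j]] by simp
    qed (use w addressesD(1,2)[OF d(1)] in auto)
    have eq: "?d = row_product (mem s) h x c i"
      unfolding row_product_def
      by (intro finsum_cong') (use m d(2)[OF i] xy x(3) addressesD(4)[OF d(1) i] in auto)
    have rc: "row_product (mem s) h x c i \<in> carrier L"
      by (rule row_product_closed) (use x(3) addressesD(4)[OF d(1) i] in auto)
    show "runs M (Seq (Assign 20 (Const zero_cell)) (Seq (dot add d vector_addr)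
        (Store (Bin Add (Reg 6) (Reg 14)) (Reg 20)))) s' (1 + (dot_steps + 1))
      ?Q"
    proof (rule runs_Seq, rule runs_Assign)
      show "runs M (Seq (dot add d vector_addr) (Store (Bin Add (Reg 6) (Reg 14)) (Reg 20)))
        (s'\<lparr>regs := (regs s')(20 := expr_val (Const zero_cell) s')\<rparr>) (dot_steps + 1)
        ?Q"
        unfolding expr_val.simps
      proof (rule runs_Seq, rule runs_mono[OF dot order_refl])
        fix s'' :: state
        assume A: "same_regs {13, 18, 19, 20} (regs ?s) (regs s'') \<and>
          mem s'' = mem ?s \<and> regs s'' 20 < Q \<and>
          \<pi> (regs s'' 20) = \<pi> zero_cell \<oplus> \<one> \<otimes> ?d"
        then have v: "regs s'' 20 < Q" "\<pi> (regs s'' 20) = row_product (mem s) h x c i" "mem s'' = mem s'"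
          using rc eq[simplified] by auto
        have A1: "same_regs {13, 18, 19, 20} (regs ?s) (regs s'')" using A by blast
        have y6: "regs s'' 6 = y" "regs s'' 14 = i" "regs s'' 1 = n"
          using rr[OF A1, of 6] r14[OF A1] rr[OF A1, of 1] s by auto
        have sr2: "same_regs {13, 14, 18, 19, 20} (regs s) (regs s'')"
          by (rule same_regs_trans[of "{13, 14, 18, 19, 20}" _ "regs ?s" "{13, 18, 19, 20}"]) (use A1 I in auto)
        show "runs M (Store (Bin Add (Reg 6) (Reg 14)) (Reg 20)) s'' 1
          ?Q"
        proof (rule runs_Store)
          show "?Q (s''\<lparr>mem := (mem s'')(expr_val (Bin Add (Reg 6) (Reg 14)) s'' := expr_val (Reg 20) s'')\<rparr>)"
            using y6 sr2 v I i by (auto simp: less_Suc_eq)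
        qed (use v M less_Q_imp_le_M in \<open>auto simp: small_expr_def\<close>)
      qed
    qed (use M less_Q_imp_le_M[of zero_cell] in \<open>auto simp: small_expr_def\<close>)
  qed (use s M in auto)
qed

text \<open>Register 0 is only ever cleared, so the verdict is the conjunction of all comparisons.
  Injectivity of \<open>\<pi>\<close> turns the vanishing of the accumulated difference into
  equality with \<open>zero_cell\<close>, which the machine can test.\<close>

lemma runs_compare_rows:
  assumes inj: "inj_on \<pi> {..<Q}"
    and s: "regs s 1 = n" "regs s 2 = N" "regs s 4 = x" "regs s 6 = y" "regs s 12 = c"
    and x: "c < N" "\<And>j. j < n \<Longrightarrow> mem s (x + j * N + c) < Q" "\<And>j. j < n \<Longrightarrow> mem s (y + j) < Q"
    and a: "addresses s a f" and d: "addresses s d h"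
  shows "runs M (compare_rows a d) s (n * ((1 + (dot_steps + (dot_steps + (max 1 1 + 1)))) + 2) + 2)
    (\<lambda>s'. same_regs {0, 13, 14, 18, 19, 20} (regs s) (regs s') \<and> mem s' = mem s \<and>
      regs s' 0 = (if \<forall>i<n. (\<Oplus>j\<in>{..<n}. \<pi> (mem s (f i j)) \<otimes> \<pi> (mem s (y + j))) = row_product (mem s) h x c i
        then regs s 0 else 0))"
proof -
  define G where "G i = (\<Oplus>j\<in>{..<n}. \<pi> (mem s (f i j)) \<otimes> \<pi> (mem s (y + j)))" for i
  have Gc: "G i \<in> carrier L" if "i < n" for i
    unfolding G_def using x(3) addressesD(4)[OF a that] by (intro finsum_closed) auto
  let ?I = "\<lambda>i s'. same_regs {0, 13, 14, 18, 19, 20} (regs s) (regs s') \<and> mem s' = mem s \<and>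
      regs s' 0 = (if \<forall>j<i. G j = row_product (mem s) h x c j then regs s 0 else 0)"
  show ?thesis
    unfolding compare_rows_def G_def[symmetric]
  proof (rule runs_For[where I = ?I])
    fix i and s' :: state
    assume i: "i < n" and I: "?I i s'" and w: "regs s' 14 = i" "regs s' 1 = n"
    let ?Q = "\<lambda>s''. regs s'' 14 = i \<and> regs s'' 1 = n \<and> ?I (Suc i) (s''\<lparr>regs := (regs s'')(14 := Suc i)\<rparr>)"
    let ?s = "s'\<lparr>regs := (regs s')(20 := zero_cell)\<rparr>"
    have rc: "row_product (mem s) h x c i \<in> carrier L"
      by (rule row_product_closed) (use x(2) addressesD(4)[OF d i] in auto)
    have sr: "same_regs check_regs (regs s) (regs s'')"
      if "same_regs {13, 18, 19, 20} (regs ?s) (regs s'')" for s''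
      by (rule same_regs_trans[of "{0, 13, 14, 18, 19, 20}" _ "regs ?s" "{13, 18, 19, 20}"]) (use that I in auto)
    have rr: "regs s'' r = regs s r" if "same_regs {13, 18, 19, 20} (regs ?s) (regs s'')" "r \<notin> check_regs" for s'' r
      using sr[OF that(1)] that(2) by (simp add: same_regs_def)
    have r14: "regs s'' 14 = i \<and> regs s'' 0 = regs s' 0 \<and> regs s'' 12 = c"
      if "same_regs {13, 18, 19, 20} (regs ?s) (regs s'')" for s''
      using that w I s by (simp add: same_regs_def)
    have dot1: "runs M (dot add a (Bin Add (Reg 6) (Reg 13))) ?s dot_steps (\<lambda>s''. same_regs {13, 18, 19, 20} (regs ?s) (regs s'') \<and>
      mem s'' = mem ?s \<and> regs s'' 20 < Q \<and>
      \<pi> (regs s'' 20) = \<pi> zero_cell \<oplus> \<one> \<otimes> (\<Oplus>j\<in>{..<n}. \<pi> (mem ?s (f i j)) \<otimes> \<pi> (mem ?s (y + j))))"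
    proof (rule runs_dot)
      fix s'' :: state and j
      assume A: "same_regs {13, 18, 19, 20} (regs ?s) (regs s'')" and j: "regs s'' 13 = j"
      show "expr_val a s'' = f i j" using addressesD(3)[OF a sr[OF A]] r14[OF A] j by simp
      show "expr_val (Bin Add (Reg 6) (Reg 13)) s'' = y + j"
        using rr[OF A, of 6] j s by simp
    next
      fix a b assume "a < Q" "b < Q"
      then show "add a b < Q \<and> \<pi> (add a b) = \<pi> a \<oplus> \<one> \<otimes> \<pi> b" using add by simp
    qed (use w I M x(3) addressesD(1,2)[OF a] addressesD(4)[OF a i] in \<open>auto simp: small_expr_def\<close>)
    have dot2: "runs M (dot sub d vector_addr) s1 dot_steps (\<lambda>s''. same_regs {13, 18, 19, 20} (regs s1) (regs s'') \<and>
      mem s'' = mem s1 \<and> regs s'' 20 < Q \<and>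
      \<pi> (regs s'' 20) = \<pi> (regs s1 20) \<oplus> (\<ominus> \<one>) \<otimes> (\<Oplus>j\<in>{..<n}. \<pi> (mem s1 (h i j)) \<otimes> \<pi> (mem s1 (x + j * N + c))))"
      if S: "same_regs {13, 18, 19, 20} (regs ?s) (regs s1)" and m1: "mem s1 = mem s" and q1: "regs s1 20 < Q" for s1
    proof (rule runs_dot)
      fix s'' :: state and j
      assume B: "same_regs {13, 18, 19, 20} (regs s1) (regs s'')" and j: "regs s'' 13 = j"
      have A: "same_regs {13, 18, 19, 20} (regs ?s) (regs s'')"
        using same_regs_trans[OF S B] by simp
      show "expr_val d s'' = h i j" using addressesD(3)[OF d sr[OF A]] r14[OF A] j by simp
      show "expr_val vector_addr s'' = x + j * N + c"
        using rr[OF A, of 2] rr[OF A, of 4] r14[OF A] j s by (simp add: vector_addr_def)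
    next
      fix a b assume "a < Q" "b < Q"
      then show "sub a b < Q \<and> \<pi> (sub a b) = \<pi> a \<oplus> (\<ominus> \<one>) \<otimes> \<pi> b" using sub by (simp add: minus_eq l_minus)
    next
      show "small_expr M vector_addr" "small_expr M (Load vector_addr)"
        using M by (auto simp: vector_addr_def small_expr_def)
    next
      show "regs s1 1 = n" using rr[OF S, of 1] s by simp
    qed (use q1 m1 x(2) addressesD(1,2)[OF d] addressesD(4)[OF d i] in auto)
    have final: "runs M reject_if_nonzero s2 (max 1 1 + 1) ?Q"
      if S: "same_regs {13, 18, 19, 20} (regs ?s) (regs s2)" and m2: "mem s2 = mem s" and q2: "regs s2 20 < Q"
        and v: "\<pi> (regs s2 20) = G i \<oplus> (\<ominus> \<one>) \<otimes> row_product (mem s) h x c i" for s2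
    proof -
      have "\<pi> (regs s2 20) = G i \<ominus> row_product (mem s) h x c i"
        using v rc Gc[OF i] by (simp add: minus_eq l_minus)
      then have z: "\<pi> (regs s2 20) = \<zero> \<longleftrightarrow> G i = row_product (mem s) h x c i"
        using rc Gc[OF i] by simp
      have z': "\<pi> (regs s2 20) = \<zero> \<longleftrightarrow> regs s2 20 = zero_cell"
        using inj_on_eq_iff[OF inj, of "regs s2 20" zero_cell] q2 by simp
      have sr2: "same_regs {0, 13, 14, 18, 19, 20} (regs s) (regs s2)"
        by (rule same_regs_trans[of "{0, 13, 14, 18, 19, 20}" _ "regs ?s" "{13, 18, 19, 20}"]) (use S I in auto)
      have r: "regs s2 14 = i" "regs s2 0 = regs s' 0" "regs s2 1 = n" using r14[OF S] rr[OF S, of 1] s by auto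
      show ?thesis
        unfolding reject_if_nonzero_def
      proof (rule runs_Cond_max)
        assume "expr_val (Bin Add (Bin Less (Reg 20) (Const zero_cell)) (Bin Less (Const zero_cell) (Reg 20))) s2 \<noteq> 0"
        then have "regs s2 20 \<noteq> zero_cell" by auto
        then have ne: "G i \<noteq> row_product (mem s) h x c i" using z z' by simp
        show "runs M (Assign 0 (Const 0)) s2 1 ?Q"
          by (rule runs_Assign) (use ne sr2 m2 r M i in \<open>auto simp: small_expr_def\<close>)
      next
        assume "expr_val (Bin Add (Bin Less (Reg 20) (Const zero_cell)) (Bin Less (Const zero_cell) (Reg 20))) s2 = 0"
        then have "regs s2 20 = zero_cell" by (auto split: if_splits)
        then have eq: "G i = row_product (mem s) h x c i" using z z' by simp
        show "runs M Skip s2 1 ?Q"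
          by (rule runs_Skip) (use eq sr2 m2 r I in \<open>auto simp: less_Suc_eq\<close>)
      qed (use M less_Q_imp_le_M[of zero_cell] in \<open>auto simp: small_expr_def\<close>)
    qed
    show "runs M (Seq (Assign 20 (Const zero_cell)) (Seq (dot add a (Bin Add (Reg 6) (Reg 13)))
      (Seq (dot sub d vector_addr)
        reject_if_nonzero))) s' (1 + (dot_steps + (dot_steps + (max 1 1 + 1)))) ?Q"
    proof (rule runs_Seq, rule runs_Assign)
      show "runs M (Seq (dot add a (Bin Add (Reg 6) (Reg 13)))
        (Seq (dot sub d vector_addr)
          reject_if_nonzero)) (s'\<lparr>regs := (regs s')(20 := expr_val (Const zero_cell) s')\<rparr>)
         (dot_steps + (dot_steps + (max 1 1 + 1))) ?Q"
        unfolding expr_val.simps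
      proof (rule runs_Seq, rule runs_mono[OF dot1 order_refl])
        fix s1 :: state
        assume A: "same_regs {13, 18, 19, 20} (regs ?s) (regs s1) \<and>
          mem s1 = mem ?s \<and> regs s1 20 < Q \<and>
          \<pi> (regs s1 20) = \<pi> zero_cell \<oplus> \<one> \<otimes> (\<Oplus>j\<in>{..<n}. \<pi> (mem ?s (f i j)) \<otimes> \<pi> (mem ?s (y + j)))"
        then have A1: "same_regs {13, 18, 19, 20} (regs ?s) (regs s1)" "mem s1 = mem s" "regs s1 20 < Q"
          "\<pi> (regs s1 20) = G i"
          using I Gc[OF i] by (auto simp: G_def)
        show "runs M (Seq (dot sub d vector_addr)
          reject_if_nonzero) s1 (dot_steps + (max 1 1 + 1)) ?Q"
        proof (rule runs_Seq, rule runs_mono[OF dot2[OF A1(1-3)] order_refl])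
          fix s2 :: state
          assume B: "same_regs {13, 18, 19, 20} (regs s1) (regs s2) \<and> mem s2 = mem s1 \<and> regs s2 20 < Q \<and>
            \<pi> (regs s2 20) = \<pi> (regs s1 20) \<oplus> (\<ominus> \<one>) \<otimes> (\<Oplus>j\<in>{..<n}. \<pi> (mem s1 (h i j)) \<otimes> \<pi> (mem s1 (x + j * N + c)))"
          show "runs M reject_if_nonzero s2 (max 1 1 + 1) ?Q"
          proof (rule final)
            show "same_regs {13, 18, 19, 20} (regs ?s) (regs s2)"
              by (rule same_regs_trans[OF A1(1), of "{13, 18, 19, 20}"]) (use B in auto)
            show "\<pi> (regs s2 20) = G i \<oplus> (\<ominus> \<one>) \<otimes> row_product (mem s) h x c i"
              using B unfolding A1(2,4) row_product_def by blast
          qed (use A1 B in auto)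
        qed
      qed
    qed (use M less_Q_imp_le_M[of zero_cell] in \<open>auto simp: small_expr_def\<close>)
  qed (use s M in auto)
qed

definition check_steps :: nat where
  "check_steps = N * (((n * ((1 + (dot_steps + 1)) + 2) + 2) +
    (n * ((1 + (dot_steps + (dot_steps + (max 1 1 + 1)))) + 2) + 2)) + 2) + 2"

lemma runs_check:
  assumes inj: "inj_on \<pi> {..<Q}"
    and s: "regs s 1 = n" "regs s 2 = N" "regs s 4 = x" "regs s 6 = y"
    and x: "x + n * N \<le> y" "\<And>j c. j < n \<Longrightarrow> c < N \<Longrightarrow> mem s (x + j * N + c) < Q"
    and a: "addresses s a f" "\<And>i j. i < n \<Longrightarrow> j < n \<Longrightarrow> f i j < y"
    and b: "addresses s b g" "\<And>i j. i < n \<Longrightarrow> j < n \<Longrightarrow> g i j < y"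
    and d: "addresses s d h" "\<And>i j. i < n \<Longrightarrow> j < n \<Longrightarrow> h i j < y"
  shows "runs M (check a b d) s check_steps
    (\<lambda>s'. same_regs check_regs (regs s) (regs s') \<and> (\<forall>a. a \<notin> {y..<y + n} \<longrightarrow> mem s' a = mem s a) \<and>
      regs s' 0 = (if \<forall>c<N. \<forall>i<n. row_agrees (mem s) f g h x c i then regs s 0 else 0))"
proof -
  let ?I = "\<lambda>k s'. same_regs check_regs (regs s) (regs s') \<and> (\<forall>a. a \<notin> {y..<y + n} \<longrightarrow> mem s' a = mem s a) \<and>
      regs s' 0 = (if \<forall>c<k. \<forall>i<n. row_agrees (mem s) f g h x c i then regs s 0 else 0)"
  have xy: "x + j * N + c < y" if "j < n" "c < N" for j c
  proof -
    have "j * N + N \<le> n * N" using that mult_le_mono1[of "Suc j" n N] by simp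
    then show ?thesis using x that by linarith
  qed
  show ?thesis
    unfolding check_def check_steps_def
  proof (rule runs_For[where I = ?I])
    fix c and s' :: state
    assume c: "c < N" and I: "?I c s'" and w: "regs s' 12 = c" "regs s' 2 = N"
    let ?Q = "\<lambda>s''. regs s'' 12 = c \<and> regs s'' 2 = N \<and> ?I (Suc c) (s''\<lparr>regs := (regs s'')(12 := Suc c)\<rparr>)"
    have r: "regs s' r = regs s r" if "r \<notin> check_regs" for r using I that by (simp add: same_regs_def)
    have m: "mem s' a = mem s a" if "a < y" for a using I that by simp
    have ad: "addresses s' b g" by (rule addresses_cong[OF b(1)]) (use I m[OF b(2)] in auto)
    have rp: "row_product (mem s') k x c i = row_product (mem s) k x c i"
      if "i < n" "addresses s e k" "\<And>i j. i < n \<Longrightarrow> j < n \<Longrightarrow> k i j < y" for e k i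
      unfolding row_product_def
      by (intro finsum_cong') (use that m xy c x(2) addressesD(4)[OF that(2)] in auto)
    have rpc: "row_product (mem s) k x c i \<in> carrier L" if "i < n" "addresses s e k" for e k i
      by (rule row_product_closed) (use that x(2) c addressesD(4)[OF that(2)] in auto)
    show "runs M (Seq (inner_products b)
          (compare_rows a d)) s'
        ((n * ((1 + (dot_steps + 1)) + 2) + 2) +
          (n * ((1 + (dot_steps + (dot_steps + (max 1 1 + 1)))) + 2) + 2)) ?Q"
    proof (rule runs_Seq, rule runs_mono[OF runs_inner_products[of _ x y c b g] order_refl])
      fix s1 :: state
      assume A: "same_regs {13, 14, 18, 19, 20} (regs s') (regs s1) \<and>
        (\<forall>a. a \<notin> {y..<y + n} \<longrightarrow> mem s1 a = mem s' a) \<and>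
        (\<forall>i<n. mem s1 (y + i) < Q \<and> \<pi> (mem s1 (y + i)) = row_product (mem s') g x c i)"
      have sr1: "same_regs check_regs (regs s) (regs s1)"
        by (rule same_regs_trans[of check_regs _ "regs s'" "{13, 14, 18, 19, 20}"]) (use A I in auto)
      have r1: "regs s1 r = regs s' r" if "r \<notin> {13, 14, 18, 19, 20}" for r
        using A that by (simp add: same_regs_def)
      have m1: "mem s1 a = mem s a" if "a < y" for a using A m[OF that] that by simp
      have y1: "mem s1 (y + i) < Q" "\<pi> (mem s1 (y + i)) = row_product (mem s) g x c i" if "i < n" for i
        using A that rp[OF that b] by auto
      show "runs M (compare_rows a d) s1
          (n * ((1 + (dot_steps + (dot_steps + (max 1 1 + 1)))) + 2) + 2) ?Q"
      proof (rule runs_mono[OF runs_compare_rows[OF inj, of _ x y c a f d h] order_refl])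
        fix s2 :: state
        assume B: "same_regs {0, 13, 14, 18, 19, 20} (regs s1) (regs s2) \<and> mem s2 = mem s1 \<and>
          regs s2 0 = (if \<forall>i<n. (\<Oplus>j\<in>{..<n}. \<pi> (mem s1 (f i j)) \<otimes> \<pi> (mem s1 (y + j))) = row_product (mem s1) h x c i
            then regs s1 0 else 0)"
        have sr2: "same_regs check_regs (regs s) (regs s2)"
          by (rule same_regs_trans[OF sr1, of "{0, 13, 14, 18, 19, 20}"]) (use B in auto)
        have r2: "regs s2 12 = c" "regs s2 2 = N" using B r1 w by (auto simp: same_regs_def)
        have eq1: "(\<Oplus>j\<in>{..<n}. \<pi> (mem s1 (f i j)) \<otimes> \<pi> (mem s1 (y + j)))
            = (\<Oplus>j\<in>{..<n}. \<pi> (mem s (f i j)) \<otimes> row_product (mem s) g x c j)" if i: "i < n" for i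
          by (intro finsum_cong') (use i y1 m1 a addressesD(4)[OF a(1)] rpc[OF _ b(1)] in auto)
        have eq2: "row_product (mem s1) h x c i = row_product (mem s) h x c i" if i: "i < n" for i
          unfolding row_product_def
          by (intro finsum_cong') (use i m1 xy c x(2) d addressesD(4)[OF d(1)] in auto)
        have "regs s2 0 = (if \<forall>i<n. row_agrees (mem s) f g h x c i then regs s' 0 else 0)"
          using B r1[of 0] eq1 eq2 by (auto simp: row_agrees_def)
        then have "regs s2 0 = (if \<forall>k<Suc c. \<forall>i<n. row_agrees (mem s) f g h x k i then regs s 0 else 0)"
          using I by (simp add: less_Suc_eq) blast
        moreover have "\<forall>a. a \<notin> {y..<y + n} \<longrightarrow> mem s2 a = mem s a" using B A I by simp
        ultimately show "?Q s2" using sr2 r2 by simp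
      next
        show "addresses s1 a f" by (rule addresses_cong[OF a(1) sr1]) (use m1 a(2) in auto)
        show "addresses s1 d h" by (rule addresses_cong[OF d(1) sr1]) (use m1 d(2) in auto)
      qed (use r1 r w s c x(2) m1 xy y1 in auto)
    qed (use r w s c x m xy ad b(2) in auto)
  qed (use s M in auto)
qed

end

section \<open>The choice of the degree, the memory layout and the complete run\<close>

definition grow :: "nat \<Rightarrow> com" where
  "grow l = While
     (Bin Add (Bin Less (Reg 2) (Bin Add (Load (Const 1)) (Const 1))) (Bin Less (Reg 8) (Bin Mult (Const 2) (Reg 1))))
     (Seq (Assign 8 (if l = 2 then Bin Mult (Reg 8) (Reg 8) else Bin Mult (Reg 8) (Bin Mult (Reg 8) (Reg 8))))
          (Assign 2 (Bin Mult (Reg 2) (Const l))))"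

text \<open>N is multiplied by l until N > r, which leaves a coordinate beyond the random bits, and
  2^N \<ge> 2 n, so that indices below n do not use the top coordinate. Register 8 follows along as
  2^N by taking l-th powers. The premises say that k is the first exponent with both
  properties.\<close>

lemma runs_grow:
  assumes l: "l = 2 \<or> l = 3" and s: "regs s 1 = n" "regs s 2 = 1" "regs s 8 = 2" "mem s 1 = r"
    and k: "r < l ^ k" "2 * n \<le> 2 ^ (l ^ k)" "\<And>i. i < k \<Longrightarrow> l ^ i \<le> r \<or> 2 ^ (l ^ i) < 2 * n"
    and M: "100 \<le> M" "2 ^ (l ^ k) \<le> M"
  shows "runs M (grow l) s (k * 3 + 1) (\<lambda>s'. same_regs {2, 8} (regs s) (regs s') \<and> mem s' = mem s \<and> regs s' 2 = l ^ k)"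
proof -
  let ?I = "\<lambda>i s'. same_regs {2, 8} (regs s) (regs s') \<and> mem s' = mem s \<and> regs s' 2 = l ^ i \<and> regs s' 8 = 2 ^ (l ^ i)"
  have "runs M (grow l) s (k * (1 + 1 + 1) + 1) (?I k)"
    unfolding grow_def
  proof (rule runs_While[where I = ?I])
    fix i and s' :: state
    assume i: "i < k" and I: "?I i s'"
    have r1: "regs s' 1 = n" using I s by (simp add: same_regs_def)
    have le: "l ^ Suc i \<le> l ^ k" by (rule power_increasing) (use i l in auto)
    then have "(2::nat) ^ (l ^ Suc i) \<le> 2 ^ (l ^ k)" by (rule power_increasing) auto
    then have b8: "2 ^ (l ^ Suc i) \<le> M" using M by linarith
    have b2: "l ^ Suc i \<le> M"
      using b8 less_exp[of "l ^ Suc i"] by linarith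
    have g: "expr_val (Bin Add (Bin Less (Reg 2) (Bin Add (Load (Const 1)) (Const 1)))
        (Bin Less (Reg 8) (Bin Mult (Const 2) (Reg 1)))) s' \<noteq> 0"
      using k(3)[OF i] I r1 s by auto
    have p: "expr_val (if l = 2 then Bin Mult (Reg 8) (Reg 8) else Bin Mult (Reg 8) (Bin Mult (Reg 8) (Reg 8))) s' = 2 ^ (l ^ Suc i)"
      using I l by (auto simp flip: power_add)
    have "runs M (Seq (Assign 8 (if l = 2 then Bin Mult (Reg 8) (Reg 8) else Bin Mult (Reg 8) (Bin Mult (Reg 8) (Reg 8))))
        (Assign 2 (Bin Mult (Reg 2) (Const l)))) s' (1 + 1) (?I (Suc i))"
      by (intro runs_Seq runs_Assign) (use I M b8 b2 p l in \<open>auto simp: small_expr_def\<close>)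
    then show "expr_val (Bin Add (Bin Less (Reg 2) (Bin Add (Load (Const 1)) (Const 1)))
        (Bin Less (Reg 8) (Bin Mult (Const 2) (Reg 1)))) s' \<noteq> 0 \<and>
      runs M (Seq (Assign 8 (if l = 2 then Bin Mult (Reg 8) (Reg 8) else Bin Mult (Reg 8) (Bin Mult (Reg 8) (Reg 8))))
        (Assign 2 (Bin Mult (Reg 2) (Const l)))) s' (1 + 1) (?I (Suc i))" using g by blast
  next
    fix s' :: state assume I: "?I k s'"
    have "regs s' 1 = n" using I s by (simp add: same_regs_def)
    then show "expr_val (Bin Add (Bin Less (Reg 2) (Bin Add (Load (Const 1)) (Const 1)))
        (Bin Less (Reg 8) (Bin Mult (Const 2) (Reg 1)))) s' = 0"
      using I s k(1,2) by auto
  qed (use s M in \<open>auto simp: small_expr_def\<close>)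
  then show ?thesis by (rule runs_mono) auto
qed

lemma length_mat_words: "length (mat_words n A) = n * n"
proof -
  have "length (concat (map (\<lambda>i. map (A i) [0..<n]) [0..<m])) = m * n" for m
    by (induction m) auto
  then show ?thesis by (simp add: mat_words_def)
qed

lemma nth_mat_words:
  assumes "i < n" "j < n"
  shows "mat_words n A ! (i * n + j) = A i j"
proof -
  have len: "length (concat (map (\<lambda>i. map (A i) [0..<n]) [0..<m])) = m * n" for m
    by (induction m) auto
  have "concat (map (\<lambda>i. map (A i) [0..<n]) [0..<m]) ! (i * n + j) = A i j" if "i < m" for m
    using that
  proof (induction m)
    case (Suc m)
    show ?case
    proof (cases "i = m")
      case True
      then show ?thesis using assms(2) len[of m] by (simp add: nth_append)
    next
      case False
      then have im: "i < m" using Suc.prems by simp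
      then have "i * n + n \<le> m * n" using mult_le_mono1[of "Suc i" m n] by simp
      then have "i * n + j < length (concat (map (\<lambda>i. map (A i) [0..<n]) [0..<m]))"
        using assms(2) unfolding len by linarith
      then show ?thesis using Suc.IH[OF im] by (simp add: nth_append)
    qed
  qed simp
  then show ?thesis using assms(1) by (simp add: mat_words_def)
qed

lemma mult_add_less_square: "i < n \<Longrightarrow> j < n \<Longrightarrow> i * n + j < n * (n :: nat)"
  using mult_le_mono1[of "Suc i" n n] by simp

text \<open>The clause for addresses from 2 + 3 n^2 on includes the zeros behind the random bits,
  which later pad the seed to N coordinates.\<close>

lemma initial_mem:
  fixes n A B C \<omega>
  defines "m \<equiv> mem (initial_state n A B C \<omega>)"
  shows "m 0 = n" "m (Suc 0) = length \<omega>"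
    and "\<And>i j. i < n \<Longrightarrow> j < n \<Longrightarrow> m (2 + (i * n + j)) = A i j"
    and "\<And>i j. i < n \<Longrightarrow> j < n \<Longrightarrow> m (n * n + 2 + (i * n + j)) = B i j"
    and "\<And>i j. i < n \<Longrightarrow> j < n \<Longrightarrow> m (2 * (n * n) + 2 + (i * n + j)) = C i j"
    and "\<And>c. m (2 + 3 * (n * n) + c) = (if c < length \<omega> then of_bool (\<omega> ! c) else 0)"
    and "regs (initial_state n A B C \<omega>) = (\<lambda>_. 0)"
proof -
  define ws where "ws = [n, length \<omega>] @ mat_words n A @ mat_words n B @ mat_words n C @ map of_bool \<omega>"
  have m: "m = (\<lambda>a. if a < length ws then ws ! a else 0)"
    unfolding m_def initial_state_def Let_def ws_def[symmetric] by simp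
  note l = length_mat_words
  show "m 0 = n" "m (Suc 0) = length \<omega>" by (simp_all add: m ws_def)
  show "regs (initial_state n A B C \<omega>) = (\<lambda>_. 0)" by (simp add: initial_state_def Let_def)
  have w: "ws = [n, length \<omega>] @ (mat_words n A @ (mat_words n B @ (mat_words n C @ map of_bool \<omega>)))"
    by (simp add: ws_def)
  have 2: "ws ! (2 + a) = (mat_words n A @ (mat_words n B @ (mat_words n C @ map of_bool \<omega>))) ! a" for a
    by (simp add: w)
  have lw: "length ws = 2 + 3 * (n * n) + length \<omega>" by (simp add: w l)
  fix i j assume ij: "i < n" "j < n"
  note lt = mult_add_less_square[OF ij]
  have "m (2 + (i * n + j)) = ws ! (2 + (i * n + j))" using lt by (simp add: m lw)
  also have "\<dots> = A i j" unfolding 2 using lt by (simp add: nth_append l nth_mat_words[OF ij])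
  finally show "m (2 + (i * n + j)) = A i j" .
  have "m (n * n + 2 + (i * n + j)) = ws ! (2 + (n * n + (i * n + j)))"
    using lt by (simp add: m lw algebra_simps)
  also have "\<dots> = B i j" unfolding 2 using lt by (simp add: nth_append l nth_mat_words[OF ij])
  finally show "m (n * n + 2 + (i * n + j)) = B i j" .
  have "2 * (n * n) + 2 + (i * n + j) = 2 + (n * n + (n * n + (i * n + j)))" by simp
  then have "m (2 * (n * n) + 2 + (i * n + j)) = ws ! (2 + (n * n + (n * n + (i * n + j))))"
    using lt by (simp only: m lw) simp
  also have "\<dots> = C i j" unfolding 2 using lt by (simp add: nth_append l nth_mat_words[OF ij])
  finally show "m (2 * (n * n) + 2 + (i * n + j)) = C i j" .
next
  fix c
  define ws where "ws = [n, length \<omega>] @ mat_words n A @ mat_words n B @ mat_words n C @ map of_bool \<omega>"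
  have m: "m = (\<lambda>a. if a < length ws then ws ! a else 0)"
    unfolding m_def initial_state_def Let_def ws_def[symmetric] by simp
  have w: "ws = ([n, length \<omega>] @ mat_words n A @ mat_words n B @ mat_words n C) @ map of_bool \<omega>"
    by (simp add: ws_def)
  have l: "length ([n, length \<omega>] @ mat_words n A @ mat_words n B @ mat_words n C) = 2 + 3 * (n * n)"
    by (simp add: length_mat_words)
  have lw: "length ws = 2 + 3 * (n * n) + length \<omega>" unfolding w length_append[of _ "map of_bool \<omega>"] l by simp
  have "ws ! (2 + 3 * (n * n) + c) = map of_bool \<omega> ! c" unfolding w nth_append l by simp
  then show "m (2 + 3 * (n * n) + c) = (if c < length \<omega> then of_bool (\<omega> ! c) else 0)"
    unfolding m lw by simp
qed

lemma initial_state_bounded: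
  assumes "\<And>i j. i < n \<Longrightarrow> j < n \<Longrightarrow> A i j \<le> M \<and> B i j \<le> M \<and> C i j \<le> M" "n \<le> M" "length \<omega> \<le> M" "1 \<le> M"
  shows "bounded_state M (initial_state n A B C \<omega>)"
proof -
  define ws where "ws = [n, length \<omega>] @ mat_words n A @ mat_words n B @ mat_words n C @ map of_bool \<omega>"
  have "x \<le> M" if "x \<in> set ws" for x
    using that assms by (auto simp: ws_def mat_words_def)
  then have "ws ! a \<le> M" if "a < length ws" for a using that by simp
  then show ?thesis by (simp add: bounded_state_def initial_state_def Let_def ws_def)
qed

definition matrix_addr :: "nat \<Rightarrow> nat \<Rightarrow> nat \<Rightarrow> expr" where
  "matrix_addr b i j = Bin Add (Bin Add (Bin Mult (Const b) (Bin Mult (Reg 1) (Reg 1))) (Const 2))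
     (Bin Add (Bin Mult (Reg i) (Reg 1)) (Reg j))"

text \<open>The random bits are not copied: the N > r cells that begin with them are the seed, and
  the store sets the last of these cells, which lies beyond the bits. Both n and r are read from
  memory, so the text does not depend on them. The second check runs on the transposed
  matrices.\<close>

definition (in field_tables) verifier :: "nat \<Rightarrow> com" where
  "verifier l =
     Seq (Assign 1 (Load (Const 0)))
    (Seq (Assign 0 (Const 1))
    (Seq (Assign 2 (Const 1))
    (Seq (Assign 8 (Const 2))
    (Seq (grow l)
    (Seq (Assign 3 (Bin Add (Const 2) (Bin Mult (Const 3) (Bin Mult (Reg 1) (Reg 1)))))
    (Seq (Assign 4 (Bin Add (Reg 3) (Reg 2)))
    (Seq (Assign 5 (Bin Add (Reg 4) (Bin Mult (Reg 1) (Reg 2))))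
    (Seq (Assign 6 (Bin Add (Reg 5) (Reg 2)))
    (Seq (Assign 7 (Const \<gamma>))
    (Seq (Store (Bin Monus (Bin Add (Reg 3) (Reg 2)) (Const 1)) (Const 1))
    (Seq build_vectors
    (Seq (check (matrix_addr 0 14 13) (matrix_addr 1 14 13) (matrix_addr 2 14 13))
         (check (matrix_addr 1 13 14) (matrix_addr 0 13 14) (matrix_addr 2 13 14))))))))))))))"

text \<open>
  The last coordinate is \<open>1\<close> for every seed and \<open>0\<close> for the bits of every index below \<open>n\<close>, so that
  the two kinds of points are distinct.  The cells \<open>0\<close> and \<open>1\<close> stand for two arbitrary field elements,
  not for zero and one.
\<close>

definition seed_cell :: "nat \<Rightarrow> bool list \<Rightarrow> nat \<Rightarrow> nat" where
  "seed_cell N \<omega> c = (if c = N - 1 then 1 else if c < length \<omega> then of_bool (\<omega> ! c) else 0)"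

context field_tower
begin

definition seed_vec :: "bool list \<Rightarrow> 'a" where
  "seed_vec \<omega> = (\<Oplus>c\<in>{..<N}. \<pi> (seed_cell N \<omega> c) \<otimes> \<beta> [^] c)"

definition agrees :: "nat matrix \<Rightarrow> nat matrix \<Rightarrow> nat matrix \<Rightarrow> (nat \<Rightarrow> nat \<Rightarrow> nat) \<Rightarrow> bool" where
  "agrees A B C Y \<longleftrightarrow> (\<forall>c<N. \<forall>i<n.
     (\<Oplus>j\<in>{..<n}. \<pi> (A i j) \<otimes> (\<Oplus>k\<in>{..<n}. \<pi> (B j k) \<otimes> \<pi> (Y k c))) = (\<Oplus>j\<in>{..<n}. \<pi> (C i j) \<otimes> \<pi> (Y j c)))"

definition verifier_steps :: "nat \<Rightarrow> nat" where
  "verifier_steps k = 10 + (k * 3 + 1) + (n * (build_vector_steps + 2) + 2) + check_steps + check_steps"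

text \<open>For D = A B - C, the condition x D = 0 is the condition that the transpose of D
  annihilates x, so rows and columns are exchanged and A and B swap roles. The second check
  continues with the verdict of the first and sees the same vector, because only the buffer at y is
  written.\<close>

lemma runs_checks:
  assumes inj: "inj_on \<pi> {..<Q}"
    and m0: "\<And>i j. i < n \<Longrightarrow> j < n \<Longrightarrow> A i j < Q \<and> B i j < Q \<and> C i j < Q"
      "\<And>i j. i < n \<Longrightarrow> j < n \<Longrightarrow> mem s (2 + (i * n + j)) = A i j"
      "\<And>i j. i < n \<Longrightarrow> j < n \<Longrightarrow> mem s (n * n + 2 + (i * n + j)) = B i j"
      "\<And>i j. i < n \<Longrightarrow> j < n \<Longrightarrow> mem s (2 * (n * n) + 2 + (i * n + j)) = C i j"
    and s: "regs s 0 = 1" "regs s 1 = n" "regs s 2 = N" "regs s 4 = x" "regs s 6 = y"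
    and x: "2 + 3 * (n * n) \<le> x" "x + n * N \<le> y" "\<And>j c. j < n \<Longrightarrow> c < N \<Longrightarrow> mem s (x + j * N + c) < Q"
  shows "runs M (Seq (check (matrix_addr 0 14 13) (matrix_addr 1 14 13) (matrix_addr 2 14 13))
         (check (matrix_addr 1 13 14) (matrix_addr 0 13 14) (matrix_addr 2 13 14))) s (check_steps + check_steps)
    (\<lambda>s'. regs s' 0 = of_bool (agrees A B C (\<lambda>j c. mem s (x + j * N + c)) \<and>
      agrees (\<lambda>i j. B j i) (\<lambda>i j. A j i) (\<lambda>i j. C j i) (\<lambda>j c. mem s (x + j * N + c))))"
proof -
  define h where "h b i j = b * (n * n) + 2 + (i * n + j)" for b i j :: nat
  have hy: "h b i j < y" "h b i j < x" if "i < n" "j < n" "b \<le> 2" for b i j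
  proof -
    have "b * (n * n) \<le> 2 * (n * n)" using that by (intro mult_right_mono) auto
    then show "h b i j < x" 
      using mult_add_less_square[OF that(1,2)] x(1) unfolding h_def by linarith
    then show "h b i j < y" using x by simp
  qed
  have hm: "mem s (h 0 i j) = A i j" "mem s (h 1 i j) = B i j" "mem s (h 2 i j) = C i j" if "i < n" "j < n" for i j
    using m0(2-4)[OF that] by (simp_all add: h_def)
  have hQ: "mem s (h b i j) < Q" if "i < n" "j < n" "b \<le> 2" for b i j
  proof -
    have "b = 0 \<or> b = 1 \<or> b = 2" using that by auto
    then show ?thesis using hm[OF that(1,2)] m0(1)[OF that(1,2)] by auto
  qed
  have small: "small_expr M (matrix_addr b i j)" "small_expr M (Load (matrix_addr b i j))"
    if "b \<le> 2" "i \<le> 14" "j \<le> 14" for b i j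
    using that M by (auto simp: small_expr_def matrix_addr_def)
  have ad: "addresses s' (matrix_addr b 14 13) (h b)" "addresses s' (matrix_addr b 13 14) (\<lambda>i j. h b j i)"
    if "b \<le> 2" "regs s' 1 = n" "\<And>a. a < y \<Longrightarrow> mem s' a = mem s a" for b s'
    unfolding addresses_def
    using that small hQ hy by (auto simp: same_regs_def matrix_addr_def h_def simp del: add_2_eq_Suc add_2_eq_Suc')
  have ag: "(\<forall>c<N. \<forall>i<n. row_agrees m f g h' x c i) \<longleftrightarrow> agrees A' B' C' (\<lambda>j c. mem s (x + j * N + c))"
    if fA: "\<And>i j. i < n \<Longrightarrow> j < n \<Longrightarrow> m (f i j) = A' i j" and gB: "\<And>i j. i < n \<Longrightarrow> j < n \<Longrightarrow> m (g i j) = B' i j"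
      and hC: "\<And>i j. i < n \<Longrightarrow> j < n \<Longrightarrow> m (h' i j) = C' i j"
      and lt: "\<And>i j. i < n \<Longrightarrow> j < n \<Longrightarrow> A' i j < Q \<and> B' i j < Q \<and> C' i j < Q"
      and mx: "\<And>j c. j < n \<Longrightarrow> c < N \<Longrightarrow> m (x + j * N + c) = mem s (x + j * N + c)" for m f g h' A' B' C'
  proof -
    have rp: "row_product m f' x c i = (\<Oplus>j\<in>{..<n}. \<pi> (D i j) \<otimes> \<pi> (mem s (x + j * N + c)))"
      "(\<Oplus>j\<in>{..<n}. \<pi> (D i j) \<otimes> \<pi> (mem s (x + j * N + c))) \<in> carrier L"
      if "c < N" "i < n" "\<And>i j. i < n \<Longrightarrow> j < n \<Longrightarrow> m (f' i j) = D i j" "\<And>i j. i < n \<Longrightarrow> j < n \<Longrightarrow> D i j < Q"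
      for f' D i c
      unfolding row_product_def using that x(3) mx
      by (auto intro!: finsum_cong' finsum_closed)
    have "row_agrees m f g h' x c i \<longleftrightarrow>
      (\<Oplus>j\<in>{..<n}. \<pi> (A' i j) \<otimes> (\<Oplus>k\<in>{..<n}. \<pi> (B' j k) \<otimes> \<pi> (mem s (x + k * N + c))))
        = (\<Oplus>j\<in>{..<n}. \<pi> (C' i j) \<otimes> \<pi> (mem s (x + j * N + c)))" if c: "c < N" and i: "i < n" for c i
    proof -
      have "(\<Oplus>j\<in>{..<n}. \<pi> (m (f i j)) \<otimes> row_product m g x c j)
        = (\<Oplus>j\<in>{..<n}. \<pi> (A' i j) \<otimes> (\<Oplus>k\<in>{..<n}. \<pi> (B' j k) \<otimes> \<pi> (mem s (x + k * N + c))))"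
        using fA gB lt i c rp[OF c, of _ g B'] by (intro finsum_cong') auto
      then show ?thesis using rp(1)[OF c i, of h' C'] hC lt by (simp add: row_agrees_def)
    qed
    then show ?thesis by (simp add: agrees_def)
  qed
  show ?thesis
  proof (rule runs_Seq, rule runs_mono[OF runs_check[OF inj, of _ x y _ "h 0" _ "h 1" _ "h 2"] order_refl])
    fix s1 :: state
    assume A: "same_regs check_regs (regs s) (regs s1) \<and> (\<forall>a. a \<notin> {y..<y + n} \<longrightarrow> mem s1 a = mem s a) \<and>
      regs s1 0 = (if \<forall>c<N. \<forall>i<n. row_agrees (mem s) (h 0) (h 1) (h 2) x c i then regs s 0 else 0)"
    have m1: "mem s1 a = mem s a" if "a < y" for a using A that by simp
    have r1: "regs s1 1 = n" "regs s1 2 = N" "regs s1 4 = x" "regs s1 6 = y" using A s by (auto simp: same_regs_def)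
    have xy: "x + j * N + c < y" if "j < n" "c < N" for j c
    proof -
      have "j * N + N \<le> n * N" using that mult_le_mono1[of "Suc j" n N] by simp
      then show ?thesis using x that by linarith
    qed
    have z1: "regs s1 0 = of_bool (agrees A B C (\<lambda>j c. mem s (x + j * N + c)))"
      using A ag[of "mem s" "h 0" A "h 1" B "h 2" C] hm m0(1) s(1) by simp
    show "runs M (check (matrix_addr 1 13 14) (matrix_addr 0 13 14) (matrix_addr 2 13 14)) s1 check_steps
      (\<lambda>s'. regs s' 0 = of_bool (agrees A B C (\<lambda>j c. mem s (x + j * N + c)) \<and>
        agrees (\<lambda>i j. B j i) (\<lambda>i j. A j i) (\<lambda>i j. C j i) (\<lambda>j c. mem s (x + j * N + c))))"
    proof (rule runs_mono[OF runs_check[OF inj, of _ x y _ "\<lambda>i j. h 1 j i" _ "\<lambda>i j. h 0 j i" _ "\<lambda>i j. h 2 j i"] order_refl])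
      fix s2 :: state
      assume B: "same_regs check_regs (regs s1) (regs s2) \<and> (\<forall>a. a \<notin> {y..<y + n} \<longrightarrow> mem s2 a = mem s1 a) \<and>
        regs s2 0 = (if \<forall>c<N. \<forall>i<n. row_agrees (mem s1) (\<lambda>i j. h 1 j i) (\<lambda>i j. h 0 j i) (\<lambda>i j. h 2 j i) x c i
          then regs s1 0 else 0)"
      have "(\<forall>c<N. \<forall>i<n. row_agrees (mem s1) (\<lambda>i j. h 1 j i) (\<lambda>i j. h 0 j i) (\<lambda>i j. h 2 j i) x c i) \<longleftrightarrow>
        agrees (\<lambda>i j. B j i) (\<lambda>i j. A j i) (\<lambda>i j. C j i) (\<lambda>j c. mem s (x + j * N + c))"
        by (rule ag) (use hm hy m1 m0(1) xy in auto)
      then show "regs s2 0 = of_bool (agrees A B C (\<lambda>j c. mem s (x + j * N + c)) \<and>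
        agrees (\<lambda>i j. B j i) (\<lambda>i j. A j i) (\<lambda>i j. C j i) (\<lambda>j c. mem s (x + j * N + c)))"
        using B z1 by simp
    qed (use r1 x m1 xy hy ad in auto)
  qed (use s x hy ad in auto)
qed

text \<open>The coordinates \<open>Y\<close> found in memory stay existential: it only matters that
  they are valid cells and that their blocks represent the cofactor products for the seed. The
  conditions on M cover the largest address kept in a register and the number 2^N.\<close>

lemma runs_verifier:
  assumes inj: "inj_on \<pi> {..<Q}" and l: "l = 2 \<or> l = 3" and N: "N = l ^ k"
    and k: "length \<omega> < l ^ k" "2 * n \<le> 2 ^ (l ^ k)" "\<And>i. i < k \<Longrightarrow> l ^ i \<le> length \<omega> \<or> 2 ^ (l ^ i) < 2 * n"
    and ABC: "\<And>i j. i < n \<Longrightarrow> j < n \<Longrightarrow> A i j < Q \<and> B i j < Q \<and> C i j < Q"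
    and M': "2 + 3 * (n * n) + 2 * N + n * N \<le> M" "2 ^ N \<le> M"
  shows "\<exists>t s' Y. exec (verifier l) (initial_state n A B C \<omega>) t s' \<and> t \<le> verifier_steps k * step_cost M \<and>
    (\<forall>j<n. \<forall>c<N. Y j c < Q) \<and>
    (\<forall>j<n. (\<Oplus>c\<in>{..<N}. \<pi> (Y j c) \<otimes> \<beta> [^] c) = (\<Otimes>k\<in>{..<n} - {j}. seed_vec \<omega> \<ominus> bitvec k)) \<and>
    regs s' 0 = of_bool (agrees A B C Y \<and> agrees (\<lambda>i j. B j i) (\<lambda>i j. A j i) (\<lambda>i j. C j i) Y)"
proof -
  define s0 where "s0 = initial_state n A B C \<omega>"
  define u where "u = 2 + 3 * (n * n)"
  define x where "x = u + N"
  define t where "t = x + n * N"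
  define y where "y = t + N"
  note im = initial_mem[where n = n and A = A and B = B and C = C and \<omega> = \<omega>, folded s0_def]
  have yM: "y \<le> M" using M' by (simp add: y_def t_def x_def u_def)
  define m1 where "m1 = (mem s0)(u + N - 1 := 1)"
  have m1u: "m1 (u + c) = seed_cell N \<omega> c" if "c < N" for c
    using im(6)[of c] that N_pos by (auto simp: m1_def seed_cell_def u_def)
  have "seed_cell N \<omega> c < Q" for c using Q_gt by (auto simp: seed_cell_def)
  then have cu: "cells m1 u" using m1u by (simp add: cells_def)
  have vu: "vec m1 u = seed_vec \<omega>"
    unfolding vec_def seed_vec_def using m1u cu by (intro finsum_cong') (auto simp: cells_def)
  let ?R = "\<lambda>s'. \<exists>Y. (\<forall>j<n. \<forall>c<N. Y j c < Q) \<and>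
    (\<forall>j<n. (\<Oplus>c\<in>{..<N}. \<pi> (Y j c) \<otimes> \<beta> [^] c) = (\<Otimes>k\<in>{..<n} - {j}. seed_vec \<omega> \<ominus> bitvec k)) \<and>
    regs s' 0 = of_bool (agrees A B C Y \<and> agrees (\<lambda>i j. B j i) (\<lambda>i j. A j i) (\<lambda>i j. C j i) Y)"
  let ?cs = "Seq (check (matrix_addr 0 14 13) (matrix_addr 1 14 13) (matrix_addr 2 14 13))
         (check (matrix_addr 1 13 14) (matrix_addr 0 13 14) (matrix_addr 2 13 14))"
  have rest: "runs M (Seq build_vectors ?cs) s1 ((n * (build_vector_steps + 2) + 2) + (check_steps + check_steps)) ?R"
    if r: "regs s1 0 = 1" "regs s1 1 = n" "regs s1 2 = N" "regs s1 3 = u" "regs s1 4 = x" "regs s1 5 = t"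
      "regs s1 6 = y" "regs s1 7 = \<gamma>" and m: "mem s1 = m1" for s1 :: state
  proof (rule runs_Seq, rule runs_mono[OF runs_build_vectors[of _ u x t] order_refl])
    fix s2 :: state
    assume B: "same_regs (insert 10 build_regs) (regs s1) (regs s2) \<and>
      (\<forall>a. a \<notin> {x..<t + N} \<longrightarrow> mem s2 a = mem s1 a) \<and> good_vectors n (vec (mem s1) u) x (mem s2)"
    have r2: "regs s2 0 = 1" "regs s2 1 = n" "regs s2 2 = N" "regs s2 4 = x" "regs s2 6 = y"
      using B r by (auto simp: same_regs_def)
    have m2: "mem s2 a = mem s0 a" if "a < u" for a using B m that N_pos by (auto simp add: m1_def x_def)
    have ux: "2 + (i * n + j) < u" "n * n + 2 + (i * n + j) < u" "2 * (n * n) + 2 + (i * n + j) < u"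
      if "i < n" "j < n" for i j
      using mult_add_less_square[OF that] by (simp_all add: u_def)
    have g: "cells (mem s2) (x + j * N)"
      "vec (mem s2) (x + j * N) = (\<Otimes>k\<in>{..<n} - {j}. seed_vec \<omega> \<ominus> bitvec k)" if "j < n" for j
      using B that m vu by (auto simp: good_vectors_def)
    show "runs M ?cs s2 (check_steps + check_steps) ?R"
    proof (rule runs_mono[OF runs_checks[OF inj ABC, where s = s2 and x = x and y = y] order_refl])
      fix s3 :: state
      assume "regs s3 0 = of_bool (agrees A B C (\<lambda>j c. mem s2 (x + j * N + c)) \<and>
        agrees (\<lambda>i j. B j i) (\<lambda>i j. A j i) (\<lambda>i j. C j i) (\<lambda>j c. mem s2 (x + j * N + c)))"
      then show "?R s3"
        by (intro exI[of _ "\<lambda>j c. mem s2 (x + j * N + c)"] conjI)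
          (use g in \<open>auto simp: cells_def vec_def\<close>)
    next
      show "2 + 3 * (n * n) \<le> x" by (simp add: x_def u_def)
      show "x + n * N \<le> y" by (simp add: y_def t_def)
    qed (use r2 m2 ux im g in \<open>auto simp: cells_def\<close>)
  qed (use r m cu M yM in \<open>auto simp: x_def y_def t_def\<close>)
  have init: "runs M (verifier l) s0 (1 + (1 + (1 + (1 + ((k * 3 + 1) + (1 + (1 + (1 + (1 + (1 + (1 +
      ((n * (build_vector_steps + 2) + 2) + (check_steps + check_steps))))))))))))) ?R"
    unfolding verifier_def
  proof (rule runs_Seq, rule runs_Assign, goal_cases)
    case 5
    define f1 where "f1 = (\<lambda>_ :: nat. 0 :: nat)(1 := n, 0 := 1, 2 := 1, 8 := 2)"
    have s4: "s0\<lparr>regs := (regs s0)(1 := n, 0 := 1, 2 := 1, 8 := 2)\<rparr> = s0\<lparr>regs := f1\<rparr>"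
      using im(7) by (simp add: f1_def)
    have gr: "runs M (grow l) (s0\<lparr>regs := f1\<rparr>) (k * 3 + 1) (\<lambda>s'. same_regs {2, 8} f1 (regs s') \<and>
        mem s' = mem s0 \<and> regs s' 2 = N)"
      using runs_grow[OF l, of "s0\<lparr>regs := f1\<rparr>" n "length \<omega>" k M] k M M' im(2) N by (simp add: f1_def)
    have rest2: "runs M
     (Seq (Assign 3 (Bin Add (Const 2) (Bin Mult (Const 3) (Bin Mult (Reg 1) (Reg 1)))))
     (Seq (Assign 4 (Bin Add (Reg 3) (Reg 2)))
     (Seq (Assign 5 (Bin Add (Reg 4) (Bin Mult (Reg 1) (Reg 2))))
     (Seq (Assign 6 (Bin Add (Reg 5) (Reg 2)))
     (Seq (Assign 7 (Const \<gamma>))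
     (Seq (Store (Bin Monus (Bin Add (Reg 3) (Reg 2)) (Const 1)) (Const 1))
     (Seq build_vectors ?cs))))))) s1 (1 + (1 + (1 + (1 + (1 + (1 +
      ((n * (build_vector_steps + 2) + 2) + (check_steps + check_steps)))))))) ?R"
      if S: "same_regs {2, 8} f1 (regs s1) \<and> mem s1 = mem s0 \<and> regs s1 2 = N" for s1 :: state
    proof -
      have r: "regs s1 0 = 1" "regs s1 1 = n" "regs s1 2 = N"
        using S by (simp_all add: same_regs_def f1_def)
      define f2 where "f2 = (regs s1)(3 := u, 4 := x, 5 := t, 6 := y, 7 := \<gamma>)"
      have le: "u \<le> M" "x \<le> M" "t \<le> M" "y \<le> M" "\<gamma> \<le> M" using yM less_Q_imp_le_M[of \<gamma>] by (auto simp: x_def t_def y_def)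
      have "runs M (Seq build_vectors ?cs) (s1\<lparr>regs := f2, mem := m1\<rparr>)
        ((n * (build_vector_steps + 2) + 2) + (check_steps + check_steps)) ?R"
        by (rule rest) (use r in \<open>simp_all add: f2_def\<close>)
      moreover have "s1\<lparr>regs := f2, mem := m1\<rparr>
        = s1\<lparr>regs := (regs s1)(3 := u, 4 := x, 5 := t, 6 := y, 7 := \<gamma>), mem := (mem s1)(u + N - 1 := 1)\<rparr>"
        using S by (simp add: f2_def m1_def)
      ultimately have fin: "runs M (Seq build_vectors ?cs)
        (s1\<lparr>regs := (regs s1)(3 := u, 4 := x, 5 := t, 6 := y, 7 := \<gamma>), mem := (mem s1)(u + N - 1 := 1)\<rparr>)
        ((n * (build_vector_steps + 2) + 2) + (check_steps + check_steps)) ?R" by simp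
      have ev: "2 + 3 * (n * n) = u" "u + N = x" "x + n * N = t" "t + N = y"
        by (simp_all add: u_def x_def t_def y_def)
      show ?thesis
        \<comment> \<open>The fifth premise is always the continuation. It is unfolded first, to
          expose the next command, and the size conditions are discharged together at the
          end.\<close>
        apply (rule runs_Seq, rule runs_Assign)
            prefer 5
            apply (rule runs_Seq, rule runs_Assign)
                prefer 5
                apply (rule runs_Seq, rule runs_Assign)
                    prefer 5
                    apply (rule runs_Seq, rule runs_Assign)
                        prefer 5
                        apply (rule runs_Seq, rule runs_Assign)
                            prefer 5
                            apply (rule runs_Seq, rule runs_Store)
                                prefer 5
        using fin r le M ev
                                apply (simp_all add: small_expr_def)
        done
    qed
    show ?case
      apply (rule runs_Seq, rule runs_Assign)
          prefer 5
          apply (rule runs_Seq, rule runs_Assign)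
              prefer 5
              apply (rule runs_Seq, rule runs_Assign)
                  prefer 5
                  apply (rule runs_Seq)
      using runs_mono[OF gr order_refl rest2] s4 im(1) M
                  apply (simp_all add: small_expr_def)
      done
  qed (use im(1) M in \<open>auto simp: small_expr_def\<close>)
  have bd: "bounded_state M s0"
    unfolding s0_def
  proof (rule initial_state_bounded)
    show "length \<omega> \<le> M" using k(1) M N by simp
  qed (use ABC less_Q_imp_le_M M in auto)
  have steps: "1 + (1 + (1 + (1 + ((k * 3 + 1) + (1 + (1 + (1 + (1 + (1 + (1 +
      ((n * (build_vector_steps + 2) + 2) + (check_steps + check_steps)))))))))))) = verifier_steps k"
    by (simp add: verifier_steps_def)
  from mp[OF init[unfolded steps runs_def] bd]
  obtain tt s' Y where e: "exec (verifier l) s0 tt s'" "tt \<le> verifier_steps k * step_cost M"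
    and Y: "\<forall>j<n. \<forall>c<N. Y j c < Q"
      "\<forall>j<n. (\<Oplus>c\<in>{..<N}. \<pi> (Y j c) \<otimes> \<beta> [^] c) = (\<Otimes>k\<in>{..<n} - {j}. seed_vec \<omega> \<ominus> bitvec k)"
      "regs s' 0 = of_bool (agrees A B C Y \<and> agrees (\<lambda>i j. B j i) (\<lambda>i j. A j i) (\<lambda>i j. C j i) Y)"
    by (elim exE conjE) (rule that)
  show ?thesis
    unfolding s0_def[symmetric] by (rule exI, rule exI, rule exI, rule conjI[OF e(1) conjI[OF e(2) conjI[OF Y(1) conjI[OF Y(2,3)]]]])
qed

end

section \<open>Acceptance probability\<close>

text \<open>Take a nonempty row i with the fewest entries, a in number, and any (i, j) in it. If
  column j has b entries, there are at least b nonempty rows with at least a entries each. So a b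
  \<le> card E, and the smaller of a and b has square at most card E.\<close>

lemma exists_sparse_row_or_column:
  fixes E :: "(nat \<times> nat) set"
  assumes E: "finite E" "E \<noteq> {}"
  shows "\<exists>i j. (i, j) \<in> E \<and> ((card {j. (i, j) \<in> E})\<^sup>2 \<le> card E \<or> (card {i. (i, j) \<in> E})\<^sup>2 \<le> card E)"
proof -
  define a where "a i = card {j. (i, j) \<in> E}" for i
  define I where "I = fst ` E"
  have I: "finite I" "I \<noteq> {}" using E by (auto simp: I_def)
  have fin: "finite {j. (i, j) \<in> E}" for i
    by (rule finite_subset[of _ "snd ` E"]) (use E in force)+
  obtain i where i: "i \<in> I" "\<And>i'. i' \<in> I \<Longrightarrow> a i \<le> a i'"
    using ex_min_if_finite[of "a ` I"] I arg_min_if_finite[OF I, of a] by (metis not_less)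
  obtain j where j: "(i, j) \<in> E" using i(1) by (auto simp: I_def)
  define b where "b = card {i. (i, j) \<in> E}"
  have "{i. (i, j) \<in> E} \<subseteq> I" by (force simp: I_def)
  then have b: "b \<le> card I" unfolding b_def using I by (intro card_mono) auto
  have "E = Sigma I (\<lambda>i. {j. (i, j) \<in> E})" by (force simp: I_def)
  then have "card E = (\<Sum>i\<in>I. a i)" unfolding a_def using I fin card_SigmaI by metis
  moreover have "(\<Sum>i'\<in>I. a i) \<le> (\<Sum>i\<in>I. a i)" by (rule sum_mono) (rule i(2))
  ultimately have ab: "card I * a i \<le> card E" by simp
  then have ba: "b * a i \<le> card E" using b le_trans mult_le_mono1 by blast
  show ?thesis
  proof (cases "a i \<le> b")
    case True
    then have "(a i)\<^sup>2 \<le> card E" using le_trans[OF mult_le_mono1[OF True] ba] by (simp add: power2_eq_square)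
    then show ?thesis using j by (auto simp: a_def)
  next
    case False
    then have "b \<le> a i" by simp
    from le_trans[OF mult_le_mono2[OF this] ba] have "b\<^sup>2 \<le> card E" by (simp add: power2_eq_square)
    then show ?thesis using j by (auto simp: b_def)
  qed
qed

lemma (in abelian_monoid) finsum_swap:
  assumes "finite A" "finite B" "\<And>i j. i \<in> A \<Longrightarrow> j \<in> B \<Longrightarrow> f i j \<in> carrier G"
  shows "(\<Oplus>i\<in>A. \<Oplus>j\<in>B. f i j) = (\<Oplus>j\<in>B. \<Oplus>i\<in>A. f i j)"
  using assms(1,3)
proof (induction A rule: finite_induct)
  case empty
  then show ?case by (simp add: finsum_zero)
next
  case (insert x A)
  have "(\<Oplus>i\<in>insert x A. \<Oplus>j\<in>B. f i j) = (\<Oplus>j\<in>B. f x j) \<oplus> (\<Oplus>i\<in>A. \<Oplus>j\<in>B. f i j)"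
    using insert assms(2) by (intro finsum_insert) (auto intro!: finsum_closed)
  also have "\<dots> = (\<Oplus>j\<in>B. f x j) \<oplus> (\<Oplus>j\<in>B. \<Oplus>i\<in>A. f i j)" using insert by simp
  also have "\<dots> = (\<Oplus>j\<in>B. f x j \<oplus> (\<Oplus>i\<in>A. f i j))"
    using insert by (intro finsum_addf[symmetric]) (auto intro!: finsum_closed)
  also have "\<dots> = (\<Oplus>j\<in>B. \<Oplus>i\<in>insert x A. f i j)"
    using insert by (intro finsum_cong') (auto intro!: finsum_closed simp: Pi_def)
  finally show ?case .
qed

lemma nat_eq_if_bits_eq:
  fixes a b :: nat
  assumes "a < 2 ^ N" "b < 2 ^ N" "\<And>c. c < N \<Longrightarrow> a div 2 ^ c mod 2 = b div 2 ^ c mod 2"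
  shows "a = b"
proof (rule bit_eqI)
  fix c
  show "bit a c = bit b c"
  proof (cases "c < N")
    case True
    then show ?thesis using assms(3)[of c] by (simp add: bit_iff_odd odd_iff_mod_2_eq_one)
  next
    case False
    then have "(2 :: nat) ^ N \<le> 2 ^ c" by (intro power_increasing) auto
    then have "a < 2 ^ c" "b < 2 ^ c" using assms(1,2) by linarith+
    then have "a div 2 ^ c = 0" "b div 2 ^ c = 0" by auto
    then show ?thesis by (simp add: bit_iff_odd)
  qed
qed

section \<open>Counting the seeds that pass both checks\<close>

context field_tower
begin

definition residual :: "nat matrix \<Rightarrow> nat matrix \<Rightarrow> nat matrix \<Rightarrow> nat \<Rightarrow> nat \<Rightarrow> 'a" where
  "residual A B C i j = (\<Oplus>k\<in>{..<n}. \<pi> (A i k) \<otimes> \<pi> (B k j)) \<ominus> \<pi> (C i j)"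

definition powers_independent :: bool where
  "powers_independent \<longleftrightarrow> (\<forall>c\<in>{..<N} \<rightarrow> \<pi> ` {..<Q}.
     (\<Oplus>i\<in>{..<N}. c i \<otimes> \<beta> [^] i) = \<zero> \<longrightarrow> (\<forall>i<N. c i = \<zero>))"

text \<open>The coordinatewise differences are again elements of the quadratic extension, so
  independence of the powers of \<beta> makes them vanish.\<close>

lemma coordinates_unique:
  assumes ind: "powers_independent" and inj: "inj_on \<pi> {..<Q}"
    and f: "\<And>c. c < N \<Longrightarrow> f c < Q" and g: "\<And>c. c < N \<Longrightarrow> g c < Q"
    and eq: "(\<Oplus>c\<in>{..<N}. \<pi> (f c) \<otimes> \<beta> [^] c) = (\<Oplus>c\<in>{..<N}. \<pi> (g c) \<otimes> \<beta> [^] c)" and c: "c < N"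
  shows "f c = g c"
proof -
  have "(\<Oplus>c\<in>{..<N}. \<pi> (sub (f c) (g c)) \<otimes> \<beta> [^] c)
      = (\<Oplus>c\<in>{..<N}. \<pi> (f c) \<otimes> \<beta> [^] c \<oplus> (\<ominus> \<one>) \<otimes> (\<pi> (g c) \<otimes> \<beta> [^] c))"
    using f g sub by (intro finsum_cong') (auto simp: minus_eq l_distr l_minus)
  also have "\<dots> = (\<Oplus>c\<in>{..<N}. \<pi> (f c) \<otimes> \<beta> [^] c) \<oplus> (\<Oplus>c\<in>{..<N}. (\<ominus> \<one>) \<otimes> (\<pi> (g c) \<otimes> \<beta> [^] c))"
    using f g by (intro finsum_addf) auto
  also have "(\<Oplus>c\<in>{..<N}. (\<ominus> \<one>) \<otimes> (\<pi> (g c) \<otimes> \<beta> [^] c)) = (\<ominus> \<one>) \<otimes> (\<Oplus>c\<in>{..<N}. \<pi> (g c) \<otimes> \<beta> [^] c)"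
    using g by (intro finsum_rdistr[symmetric]) auto
  also have "(\<Oplus>c\<in>{..<N}. \<pi> (f c) \<otimes> \<beta> [^] c) \<oplus> (\<ominus> \<one>) \<otimes> (\<Oplus>c\<in>{..<N}. \<pi> (g c) \<otimes> \<beta> [^] c) = \<zero>"
    unfolding eq using g finsum_closed[of "\<lambda>c. \<pi> (g c) \<otimes> \<beta> [^] c" "{..<N}"]
    by (simp add: l_minus r_neg Pi_def)
  finally have "(\<Oplus>c\<in>{..<N}. \<pi> (sub (f c) (g c)) \<otimes> \<beta> [^] c) = \<zero>" .
  moreover have "(\<lambda>c. \<pi> (sub (f c) (g c))) \<in> {..<N} \<rightarrow> \<pi> ` {..<Q}" using sub f g by auto
  ultimately have "\<forall>c<N. \<pi> (sub (f c) (g c)) = \<zero>"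
    using bspec[OF ind[unfolded powers_independent_def]] by blast
  then have "\<pi> (sub (f c) (g c)) = \<zero>" using c by blast
  then have "\<pi> (f c) \<ominus> \<pi> (g c) = \<zero>" using sub[OF f[OF c] g[OF c]] by simp
  then have "\<pi> (f c) = \<pi> (g c)" using f[OF c] g[OF c] by simp
  then show ?thesis using inj f[OF c] g[OF c] by (auto dest: inj_onD)
qed

lemma seed_cell_less [simp]: "seed_cell N \<omega> c < Q"
  using Q_gt by (auto simp: seed_cell_def)

lemma inj_on_bitvec:
  assumes "powers_independent" "inj_on \<pi> {..<Q}" "m \<le> 2 ^ N"
  shows "inj_on bitvec {..<m}"
proof (rule inj_onI)
  fix a b assume ab: "a \<in> {..<m}" "b \<in> {..<m}" "bitvec a = bitvec b"
  show "a = b"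
  proof (rule nat_eq_if_bits_eq[of _ N])
    fix c assume "c < N"
    then show "a div 2 ^ c mod 2 = b div 2 ^ c mod 2"
      using coordinates_unique[OF assms(1,2), of "\<lambda>c. a div 2 ^ c mod 2" "\<lambda>c. b div 2 ^ c mod 2" c] ab(3)
      by (simp add: bitvec_def)
  qed (use ab assms(3) in auto)
qed

lemma inj_on_seed_vec:
  assumes "powers_independent" "inj_on \<pi> {..<Q}" "r < N"
  shows "inj_on seed_vec {\<omega>. length \<omega> = r}"
proof (rule inj_onI)
  fix a b :: "bool list" assume ab: "a \<in> {\<omega>. length \<omega> = r}" "b \<in> {\<omega>. length \<omega> = r}" "seed_vec a = seed_vec b"
  show "a = b"
  proof (rule nth_equalityI)
    fix c assume c: "c < length a"
    have "seed_cell N a c = seed_cell N b c"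
      using coordinates_unique[OF assms(1,2), of "seed_cell N a" "seed_cell N b" c] ab c assms(3)
      by (simp add: seed_vec_def)
    \<comment> \<open>As r < N, the coordinate that is overwritten by 1 hides no random bit.\<close>
    moreover have "c \<noteq> N - 1" using c ab assms(3) by auto
    moreover have "c < length b" using c ab by simp
    ultimately have "(of_bool (a ! c) :: nat) = of_bool (b ! c)" using c by (simp add: seed_cell_def)
    then show "a ! c = b ! c" by (cases "a ! c"; cases "b ! c") simp_all
  qed (use ab in simp)
qed

lemma seed_vec_noteq_bitvec:
  assumes "powers_independent" "inj_on \<pi> {..<Q}" "2 * k < 2 ^ N"
  shows "seed_vec \<omega> \<noteq> bitvec k"
proof
  assume "seed_vec \<omega> = bitvec k"
  then have "seed_cell N \<omega> (N - 1) = k div 2 ^ (N - 1) mod 2"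
    using coordinates_unique[OF assms(1,2), of "seed_cell N \<omega>" "\<lambda>c. k div 2 ^ c mod 2" "N - 1"] N_pos
    by (simp add: seed_vec_def bitvec_def)
  moreover have "k < 2 ^ (N - 1)" using assms(3) N_pos by (cases N) auto
  ultimately show False by (simp add: seed_cell_def)
qed

lemma seed_vec_closed [simp]: "seed_vec \<omega> \<in> carrier L"
  unfolding seed_vec_def by (intro finsum_closed) auto

lemma residual_closed:
  assumes "\<And>i j. i < n \<Longrightarrow> j < n \<Longrightarrow> A i j < Q \<and> B i j < Q \<and> C i j < Q" "i < n" "j < n"
  shows "residual A B C i j \<in> carrier L"
  unfolding residual_def using assms by (intro minus_closed finsum_closed) auto

text \<open>Exchanging the summations turns A (B Y) - C Y into (A B - C) Y.\<close>

lemma agrees_iff: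
  assumes ABC: "\<And>i j. i < n \<Longrightarrow> j < n \<Longrightarrow> A i j < Q \<and> B i j < Q \<and> C i j < Q"
    and Y: "\<And>j c. j < n \<Longrightarrow> c < N \<Longrightarrow> Y j c < Q"
  shows "agrees A B C Y \<longleftrightarrow> (\<forall>c<N. \<forall>i<n. (\<Oplus>j\<in>{..<n}. residual A B C i j \<otimes> \<pi> (Y j c)) = \<zero>)"
proof -
  have "(\<Oplus>j\<in>{..<n}. residual A B C i j \<otimes> \<pi> (Y j c)) =
      (\<Oplus>j\<in>{..<n}. \<pi> (A i j) \<otimes> (\<Oplus>k\<in>{..<n}. \<pi> (B j k) \<otimes> \<pi> (Y k c))) \<ominus> (\<Oplus>j\<in>{..<n}. \<pi> (C i j) \<otimes> \<pi> (Y j c))"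
    and "(\<Oplus>j\<in>{..<n}. \<pi> (A i j) \<otimes> (\<Oplus>k\<in>{..<n}. \<pi> (B j k) \<otimes> \<pi> (Y k c))) \<in> carrier L"
    and "(\<Oplus>j\<in>{..<n}. \<pi> (C i j) \<otimes> \<pi> (Y j c)) \<in> carrier L"
    if c: "c < N" and i: "i < n" for c i
  proof -
    have k: "\<pi> (A i j) \<in> carrier L" "\<pi> (B j k) \<in> carrier L" "\<pi> (C i j) \<in> carrier L" "\<pi> (Y j c) \<in> carrier L"
      if "j < n" "k < n" for j k using ABC Y c i that by auto
    have kA: "\<pi> (A i j) \<in> carrier L" "\<pi> (C i j) \<in> carrier L" "\<pi> (Y j c) \<in> carrier L" if "j < n" for j
      using k that by auto
    let ?P = "\<lambda>j. \<Oplus>k\<in>{..<n}. \<pi> (A i k) \<otimes> \<pi> (B k j)"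
    have Pc: "?P j \<in> carrier L" if "j < n" for j using k that by (intro finsum_closed) auto
    have "(\<Oplus>j\<in>{..<n}. \<pi> (A i j) \<otimes> (\<Oplus>k\<in>{..<n}. \<pi> (B j k) \<otimes> \<pi> (Y k c)))
        = (\<Oplus>j\<in>{..<n}. \<Oplus>k\<in>{..<n}. \<pi> (A i j) \<otimes> (\<pi> (B j k) \<otimes> \<pi> (Y k c)))"
      using k kA by (intro finsum_cong' finsum_rdistr finsum_closed) (auto intro!: finsum_closed)
    also have "\<dots> = (\<Oplus>k\<in>{..<n}. \<Oplus>j\<in>{..<n}. \<pi> (A i j) \<otimes> (\<pi> (B j k) \<otimes> \<pi> (Y k c)))"
      using k kA by (intro finsum_swap) auto
    also have "\<dots> = (\<Oplus>k\<in>{..<n}. ?P k \<otimes> \<pi> (Y k c))"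
    proof (intro finsum_cong' refl)
      fix j assume j: "j \<in> {..<n}"
      have "?P j \<otimes> \<pi> (Y j c) = (\<Oplus>k\<in>{..<n}. \<pi> (A i k) \<otimes> \<pi> (B k j) \<otimes> \<pi> (Y j c))"
        using k kA j by (intro finsum_ldistr) auto
      also have "\<dots> = (\<Oplus>k\<in>{..<n}. \<pi> (A i k) \<otimes> (\<pi> (B k j) \<otimes> \<pi> (Y j c)))"
        using k kA j by (intro finsum_cong') (auto simp: m_assoc)
      finally show "(\<Oplus>k\<in>{..<n}. \<pi> (A i k) \<otimes> (\<pi> (B k j) \<otimes> \<pi> (Y j c))) = ?P j \<otimes> \<pi> (Y j c)" by simp
    qed (use Pc kA in auto)
    finally have 1: "(\<Oplus>j\<in>{..<n}. \<pi> (A i j) \<otimes> (\<Oplus>k\<in>{..<n}. \<pi> (B j k) \<otimes> \<pi> (Y k c))) = (\<Oplus>k\<in>{..<n}. ?P k \<otimes> \<pi> (Y k c))" .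
    then show c1: "(\<Oplus>j\<in>{..<n}. \<pi> (A i j) \<otimes> (\<Oplus>k\<in>{..<n}. \<pi> (B j k) \<otimes> \<pi> (Y k c))) \<in> carrier L"
      using Pc kA by (auto intro!: finsum_closed)
    show c2: "(\<Oplus>j\<in>{..<n}. \<pi> (C i j) \<otimes> \<pi> (Y j c)) \<in> carrier L" using kA by (intro finsum_closed) auto
    have "(\<Oplus>j\<in>{..<n}. residual A B C i j \<otimes> \<pi> (Y j c))
        = (\<Oplus>j\<in>{..<n}. ?P j \<otimes> \<pi> (Y j c) \<oplus> (\<ominus> \<one>) \<otimes> (\<pi> (C i j) \<otimes> \<pi> (Y j c)))"
      unfolding residual_def using Pc kA by (intro finsum_cong') (auto simp: minus_eq l_distr l_minus)
    also have "\<dots> = (\<Oplus>j\<in>{..<n}. ?P j \<otimes> \<pi> (Y j c)) \<oplus> (\<Oplus>j\<in>{..<n}. (\<ominus> \<one>) \<otimes> (\<pi> (C i j) \<otimes> \<pi> (Y j c)))"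
      using Pc kA by (intro finsum_addf) auto
    also have "(\<Oplus>j\<in>{..<n}. (\<ominus> \<one>) \<otimes> (\<pi> (C i j) \<otimes> \<pi> (Y j c))) = (\<ominus> \<one>) \<otimes> (\<Oplus>j\<in>{..<n}. \<pi> (C i j) \<otimes> \<pi> (Y j c))"
      using kA by (intro finsum_rdistr[symmetric]) auto
    finally show "(\<Oplus>j\<in>{..<n}. residual A B C i j \<otimes> \<pi> (Y j c)) =
      (\<Oplus>j\<in>{..<n}. \<pi> (A i j) \<otimes> (\<Oplus>k\<in>{..<n}. \<pi> (B j k) \<otimes> \<pi> (Y k c))) \<ominus> (\<Oplus>j\<in>{..<n}. \<pi> (C i j) \<otimes> \<pi> (Y j c))"
      using c2 unfolding 1 by (simp add: minus_eq l_minus)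
  qed
  then show ?thesis by (simp add: agrees_def)
qed

lemma residual_transpose:
  assumes "\<And>i j. i < n \<Longrightarrow> j < n \<Longrightarrow> A i j < Q \<and> B i j < Q \<and> C i j < Q" "i < n" "j < n"
  shows "residual (\<lambda>i j. B j i) (\<lambda>i j. A j i) (\<lambda>i j. C j i) i j = residual A B C j i"
proof -
  have "(\<Oplus>k\<in>{..<n}. \<pi> (B k i) \<otimes> \<pi> (A j k)) = (\<Oplus>k\<in>{..<n}. \<pi> (A j k) \<otimes> \<pi> (B k i))"
    using assms by (intro finsum_cong') (auto simp: m_comm)
  then show ?thesis by (simp add: residual_def)
qed

text \<open>Weighting the coordinate equations by \<beta>^c and adding them up gives one equation
  over the large field, in the form to which the count of zeros applies.\<close>

lemma agrees_imp_vector_zero: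
  assumes ABC: "\<And>i j. i < n \<Longrightarrow> j < n \<Longrightarrow> A i j < Q \<and> B i j < Q \<and> C i j < Q"
    and Y: "\<And>j c. j < n \<Longrightarrow> c < N \<Longrightarrow> Y j c < Q" and ag: "agrees A B C Y" and i: "i < n"
  shows "(\<Oplus>j\<in>{..<n}. residual A B C i j \<otimes> (\<Oplus>c\<in>{..<N}. \<pi> (Y j c) \<otimes> \<beta> [^] c)) = \<zero>"
proof -
  let ?D = "residual A B C i"
  have D: "?D j \<in> carrier L" if "j < n" for j using residual_closed[where A = A and B = B and C = C] ABC i that by blast
  have Yc: "\<pi> (Y j c) \<in> carrier L" if "j < n" "c < N" for j c using Y that by auto
  have "(\<Oplus>j\<in>{..<n}. ?D j \<otimes> (\<Oplus>c\<in>{..<N}. \<pi> (Y j c) \<otimes> \<beta> [^] c))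
      = (\<Oplus>j\<in>{..<n}. \<Oplus>c\<in>{..<N}. ?D j \<otimes> (\<pi> (Y j c) \<otimes> \<beta> [^] c))"
    using D Yc by (intro finsum_cong' finsum_rdistr) (auto intro!: finsum_closed)
  also have "\<dots> = (\<Oplus>c\<in>{..<N}. \<Oplus>j\<in>{..<n}. ?D j \<otimes> (\<pi> (Y j c) \<otimes> \<beta> [^] c))"
    using D Yc by (intro finsum_swap) auto
  also have "\<dots> = (\<Oplus>c\<in>{..<N}. \<zero>)"
  proof (intro finsum_cong' refl)
    fix c assume c: "c \<in> {..<N}"
    have "(\<Oplus>j\<in>{..<n}. ?D j \<otimes> (\<pi> (Y j c) \<otimes> \<beta> [^] c)) = (\<Oplus>j\<in>{..<n}. ?D j \<otimes> \<pi> (Y j c) \<otimes> \<beta> [^] c)"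
      using D Yc c by (intro finsum_cong') (auto simp: m_assoc)
    also have "\<dots> = (\<Oplus>j\<in>{..<n}. ?D j \<otimes> \<pi> (Y j c)) \<otimes> \<beta> [^] c"
      using D Yc c by (intro finsum_ldistr[symmetric]) auto
    also have "(\<Oplus>j\<in>{..<n}. ?D j \<otimes> \<pi> (Y j c)) = \<zero>"
      using agrees_iff[where A = A and B = B and C = C and Y = Y] ABC Y ag c i by blast
    finally show "(\<Oplus>j\<in>{..<n}. ?D j \<otimes> (\<pi> (Y j c) \<otimes> \<beta> [^] c)) = \<zero>" by simp
  qed auto
  finally show ?thesis by (simp add: finsum_zero)
qed

text \<open>A condition free of the program. It holds for every string whose run returns 1, which is
  the direction that an error bound requires.\<close>

definition accepts :: "nat matrix \<Rightarrow> nat matrix \<Rightarrow> nat matrix \<Rightarrow> bool list \<Rightarrow> bool" where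
  "accepts A B C \<omega> \<longleftrightarrow> (\<exists>Y. (\<forall>j<n. \<forall>c<N. Y j c < Q) \<and>
    (\<forall>j<n. (\<Oplus>c\<in>{..<N}. \<pi> (Y j c) \<otimes> \<beta> [^] c) = (\<Otimes>k\<in>{..<n} - {j}. seed_vec \<omega> \<ominus> bitvec k)) \<and>
    agrees A B C Y \<and> agrees (\<lambda>i j. B j i) (\<lambda>i j. A j i) (\<lambda>i j. C j i) Y)"

text \<open>Every accepted seed is a zero of the cofactor sums of row i and of column j, for the
  pair (i, j) of the sparse row or column. Both sums have a nonzero coefficient at (i, j), so the
  number of accepted seeds is below both supports, one of which has square at most card E.\<close>

lemma card_accepting:
  assumes ind: "powers_independent" and inj: "inj_on \<pi> {..<Q}" and r: "r < N" and nN: "2 * n \<le> 2 ^ N"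
    and ABC: "\<And>i j. i < n \<Longrightarrow> j < n \<Longrightarrow> A i j < Q \<and> B i j < Q \<and> C i j < Q"
    and E: "E = {(i, j). i < n \<and> j < n \<and> residual A B C i j \<noteq> \<zero>}" "E \<noteq> {}"
  shows "(card {\<omega>. length \<omega> = r \<and> accepts A B C \<omega>})\<^sup>2 \<le> card E"
proof -
  let ?Z = "{\<omega>. length \<omega> = r \<and> accepts A B C \<omega>}"
  have finE: "finite E" unfolding E by (rule finite_subset[of _ "{..<n} \<times> {..<n}"]) auto
  have finZ: "finite ?Z"
    by (rule finite_subset[OF _ finite_lists_length_eq[of "UNIV :: bool set" r]]) auto
  have "inj_on seed_vec ?Z" by (rule inj_on_subset[OF inj_on_seed_vec[OF ind inj r]]) auto
  then have cZ: "card ?Z = card (seed_vec ` ?Z)" by (simp add: card_image)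
  have binj: "inj_on bitvec {..<n}" by (rule inj_on_bitvec[OF ind inj]) (use nN in simp)
  have disj: "seed_vec ` ?Z \<inter> bitvec ` {..<n} = {}"
    using seed_vec_noteq_bitvec[OF ind inj] nN by fastforce
  have less: "card ?Z < card {j. j < n \<and> D j \<noteq> \<zero>}"
    if D: "\<And>j. j < n \<Longrightarrow> D j \<in> carrier L" "j0 < n" "D j0 \<noteq> \<zero>"
      and z: "\<And>\<omega>. accepts A B C \<omega> \<Longrightarrow> (\<Oplus>j\<in>{..<n}. D j \<otimes> (\<Otimes>k\<in>{..<n} - {j}. seed_vec \<omega> \<ominus> bitvec k)) = \<zero>"
    for D j0
    unfolding cZ
    by (rule card_zeros_cofactor_sum[of bitvec n D j0]) (use D z binj disj finZ in auto)
  obtain i j where ij: "(i, j) \<in> E"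
    "(card {j. (i, j) \<in> E})\<^sup>2 \<le> card E \<or> (card {i. (i, j) \<in> E})\<^sup>2 \<le> card E"
    using exists_sparse_row_or_column[OF finE E(2)] by blast
  have ij': "i < n" "j < n" "residual A B C i j \<noteq> \<zero>" using ij(1) by (auto simp: E)
  have res: "residual A B C i j \<in> carrier L" if "i < n" "j < n" for i j
    using residual_closed[where A = A and B = B and C = C] ABC that by blast
  have row: "(\<Oplus>j\<in>{..<n}. residual A B C i j \<otimes> (\<Otimes>k\<in>{..<n} - {j}. seed_vec \<omega> \<ominus> bitvec k)) = \<zero>"
    and col: "(\<Oplus>i\<in>{..<n}. residual A B C i j \<otimes> (\<Otimes>k\<in>{..<n} - {i}. seed_vec \<omega> \<ominus> bitvec k)) = \<zero>"
    if acc: "accepts A B C \<omega>" for \<omega>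
  proof -
    obtain Y where Y: "\<And>j c. j < n \<Longrightarrow> c < N \<Longrightarrow> Y j c < Q"
      "\<And>j. j < n \<Longrightarrow> (\<Oplus>c\<in>{..<N}. \<pi> (Y j c) \<otimes> \<beta> [^] c) = (\<Otimes>k\<in>{..<n} - {j}. seed_vec \<omega> \<ominus> bitvec k)"
      "agrees A B C Y" "agrees (\<lambda>i j. B j i) (\<lambda>i j. A j i) (\<lambda>i j. C j i) Y"
      using acc unfolding accepts_def by blast
    have vc: "(\<Otimes>k\<in>{..<n} - {j}. seed_vec \<omega> \<ominus> bitvec k) \<in> carrier L" for j
      by (intro finprod_closed) auto
    have "(\<Oplus>j\<in>{..<n}. residual A B C i j \<otimes> (\<Otimes>k\<in>{..<n} - {j}. seed_vec \<omega> \<ominus> bitvec k))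
        = (\<Oplus>j\<in>{..<n}. residual A B C i j \<otimes> (\<Oplus>c\<in>{..<N}. \<pi> (Y j c) \<otimes> \<beta> [^] c))"
      using Y(2) res ij' vc by (intro finsum_cong') auto
    also have "\<dots> = \<zero>" by (rule agrees_imp_vector_zero[OF ABC Y(1) Y(3) ij'(1)])
    finally show "(\<Oplus>j\<in>{..<n}. residual A B C i j \<otimes> (\<Otimes>k\<in>{..<n} - {j}. seed_vec \<omega> \<ominus> bitvec k)) = \<zero>" .
    have "(\<Oplus>i\<in>{..<n}. residual A B C i j \<otimes> (\<Otimes>k\<in>{..<n} - {i}. seed_vec \<omega> \<ominus> bitvec k))
        = (\<Oplus>i\<in>{..<n}. residual (\<lambda>i j. B j i) (\<lambda>i j. A j i) (\<lambda>i j. C j i) j i \<otimes> (\<Oplus>c\<in>{..<N}. \<pi> (Y i c) \<otimes> \<beta> [^] c))"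
      using Y(2) res ij' vc residual_transpose[where A = A and B = B and C = C, OF ABC] by (intro finsum_cong') auto
    also have "\<dots> = \<zero>" by (rule agrees_imp_vector_zero[OF _ Y(1) Y(4) ij'(2)]) (use ABC in auto)
    finally show "(\<Oplus>i\<in>{..<n}. residual A B C i j \<otimes> (\<Otimes>k\<in>{..<n} - {i}. seed_vec \<omega> \<ominus> bitvec k)) = \<zero>" .
  qed
  have "card ?Z < card {j. j < n \<and> residual A B C i j \<noteq> \<zero>}"
    by (rule less[of _ j]) (use res ij' row in auto)
  then have 1: "card ?Z \<le> card {j. (i, j) \<in> E}" using ij' by (simp add: E)
  have "card ?Z < card {i. i < n \<and> residual A B C i j \<noteq> \<zero>}"
    by (rule less[of _ i]) (use res ij' col in auto)
  then have 2: "card ?Z \<le> card {i. (i, j) \<in> E}" using ij' by (simp add: E)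
  show ?thesis using ij(2) power_mono[OF 1, of 2] power_mono[OF 2, of 2] by linarith
qed

text \<open>The cube stems from building the vector: n entries with up to n factors each, and N^2
  table lookups of depth e per factor. The two checks take about N n^2 lookups and contribute only
  W^2.\<close>

lemma verifier_steps_le:
  assumes W: "1 \<le> W" "N \<le> W" "e \<le> W" "k \<le> W" and n: "1 \<le> n"
  shows "verifier_steps k \<le> 200 * n\<^sup>2 * W ^ 3"
proof -
  have W2: "W \<le> W\<^sup>2" "W\<^sup>2 \<le> W ^ 3" "1 \<le> W ^ 3"
    using W(1) by (auto intro!: power_increasing[of 2 3 W] self_le_power)
  have n2: "n \<le> n\<^sup>2" "1 \<le> n\<^sup>2" using n by (auto intro!: self_le_power)
  have p1: "N * (6 * e + 10 + 2) \<le> 18 * W\<^sup>2"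
    using mult_mono[of N W "6 * e + 10 + 2" "18 * W"] W by (simp add: power2_eq_square)
  have "(1 + (1 + (1 + ((1 + e + e) + (N * (6 * e + 10 + 2) + 2))))) + 2 \<le> 28 * W\<^sup>2"
    using W W2 p1 by linarith
  then have p2: "N * ((1 + (1 + (1 + ((1 + e + e) + (N * (6 * e + 10 + 2) + 2))))) + 2) \<le> W * (28 * W\<^sup>2)"
    using W by (intro mult_mono) auto
  have td: "times_diff_steps \<le> 43 * W ^ 3"
  proof -
    have "W * (28 * W\<^sup>2) = 28 * W ^ 3" by (simp add: power2_eq_square power3_eq_cube)
    then show ?thesis unfolding times_diff_steps_def using p2 W W2 by linarith
  qed
  have p3: "n * ((max times_diff_steps 1 + 1) + 2) \<le> n * (46 * W ^ 3)" using td W2 by (intro mult_mono) auto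
  have nW: "n * 1 \<le> n * W ^ 3" "1 * W ^ 3 \<le> n * W ^ 3" using W2 n by (intro mult_mono; simp)+
  have bv: "build_vector_steps \<le> 55 * (n * W ^ 3)"
    unfolding build_vector_steps_def using p3 W W2 n nW by linarith
  have "build_vector_steps + 2 \<le> 57 * (n * W ^ 3)" using bv W2 nW by linarith
  then have p4: "n * (build_vector_steps + 2) \<le> n * (57 * (n * W ^ 3))" by (rule mult_le_mono2)
  have nnW: "1 * 1 \<le> n\<^sup>2 * W ^ 3" "1 * W ^ 3 \<le> n\<^sup>2 * W ^ 3" "n\<^sup>2 * W\<^sup>2 \<le> n\<^sup>2 * W ^ 3" using W2 n2 by (intro mult_mono; simp)+
  have b: "n * (build_vector_steps + 2) + 2 \<le> 59 * (n\<^sup>2 * W ^ 3)"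
  proof -
    have "n * (57 * (n * W ^ 3)) = 57 * (n\<^sup>2 * W ^ 3)" by (simp add: power2_eq_square)
    then show ?thesis using p4 nnW(1) by linarith
  qed
  have nW1: "1 * W \<le> n * W" "n * 1 \<le> n * W" using n W by (intro mult_mono; simp)+
  have "n * ((1 + (1 + ((1 + e + e) + (1 + e + e)))) + 2) \<le> n * (10 * W)" using W by (intro mult_mono) auto
  then have dot: "dot_steps \<le> 12 * (n * W)" unfolding dot_steps_def using nW1 W n by linarith
  have "(1 + (dot_steps + 1)) + 2 \<le> 16 * (n * W)" using dot nW1 W by linarith
  then have q1: "n * ((1 + (dot_steps + 1)) + 2) \<le> n * (16 * (n * W))" by (rule mult_le_mono2)
  have "(1 + (dot_steps + (dot_steps + (max 1 1 + 1)))) + 2 \<le> 29 * (n * W)"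
    unfolding max.idem using dot nW1 W by linarith
  then have q2: "n * ((1 + (dot_steps + (dot_steps + (max 1 1 + 1)))) + 2) \<le> n * (29 * (n * W))"
    by (rule mult_le_mono2)
  have nn: "1 \<le> n * n * W" using n W by simp
  have "N * (((n * ((1 + (dot_steps + 1)) + 2) + 2) +
    (n * ((1 + (dot_steps + (dot_steps + (max 1 1 + 1)))) + 2) + 2)) + 2) \<le> W * (51 * (n * n * W))"
  proof (rule mult_le_mono)
    have "n * (16 * (n * W)) = 16 * (n * n * W)" "n * (29 * (n * W)) = 29 * (n * n * W)" by simp_all
    then show "((n * ((1 + (dot_steps + 1)) + 2) + 2) +
      (n * ((1 + (dot_steps + (dot_steps + (max 1 1 + 1)))) + 2) + 2)) + 2 \<le> 51 * (n * n * W)"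
      using q1 q2 nn by linarith
  qed (rule W)
  moreover have "W * (51 * (n * n * W)) = 51 * (n\<^sup>2 * W\<^sup>2)" by (simp add: power2_eq_square)
  ultimately have c: "check_steps \<le> 53 * (n\<^sup>2 * W ^ 3)"
    unfolding check_steps_def using nnW by linarith
  show ?thesis proof -
    have "200 * n\<^sup>2 * W ^ 3 = 200 * (n\<^sup>2 * W ^ 3)" by simp
    then show ?thesis unfolding verifier_steps_def using b c W W2 nnW by linarith
  qed
qed

end

section \<open>Correctness and running time\<close>

text \<open>This carries the promise on the nonzero entries, which concerns F, over to the residual
  in L.\<close>

lemma (in field_tower) residual_eq_hom:
  fixes F :: "nat ring"
  assumes F: "field F" "carrier F = {..<q}" "q \<le> Q" and h: "\<pi> \<in> ring_hom F L"
    and ABC: "A \<in> square_matrices F n" "B \<in> square_matrices F n" "C \<in> square_matrices F n"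
    and ij: "i < n" "j < n"
  shows "residual A B C i j = \<pi> (mat_diff F (mat_prod F n A B) C i j)"
    and "mat_diff F (mat_prod F n A B) C i j \<in> carrier F"
proof -
  interpret F: field F by fact
  interpret h: ring_hom_cring F L \<pi>
    using h F.is_cring is_cring by (intro ring_hom_cringI)
  have c: "A i k \<in> carrier F" "B k j \<in> carrier F" "C i j \<in> carrier F" if "k < n" for k
    using ABC ij that by (auto simp: square_matrices_def)
  have p: "(\<Oplus>\<^bsub>F\<^esub>k\<in>{..<n}. A i k \<otimes>\<^bsub>F\<^esub> B k j) \<in> carrier F"
    using c by (intro F.finsum_closed) auto
  have "\<pi> (\<Oplus>\<^bsub>F\<^esub>k\<in>{..<n}. A i k \<otimes>\<^bsub>F\<^esub> B k j) = (\<Oplus>k\<in>{..<n}. \<pi> (A i k) \<otimes> \<pi> (B k j))"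
    using c by (subst h.hom_finsum) (auto intro!: finsum_cong')
  then show "residual A B C i j = \<pi> (mat_diff F (mat_prod F n A B) C i j)"
    using p c ij by (simp add: residual_def mat_diff_def mat_prod_def minus_eq F.minus_eq)
  show "mat_diff F (mat_prod F n A B) C i j \<in> carrier F"
    using p c ij by (simp add: mat_diff_def mat_prod_def)
qed

text \<open>The error is one-sided. If A B = C, the residual is zero and every vector passes both
  checks; otherwise a wrong verdict means acceptance, and the accepted seeds have been
  counted.\<close>

lemma (in field_tower) verifier_correct:
  fixes F :: "nat ring"
  assumes F: "field F" "carrier F = {..<q}" "q \<le> Q" and h: "\<pi> \<in> ring_hom F L" and inj: "inj_on \<pi> {..<Q}"
    and ind: "powers_independent"
    and l: "l = 2 \<or> l = 3" "N = l ^ k"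
    and k: "r < l ^ k" "2 * n \<le> 2 ^ (l ^ k)" "\<forall>i<k. l ^ i \<le> r \<or> 2 ^ (l ^ i) < 2 * n"
    and ABC: "A \<in> square_matrices F n" "B \<in> square_matrices F n" "C \<in> square_matrices F n"
    and M': "2 + 3 * (n * n) + 2 * N + n * N \<le> M" "2 ^ N \<le> M"
  shows "length \<omega> = r \<Longrightarrow> \<exists>t s'. exec (verifier l) (initial_state n A B C \<omega>) t s' \<and> t \<le> verifier_steps k * step_cost M"
    and "(card {\<omega>. length \<omega> = r \<and> \<not> outputs (verifier l) (initial_state n A B C \<omega>) (MMV_answer F n A B C)})\<^sup>2
      \<le> num_nonzero F n (mat_diff F (mat_prod F n A B) C)"
proof -
  interpret F: field F by fact
  interpret h: ring_hom_cring F L \<pi>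
    using h F.is_cring is_cring by (intro ring_hom_cringI)
  have lt: "A i j < Q \<and> B i j < Q \<and> C i j < Q" if "i < n" "j < n" for i j
    using ABC that F(2,3) by (force simp: square_matrices_def)
  note res = residual_eq_hom[OF F h ABC]
  let ?D = "mat_diff F (mat_prod F n A B) C"
  have zero: "residual A B C i j = \<zero> \<longleftrightarrow> ?D i j = \<zero>\<^bsub>F\<^esub>" if "i < n" "j < n" for i j
  proof -
    have "\<zero>\<^bsub>F\<^esub> \<in> carrier F" by simp
    then have "\<zero>\<^bsub>F\<^esub> < Q" "?D i j < Q" using res(2)[OF that] F(2,3) by auto
    then show ?thesis using res(1)[OF that] inj_on_eq_iff[OF inj, of "?D i j" "\<zero>\<^bsub>F\<^esub>"] by simp
  qed
  have answer: "MMV_answer F n A B C \<longleftrightarrow> (\<forall>i<n. \<forall>j<n. ?D i j = \<zero>\<^bsub>F\<^esub>)"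
  proof -
    have "mat_prod F n A B i j = C i j \<longleftrightarrow> ?D i j = \<zero>\<^bsub>F\<^esub>" if "i < n" "j < n" for i j
    proof -
      have "mat_prod F n A B i j \<in> carrier F" "C i j \<in> carrier F"
        unfolding mat_prod_def using ABC that by (auto simp: square_matrices_def intro!: F.finsum_closed)
      then show ?thesis by (simp add: mat_diff_def)
    qed
    then show ?thesis by (simp add: MMV_answer_def mat_eq_def)
  qed
  have run: "\<exists>t s' Y. exec (verifier l) (initial_state n A B C \<omega>) t s' \<and> t \<le> verifier_steps k * step_cost M \<and>
    (\<forall>j<n. \<forall>c<N. Y j c < Q) \<and>
    (\<forall>j<n. (\<Oplus>c\<in>{..<N}. \<pi> (Y j c) \<otimes> \<beta> [^] c) = (\<Otimes>k\<in>{..<n} - {j}. seed_vec \<omega> \<ominus> bitvec k)) \<and>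
    regs s' 0 = of_bool (agrees A B C Y \<and> agrees (\<lambda>i j. B j i) (\<lambda>i j. A j i) (\<lambda>i j. C j i) Y)"
    if w: "length \<omega> = r" for \<omega>
    by (rule runs_verifier[OF inj l]) (use k w lt M' in auto)
  show "\<exists>t s'. exec (verifier l) (initial_state n A B C \<omega>) t s' \<and> t \<le> verifier_steps k * step_cost M"
    if "length \<omega> = r" using run[OF that] by blast
  let ?bad = "{\<omega>. length \<omega> = r \<and> \<not> outputs (verifier l) (initial_state n A B C \<omega>) (MMV_answer F n A B C)}"
  define E where "E = {(i, j). i < n \<and> j < n \<and> residual A B C i j \<noteq> \<zero>}"
  have EE: "E = {(i, j). i < n \<and> j < n \<and> ?D i j \<noteq> \<zero>\<^bsub>F\<^esub>}" using zero by (auto simp: E_def)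
  then have nn: "num_nonzero F n ?D = card E" by (simp add: num_nonzero_def)
  show "(card ?bad)\<^sup>2 \<le> num_nonzero F n ?D"
  proof (cases "E = {}")
    case True
    then have D0: "residual A B C i j = \<zero>" if "i < n" "j < n" for i j using that by (auto simp: E_def)
    have ans: "MMV_answer F n A B C" using True EE unfolding answer by blast
    have "outputs (verifier l) (initial_state n A B C \<omega>) (MMV_answer F n A B C)" if w: "length \<omega> = r" for \<omega>
    proof -
      obtain t s' Y where e: "exec (verifier l) (initial_state n A B C \<omega>) t s'"
        and Y: "\<forall>j<n. \<forall>c<N. Y j c < Q"
        and o: "regs s' 0 = of_bool (agrees A B C Y \<and> agrees (\<lambda>i j. B j i) (\<lambda>i j. A j i) (\<lambda>i j. C j i) Y)"
        using run[OF w] by (elim exE conjE) (rule that)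
      have Yc: "\<pi> (Y j c) \<in> carrier L" if "j < n" "c < N" for j c using Y that by auto
      have 1: "agrees A B C Y"
      proof (subst agrees_iff)
        show "\<forall>c<N. \<forall>i<n. (\<Oplus>j\<in>{..<n}. residual A B C i j \<otimes> \<pi> (Y j c)) = \<zero>"
        proof (intro allI impI)
          fix c i assume ci: "c < N" "i < n"
          have "(\<Oplus>j\<in>{..<n}. residual A B C i j \<otimes> \<pi> (Y j c)) = (\<Oplus>j\<in>{..<n}. \<zero>)"
            using D0 Yc ci by (intro finsum_cong') auto
          then show "(\<Oplus>j\<in>{..<n}. residual A B C i j \<otimes> \<pi> (Y j c)) = \<zero>" by (simp add: finsum_zero)
        qed
      qed (use lt Y in auto)
      have 2: "agrees (\<lambda>i j. B j i) (\<lambda>i j. A j i) (\<lambda>i j. C j i) Y"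
      proof (subst agrees_iff)
        show "\<forall>c<N. \<forall>i<n. (\<Oplus>j\<in>{..<n}. residual (\<lambda>i j. B j i) (\<lambda>i j. A j i) (\<lambda>i j. C j i) i j \<otimes> \<pi> (Y j c)) = \<zero>"
        proof (intro allI impI)
          fix c i assume ci: "c < N" "i < n"
          have "(\<Oplus>j\<in>{..<n}. residual (\<lambda>i j. B j i) (\<lambda>i j. A j i) (\<lambda>i j. C j i) i j \<otimes> \<pi> (Y j c)) = (\<Oplus>j\<in>{..<n}. \<zero>)"
            using D0 Yc ci residual_transpose[where A = A and B = B and C = C, OF lt] by (intro finsum_cong') auto
          then show "(\<Oplus>j\<in>{..<n}. residual (\<lambda>i j. B j i) (\<lambda>i j. A j i) (\<lambda>i j. C j i) i j \<otimes> \<pi> (Y j c)) = \<zero>"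
            by (simp add: finsum_zero)
        qed
      qed (use lt Y in auto)
      show ?thesis unfolding outputs_def using e o 1 2 ans by auto
    qed
    then have bad: "?bad = {}" by blast
    show ?thesis unfolding bad by simp
  next
    case False
    then have ans: "\<not> MMV_answer F n A B C" using EE unfolding answer by blast
    have sub: "?bad \<subseteq> {\<omega>. length \<omega> = r \<and> accepts A B C \<omega>}"
    proof
      fix \<omega> assume w: "\<omega> \<in> ?bad"
      then have w': "length \<omega> = r" by simp
      obtain t s' Y where e: "exec (verifier l) (initial_state n A B C \<omega>) t s'"
        and Y: "\<forall>j<n. \<forall>c<N. Y j c < Q"
          "\<forall>j<n. (\<Oplus>c\<in>{..<N}. \<pi> (Y j c) \<otimes> \<beta> [^] c) = (\<Otimes>k\<in>{..<n} - {j}. seed_vec \<omega> \<ominus> bitvec k)"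
        and o: "regs s' 0 = of_bool (agrees A B C Y \<and> agrees (\<lambda>i j. B j i) (\<lambda>i j. A j i) (\<lambda>i j. C j i) Y)"
        using run[OF w'] by (elim exE conjE) (rule that)
      have "agrees A B C Y \<and> agrees (\<lambda>i j. B j i) (\<lambda>i j. A j i) (\<lambda>i j. C j i) Y"
      proof (rule ccontr)
        assume "\<not> ?thesis"
        then have "regs s' 0 = of_bool (MMV_answer F n A B C)" using o ans by simp
        then have "outputs (verifier l) (initial_state n A B C \<omega>) (MMV_answer F n A B C)"
          unfolding outputs_def using e by blast
        then show False using w by simp
      qed
      then have "accepts A B C \<omega>" unfolding accepts_def using Y by blast
      then show "\<omega> \<in> {\<omega>. length \<omega> = r \<and> accepts A B C \<omega>}" using w' by simp
    qed
    have fin: "finite {\<omega>. length \<omega> = r \<and> accepts A B C \<omega>}"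
      by (rule finite_subset[OF _ finite_lists_length_eq[of "UNIV :: bool set" r]]) auto
    have "(card ?bad)\<^sup>2 \<le> (card {\<omega>. length \<omega> = r \<and> accepts A B C \<omega>})\<^sup>2"
      by (rule power_mono[OF card_mono[OF fin sub]]) simp
    also have "\<dots> \<le> card E"
      by (rule card_accepting[OF ind inj _ _ lt E_def False]) (use k l in auto)
    finally show ?thesis using nn by simp
  qed
qed

text \<open>\<Lambda> is log n + log q + log (1 / \<epsilon>). The summand log q \<ge> 1 pays for
  rounding r up and for the factor 2 in 2 n, while \<delta> \<le> 2 keeps the first summand of r
  below log n. The last claim is the error bound: n^(\<delta>/2), the root of the sparsity, is at
  most an \<epsilon> fraction of all strings.\<close>

lemma logarithms_le:
  fixes \<delta> \<epsilon> :: real and n q :: nat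
  assumes d: "0 \<le> \<delta>" "\<delta> \<le> 2" and eps: "0 < \<epsilon>" "\<epsilon> < 1" and n: "1 \<le> n" and q: "2 \<le> q"
  defines "r \<equiv> nat \<lceil>\<delta> / 2 * log 2 (real n) + log 2 (1 / \<epsilon>)\<rceil>"
    and "\<Lambda> \<equiv> log 2 (real n * real q / \<epsilon>)"
  shows "1 \<le> \<Lambda>" "real r \<le> \<Lambda>" "log 2 (real (2 * n)) \<le> \<Lambda>" "log 2 (real n) \<le> \<Lambda>" "log 2 (real q) \<le> \<Lambda>"
    "real n powr (\<delta> / 2) \<le> \<epsilon> * 2 ^ r"
proof -
  define a where "a = log 2 (real n)"
  define b where "b = log 2 (real q)"
  define c where "c = log 2 (1 / \<epsilon>)"
  have "real n > 0" "real q > 0" using n q by auto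
  then have L: "\<Lambda> = a + b + c"
    unfolding \<Lambda>_def a_def b_def c_def using eps by (simp add: log_mult log_divide)
  have a: "0 \<le> a" using n by (simp add: a_def)
  have b: "1 \<le> b" using q by (simp add: b_def le_log_iff)
  have c: "0 \<le> c" using eps by (simp add: c_def)
  show "1 \<le> \<Lambda>" "log 2 (real n) \<le> \<Lambda>" "log 2 (real q) \<le> \<Lambda>" using L a b c by (auto simp: a_def[symmetric] b_def[symmetric])
  have "log 2 (real (2 * n)) = 1 + a" using n by (simp add: a_def log_mult)
  then show "log 2 (real (2 * n)) \<le> \<Lambda>" using L a b c by simp
  define x where "x = \<delta> / 2 * a + c"
  have da: "\<delta> / 2 * a \<le> 1 * a" using d a by (intro mult_right_mono) auto
  have x0: "0 \<le> x" using d a c by (simp add: x_def)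
  \<comment> \<open>x is nonnegative because \<epsilon> < 1, so \<open>nat\<close> cuts nothing
    off.\<close>
  have rx: "real r = of_int \<lceil>x\<rceil>" using x0 by (simp add: r_def x_def a_def c_def)
  have "of_int \<lceil>x\<rceil> \<le> x + 1" by linarith
  moreover have "x \<le> a + c" using da by (simp add: x_def)
  ultimately show "real r \<le> \<Lambda>" using rx L b by linarith
  have "x \<le> real r" using rx by linarith
  then have "2 powr x \<le> 2 powr real r" by simp
  then have le: "2 powr x \<le> 2 ^ r" by (simp add: powr_realpow)
  have "2 powr x = real n powr (\<delta> / 2) * (1 / \<epsilon>)"
  proof -
    have "2 powr x = 2 powr (a * (\<delta> / 2)) * 2 powr c" by (simp add: x_def powr_add mult.commute)
    also have "2 powr (a * (\<delta> / 2)) = real n powr (\<delta> / 2)" using powr_powr[of 2 a "\<delta> / 2"] n by (simp add: a_def)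
    also have "2 powr c = 1 / \<epsilon>" using eps by (simp add: c_def)
    finally show ?thesis .
  qed
  then have "real n powr (\<delta> / 2) = \<epsilon> * 2 powr x" using eps by simp
  then show "real n powr (\<delta> / 2) \<le> \<epsilon> * 2 ^ r" using le eps by simp
qed

text \<open>For the least k, one of the two conditions fails at k - 1, which bounds l^(k-1) by
  \<Lambda>. The last multiplication by l \<le> 3 accounts for the factor 3.\<close>

lemma exists_root_degree:
  fixes l n r :: nat
  assumes l: "l = 2 \<or> l = 3" and n: "1 \<le> n"
    and \<Lambda>: "1 \<le> \<Lambda>" "real r \<le> \<Lambda>" "log 2 (real (2 * n)) \<le> \<Lambda>"
  obtains k where "r < l ^ k" "2 * n \<le> 2 ^ (l ^ k)" "\<forall>i<k. l ^ i \<le> r \<or> 2 ^ (l ^ i) < 2 * n"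
    "real (l ^ k) \<le> 3 * \<Lambda>" "k \<le> l ^ k"
proof -
  define P where "P k \<longleftrightarrow> r < l ^ k \<and> 2 * n \<le> 2 ^ (l ^ k)" for k
  have kl: "k < l ^ k" for k
  proof -
    have "(2 :: nat) ^ k \<le> l ^ k" by (rule power_mono) (use l in auto)
    then show ?thesis using less_exp[of k] by linarith
  qed
  have "P (r + 2 * n)"
    unfolding P_def using kl[of "r + 2 * n"] less_exp[of "l ^ (r + 2 * n)"] by linarith
  then obtain k where k: "P k" "\<And>i. i < k \<Longrightarrow> \<not> P i" by (metis exists_least_iff)
  have "real (l ^ k) \<le> 3 * \<Lambda>"
  proof (cases k)
    case 0 then show ?thesis using \<Lambda> by simp
  next
    case (Suc j)
    then have "\<not> P j" using k by simp
    then have "l ^ j \<le> r \<or> 2 ^ (l ^ j) < 2 * n" by (auto simp: P_def)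
    then have "real (l ^ j) \<le> \<Lambda>"
    proof
      assume "l ^ j \<le> r" then show ?thesis using \<Lambda>(2) by linarith
    next
      assume "2 ^ (l ^ j) < 2 * n"
      moreover have "2 powr real m = real (2 ^ m)" for m by (simp add: powr_realpow)
      ultimately have "2 powr real (l ^ j) \<le> real (2 * n)" by (metis less_imp_le of_nat_le_iff)
      then have "real (l ^ j) \<le> log 2 (real (2 * n))" using n by (subst le_log_iff) auto
      then show ?thesis using \<Lambda>(3) by linarith
    qed
    moreover have "real (l ^ k) \<le> 3 * real (l ^ j)" using l Suc by auto
    ultimately show ?thesis by linarith
  qed
  then show thesis using that[of k] k kl[of k] by (auto simp: P_def not_le not_less less_imp_le)
qed

lemma floorlog_le_log: "1 \<le> a \<Longrightarrow> real (floorlog 2 a) \<le> log 2 (real a) + 1"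
  by (simp add: floorlog_def)

text \<open>The tables are computed in L and pulled back by an inverse of the numbering; closure of
  the subring keeps the results below Q.\<close>

lemma exists_field_tables:
  fixes L (structure) and \<pi> :: "nat \<Rightarrow> 'a"
  assumes L: "field L" and K: "subring (\<pi> ` {..<Q}) L" and Q: "Q \<le> 2 ^ e" "1 < Q" "\<gamma> < Q"
  shows "\<exists>z0 z1 add sub mul. field_tables L \<pi> Q e \<gamma> z0 z1 add sub mul"
proof -
  interpret L: field L by (rule L)
  note sub = subringE[OF K]
  define num where "num = inv_into {..<Q} \<pi>"
  have num: "num y < Q \<and> \<pi> (num y) = y" if "y \<in> \<pi> ` {..<Q}" for y
    using inv_into_into[OF that] f_inv_into_f[OF that] by (simp add: num_def)
  have "field_tables_axioms L \<pi> Q e \<gamma> (num \<zero>) (num \<one>)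
    (\<lambda>a b. num (\<pi> a \<oplus> \<pi> b)) (\<lambda>a b. num (\<pi> a \<ominus> \<pi> b)) (\<lambda>a b. num (\<pi> a \<otimes> \<pi> b))"
  proof (rule field_tables_axioms.intro)
    show "\<pi> a \<in> carrier L" if "a < Q" for a using that sub(1) by auto
    show "num \<zero> < Q" "\<pi> (num \<zero>) = \<zero>" using num[OF sub(2)] by blast+
    show "num \<one> < Q" "\<pi> (num \<one>) = \<one>" using num[OF sub(3)] by blast+
    fix a b assume "a < Q" "b < Q"
    then have ab: "\<pi> a \<in> \<pi> ` {..<Q}" "\<pi> b \<in> \<pi> ` {..<Q}" by auto
    show "num (\<pi> a \<oplus> \<pi> b) < Q \<and> \<pi> (num (\<pi> a \<oplus> \<pi> b)) = \<pi> a \<oplus> \<pi> b"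
      by (rule num[OF sub(7)[OF ab]])
    show "num (\<pi> a \<ominus> \<pi> b) < Q \<and> \<pi> (num (\<pi> a \<ominus> \<pi> b)) = \<pi> a \<ominus> \<pi> b"
      unfolding L.minus_eq by (rule num[OF sub(7)[OF ab(1) sub(5)[OF ab(2)]]])
    show "num (\<pi> a \<otimes> \<pi> b) < Q \<and> \<pi> (num (\<pi> a \<otimes> \<pi> b)) = \<pi> a \<otimes> \<pi> b"
      by (rule num[OF sub(6)[OF ab]])
  qed (use Q in auto)
  then have "field_tables L \<pi> Q e \<gamma> (num \<zero>) (num \<one>)
    (\<lambda>a b. num (\<pi> a \<oplus> \<pi> b)) (\<lambda>a b. num (\<pi> a \<ominus> \<pi> b)) (\<lambda>a b. num (\<pi> a \<otimes> \<pi> b))"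
    by (intro field_tables.intro L)
  then show ?thesis by (intro exI)
qed

text \<open>100 covers register numbers and small constants, 2^e the cells and the thresholds in the
  decision trees, and n^2 2^N the addresses and register 8. As M is a product, its length is bounded
  by a sum of logarithms.\<close>

lemma register_bound:
  fixes n N e :: nat
  assumes n: "1 \<le> n"
  defines "M \<equiv> 100 * 2 ^ e * (n * n) * 2 ^ N"
  shows "100 \<le> M" "2 ^ e \<le> M" "2 * N \<le> M" "n \<le> M" "2 + 3 * (n * n) + 2 * N + n * N \<le> M" "2 ^ N \<le> M"
proof -
  have NN: "N \<le> 2 ^ N" using less_exp[of N] by simp
  have one: "1 \<le> n * n" "1 \<le> (2::nat) ^ e" "1 \<le> (2::nat) ^ N" "n \<le> n * n" using n by auto
  have c1: "100 * (x * y) \<le> M" if "x \<le> n * n" "y \<le> 2 ^ N" for x y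
  proof -
    have "x * y \<le> (n * n) * 2 ^ N" using that by (rule mult_le_mono)
    also have "\<dots> \<le> 2 ^ e * ((n * n) * 2 ^ N)" by simp
    finally show ?thesis by (simp add: M_def mult_ac)
  qed
  have "2 ^ e * 1 \<le> 2 ^ e * (100 * (n * n) * 2 ^ N)" using one by (intro mult_le_mono2) simp
  then show "2 ^ e \<le> M" unfolding M_def by (simp add: mult_ac)
  show "100 \<le> M" "2 * N \<le> M" "n \<le> M" "2 ^ N \<le> M"
    using c1[of 1 1] c1[of 1 N] c1[of n 1] c1[of 1 "2 ^ N"] one NN by auto
  show "2 + 3 * (n * n) + 2 * N + n * N \<le> M"
    using c1[of 1 1] c1[of 1 N] c1[of "n * n" 1] c1[of n N] one NN by linarith
qed

text \<open>100 \<le> 2^7, and the lengths of the other factors add up to a multiple of \<Lambda>;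
  46000 is 2000 * 23 and leaves some room.\<close>

lemma step_cost_le:
  fixes n N e :: nat
  assumes n: "1 \<le> n" and L: "1 \<le> \<Lambda>" "real N \<le> 3 * \<Lambda>" "real e \<le> 4 * \<Lambda>" "log 2 (real n) \<le> \<Lambda>"
  shows "real (step_cost (100 * 2 ^ e * (n * n) * 2 ^ N)) \<le> 46000 * \<Lambda>"
proof -
  let ?M = "100 * 2 ^ e * (n * n) * 2 ^ N"
  have fln: "real (floorlog 2 n) \<le> 2 * \<Lambda>" using floorlog_le_log[of n] n L(1,4) by linarith
  have "?M < 2 ^ (7 + e + (floorlog 2 n + floorlog 2 n) + N)"
  proof -
    have "n < 2 ^ floorlog 2 n" by (rule floorlog_leD) auto
    then have "n * n < 2 ^ floorlog 2 n * 2 ^ floorlog 2 n" by (intro mult_strict_mono) auto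
    then have "(100 * 2 ^ e * 2 ^ N) * (n * n) < (100 * 2 ^ e * 2 ^ N) * (2 ^ floorlog 2 n * 2 ^ floorlog 2 n)"
      by (intro mult_strict_left_mono) auto
    also have "\<dots> \<le> (128 * 2 ^ e * 2 ^ N) * (2 ^ floorlog 2 n * 2 ^ floorlog 2 n)"
      by (intro mult_right_mono) auto
    also have "\<dots> = 2 ^ (7 + e + (floorlog 2 n + floorlog 2 n) + N)" by (simp only: power_add) simp
    finally show ?thesis by (simp add: mult_ac)
  qed
  then have "floorlog 2 ?M \<le> 7 + e + (floorlog 2 n + floorlog 2 n) + N" by (intro floorlog_leI) auto
  then have "real (floorlog 2 ?M) \<le> real (7 + e + (floorlog 2 n + floorlog 2 n) + N)"
    by (simp only: of_nat_le_iff)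
  also have "\<dots> = 7 + real e + (real (floorlog 2 n) + real (floorlog 2 n)) + real N" by simp
  finally have "real (word_cost ?M) \<le> 23 * \<Lambda>"
    using L fln unfolding word_cost_def of_nat_add of_nat_1 by linarith
  then show ?thesis unfolding step_cost_def of_nat_mult by simp
qed

text \<open>The bound W on the small parameters is the ceiling of 7 \<Lambda>, at most 8 \<Lambda>
  because \<Lambda> \<ge> 1. The constant is 200 * 8^3 * 46000.\<close>

lemma (in field_tower) verifier_time:
  assumes n: "1 \<le> n" and L: "1 \<le> \<Lambda>" "real N \<le> 3 * \<Lambda>" "real e \<le> 4 * \<Lambda>" "log 2 (real n) \<le> \<Lambda>" "k \<le> N"
    and M: "M = 100 * 2 ^ e * (n * n) * 2 ^ N"
  shows "real (verifier_steps k * step_cost M) \<le> (real n)\<^sup>2 * (4710400000 * \<Lambda> ^ 4)"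
proof -
  define w where "w = nat \<lceil>7 * \<Lambda>\<rceil>"
  have "real w = of_int \<lceil>7 * \<Lambda>\<rceil>" using L(1) by (simp add: w_def)
  then have w: "7 * \<Lambda> \<le> real w" "real w \<le> 8 * \<Lambda>" using L(1) by linarith+
  have "real N \<le> real w" "real e \<le> real w" "1 \<le> real w" using L w by linarith+
  then have "N \<le> w" "e \<le> w" "1 \<le> w" by simp_all
  then have steps: "verifier_steps k \<le> 200 * n\<^sup>2 * w ^ 3" using L(5) by (intro verifier_steps_le n) simp_all
  have "real (verifier_steps k) \<le> real (200 * n\<^sup>2 * w ^ 3)" using steps by (simp only: of_nat_le_iff)
  also have "\<dots> = 200 * (real n)\<^sup>2 * real w ^ 3" by simp
  also have "\<dots> \<le> 200 * (real n)\<^sup>2 * (8 * \<Lambda>) ^ 3"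
    using w by (intro mult_left_mono power_mono) auto
  finally have "real (verifier_steps k) * real (step_cost M) \<le> (200 * (real n)\<^sup>2 * (8 * \<Lambda>) ^ 3) * (46000 * \<Lambda>)"
    using step_cost_le[OF n L(1-4)] L(1) unfolding M by (intro mult_mono) auto
  also have "\<dots> = (real n)\<^sup>2 * (4710400000 * \<Lambda> ^ 4)"
    by (simp add: power_mult_distrib power3_eq_cube power4_eq_xxxx)
  finally show ?thesis by simp
qed

lemma (in field_tower) verifier_instance:
  fixes F :: "nat ring"
  assumes F: "field F" "carrier F = {..<q}" "q \<le> Q" and h: "\<pi> \<in> ring_hom F L" and inj: "inj_on \<pi> {..<Q}"
    and ind: "\<forall>c\<in>{..<N} \<rightarrow> \<pi> ` {..<Q}. (\<Oplus>i\<in>{..<N}. c i \<otimes> \<beta> [^] i) = \<zero> \<longrightarrow> (\<forall>i<N. c i = \<zero>)"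
    and l: "l = 2 \<or> l = 3" "N = l ^ k"
    and k: "r < l ^ k" "2 * n \<le> 2 ^ (l ^ k)" "\<forall>i<k. l ^ i \<le> r \<or> 2 ^ (l ^ i) < 2 * n"
    and n: "1 \<le> n" and L: "1 \<le> \<Lambda>" "real N \<le> 3 * \<Lambda>" "real e \<le> 4 * \<Lambda>" "log 2 (real n) \<le> \<Lambda>" "k \<le> N"
    and M: "M = 100 * 2 ^ e * (n * n) * 2 ^ N"
    and ABC: "A \<in> square_matrices F n" "B \<in> square_matrices F n" "C \<in> square_matrices F n"
  shows "\<forall>\<omega>. length \<omega> = r \<longrightarrow> halts_within (verifier l) (initial_state n A B C \<omega>) ((real n)\<^sup>2 * (4710400000 * \<Lambda> ^ 4))"
    and "(card {\<omega>. length \<omega> = r \<and> \<not> outputs (verifier l) (initial_state n A B C \<omega>) (MMV_answer F n A B C)})\<^sup>2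
      \<le> num_nonzero F n (mat_diff F (mat_prod F n A B) C)"
proof -
  note bounds = register_bound[OF n, where N = N and e = e, folded M]
  have "powers_independent" unfolding powers_independent_def by (rule ind)
  note correct = verifier_correct[OF F h inj this l k ABC bounds(5,6)]
  show "\<forall>\<omega>. length \<omega> = r \<longrightarrow> halts_within (verifier l) (initial_state n A B C \<omega>) ((real n)\<^sup>2 * (4710400000 * \<Lambda> ^ 4))"
  proof (intro allI impI)
    fix \<omega> :: "bool list" assume w: "length \<omega> = r"
    obtain t s' where t: "exec (verifier l) (initial_state n A B C \<omega>) t s'" "t \<le> verifier_steps k * step_cost M"
      using correct(1)[OF w] by (elim exE conjE) (rule that)
    have "real t \<le> real (verifier_steps k * step_cost M)" using t(2) by (simp only: of_nat_le_iff)
    also have "\<dots> \<le> (real n)\<^sup>2 * (4710400000 * \<Lambda> ^ 4)" by (rule verifier_time[OF n L M])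
    finally show "halts_within (verifier l) (initial_state n A B C \<omega>) ((real n)\<^sup>2 * (4710400000 * \<Lambda> ^ 4))"
      unfolding halts_within_def using t(1) by blast
  qed
  show "(card {\<omega>. length \<omega> = r \<and> \<not> outputs (verifier l) (initial_state n A B C \<omega>) (MMV_answer F n A B C)})\<^sup>2
      \<le> num_nonzero F n (mat_diff F (mat_prod F n A B) C)" by (rule correct(2))
qed

text \<open>Here the degree and its root are chosen to suit n and r, while the program stays the
  same; its own loop arrives at the same k.\<close>

lemma (in field_tables) verifier_main:
  fixes F :: "nat ring"
  assumes F: "field F" "carrier F = {..<q}" "q \<le> Q" and h: "\<pi> \<in> ring_hom F L" and inj: "inj_on \<pi> {..<Q}"
    and tower: "\<forall>k. \<exists>\<beta>\<in>carrier L. \<beta> [^] (l ^ k) = \<pi> \<gamma> \<and> (\<forall>c\<in>{..<l ^ k} \<rightarrow> \<pi> ` {..<Q}.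
        (\<Oplus>i\<in>{..<l ^ k}. c i \<otimes> \<beta> [^] i) = \<zero> \<longrightarrow> (\<forall>i<l ^ k. c i = \<zero>))"
    and l: "l = 2 \<or> l = 3" and n: "1 \<le> n"
    and L: "1 \<le> \<Lambda>" "real r \<le> \<Lambda>" "log 2 (real (2 * n)) \<le> \<Lambda>" "log 2 (real n) \<le> \<Lambda>" "real e \<le> 4 * \<Lambda>"
    and ABC: "A \<in> square_matrices F n" "B \<in> square_matrices F n" "C \<in> square_matrices F n"
  shows "(\<forall>\<omega>. length \<omega> = r \<longrightarrow> halts_within (verifier l) (initial_state n A B C \<omega>) ((real n)\<^sup>2 * (4710400000 * \<Lambda> ^ 4)))
    \<and> (card {\<omega>. length \<omega> = r \<and> \<not> outputs (verifier l) (initial_state n A B C \<omega>) (MMV_answer F n A B C)})\<^sup>2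
      \<le> num_nonzero F n (mat_diff F (mat_prod F n A B) C)"
proof -
  obtain k where k: "r < l ^ k" "2 * n \<le> 2 ^ (l ^ k)" "\<forall>i<k. l ^ i \<le> r \<or> 2 ^ (l ^ i) < 2 * n"
    "real (l ^ k) \<le> 3 * \<Lambda>" "k \<le> l ^ k"
    by (rule exists_root_degree[OF l n L(1,2,3)]) (rule that)
  obtain \<beta> where b: "\<beta> \<in> carrier L" "\<beta> [^] (l ^ k) = \<pi> \<gamma>"
    "\<forall>c\<in>{..<l ^ k} \<rightarrow> \<pi> ` {..<Q}.
      (\<Oplus>i\<in>{..<l ^ k}. c i \<otimes> \<beta> [^] i) = \<zero> \<longrightarrow> (\<forall>i<l ^ k. c i = \<zero>)"
    using spec[OF tower, of k] by (elim bexE conjE) (rule that)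
  let ?M = "100 * 2 ^ e * (n * n) * 2 ^ (l ^ k)"
  note bounds = register_bound[OF n, where N = "l ^ k" and e = e]
  have "field_tower L \<pi> Q e \<gamma> zero_cell one_cell add sub mul (l ^ k) ?M n \<beta>"
  proof (intro field_tower.intro field_tower_axioms.intro)
    show "field_tables L \<pi> Q e \<gamma> zero_cell one_cell add sub mul" by (rule field_tables_axioms)
    show "0 < l ^ k" using l by auto
  qed (rule b bounds)+
  from field_tower.verifier_instance[OF this F h inj b(3) l refl k(1-3) n L(1) k(4) L(5,4) k(5) refl ABC]
  show ?thesis by (rule conjI)
qed

text \<open>The square of the number of bad strings is at most n^\<delta>, hence their number is at
  most n^(\<delta>/2), an \<epsilon> fraction of the 2^r strings by the choice of r.\<close>

lemma verifier_success:
  fixes F :: "nat ring" and \<delta> \<epsilon> :: real and n r :: nat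
  assumes P: "(A, B, C) \<in> MMV_promise F (\<lambda>n. real n powr \<delta>) n"
    and le: "real n powr (\<delta> / 2) \<le> \<epsilon> * 2 ^ r"
    and bad: "(card {\<omega>. length \<omega> = r \<and> \<not> outputs c (initial_state n A B C \<omega>) (MMV_answer F n A B C)})\<^sup>2
      \<le> num_nonzero F n (mat_diff F (mat_prod F n A B) C)"
  shows "1 - \<epsilon> \<le> measure_pmf.prob (pmf_of_set {\<omega>. length \<omega> = r})
    {\<omega>. outputs c (initial_state n A B C \<omega>) (MMV_answer F n A B C)}"
proof -
  let ?S = "{\<omega> :: bool list. length \<omega> = r}"
  let ?ok = "{\<omega>. outputs c (initial_state n A B C \<omega>) (MMV_answer F n A B C)}"
  define bad where "bad = {\<omega>. length \<omega> = r \<and> \<not> outputs c (initial_state n A B C \<omega>) (MMV_answer F n A B C)}"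
  have nz: "real (num_nonzero F n (mat_diff F (mat_prod F n A B) C)) \<le> real n powr \<delta>"
    using P by (simp add: MMV_promise_def)
  have "real ((card bad)\<^sup>2) \<le> real (num_nonzero F n (mat_diff F (mat_prod F n A B) C))"
    using assms(3) unfolding bad_def by (simp only: of_nat_le_iff)
  then have "(real (card bad))\<^sup>2 \<le> real n powr \<delta>" using nz unfolding of_nat_power by linarith
  also have "\<dots> = (real n powr (\<delta> / 2))\<^sup>2" by (simp add: power2_eq_square powr_add[symmetric])
  finally have "real (card bad) \<le> real n powr (\<delta> / 2)" by (rule power2_le_imp_le) simp
  then have le': "real (card bad) \<le> \<epsilon> * 2 ^ r" using le by linarith
  have Sl: "?S = {xs. set xs \<subseteq> (UNIV :: bool set) \<and> length xs = r}" by simp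
  have finS: "finite ?S" unfolding Sl by (rule finite_lists_length_eq) simp
  have cardS: "card ?S = 2 ^ r" unfolding Sl by (subst card_lists_length_eq) simp_all
  have neS: "?S \<noteq> {}"
  proof
    assume "?S = {}"
    then show False using cardS by (simp only: card.empty) simp
  qed
  have bS: "bad \<subseteq> ?S" by (auto simp: bad_def)
  have fb: "finite bad" using bS finS by (rule finite_subset)
  have e: "?S \<inter> ?ok = ?S - bad" by (auto simp: bad_def)
  have "card (?S \<inter> ?ok) = card ?S - card bad" unfolding e by (rule card_Diff_subset[OF fb bS])
  moreover have "card bad \<le> card ?S" by (rule card_mono[OF finS bS])
  ultimately have "real (card (?S \<inter> ?ok)) = 2 ^ r - real (card bad)" using cardS by (simp add: of_nat_diff)
  moreover have "measure_pmf.prob (pmf_of_set ?S) ?ok = real (card (?S \<inter> ?ok)) / real (card ?S)"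
    by (rule measure_pmf_of_set[OF neS finS])
  ultimately have "measure_pmf.prob (pmf_of_set ?S) ?ok = (2 ^ r - real (card bad)) / 2 ^ r"
    using cardS by simp
  also have "\<dots> = 1 - real (card bad) / 2 ^ r" by (simp add: diff_divide_distrib)
  finally have "measure_pmf.prob (pmf_of_set ?S) ?ok = 1 - real (card bad) / 2 ^ r" .
  moreover have "real (card bad) / 2 ^ r \<le> \<epsilon>" using le' by (simp add: pos_divide_le_eq)
  ultimately show ?thesis by linarith
qed

lemma exists_verifier:
  fixes F :: "nat ring" and \<delta> \<epsilon> :: real
  assumes F: "field F" "carrier F = {..<q}" and d: "0 \<le> \<delta>" "\<delta> \<le> 2" and eps: "0 < \<epsilon>" "\<epsilon> < 1"
  defines "r \<equiv> \<lambda>n :: nat. nat \<lceil>\<delta> / 2 * log 2 (real n) + log 2 (1 / \<epsilon>)\<rceil>"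
  shows "\<exists>c. runs_in_time F r c (\<lambda>n. (real n)\<^sup>2 * (4710400000 * (log 2 (real n * real q / \<epsilon>)) ^ 4)) \<and>
    solves_MMV F (\<lambda>n. real n powr \<delta>) r c (1 - \<epsilon>)"
proof -
  interpret F: field F by fact
  have "card {\<zero>\<^bsub>F\<^esub>, \<one>\<^bsub>F\<^esub>} \<le> card (carrier F)" using F by (intro card_mono) auto
  then have q2: "q \<ge> 2" using F by simp
  define Q where "Q = q\<^sup>2"
  have qQ: "q \<le> Q" using q2 by (simp add: Q_def power2_eq_square)
  define e where "e = 2 * floorlog 2 q"
  have Qe: "Q \<le> 2 ^ e"
  proof -
    have "q < 2 ^ floorlog 2 q" by (rule floorlog_leD) auto
    then have "q\<^sup>2 \<le> (2 ^ floorlog 2 q)\<^sup>2" by (intro power_mono) auto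
    then show ?thesis by (simp add: Q_def e_def power_mult[symmetric] mult.commute)
  qed
  obtain L :: "((nat list \<times> nat) multiset \<Rightarrow> nat) ring" and \<pi> \<gamma> and l :: nat where
    L: "field L" and l: "l = 2 \<or> l = 3" and hom: "\<pi> \<in> ring_hom F L" and inj: "inj_on \<pi> {..<Q}"
    and K: "subfield (\<pi> ` {..<Q}) L" and g: "\<gamma> < Q"
    and tower: "\<forall>k. \<exists>\<beta>\<in>carrier L. \<beta> [^]\<^bsub>L\<^esub> (l ^ k) = \<pi> \<gamma> \<and>
      (\<forall>c\<in>{..<l ^ k} \<rightarrow> \<pi> ` {..<Q}.
        (\<Oplus>\<^bsub>L\<^esub>i\<in>{..<l ^ k}. c i \<otimes>\<^bsub>L\<^esub> \<beta> [^]\<^bsub>L\<^esub> i) = \<zero>\<^bsub>L\<^esub> \<longrightarrow> (\<forall>i<l ^ k. c i = \<zero>\<^bsub>L\<^esub>))"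
    using exists_field_with_root_towers[OF F, folded Q_def] by (elim exE conjE) (rule that)
  have Q1: "1 < Q" using q2 qQ by linarith
  obtain z0 z1 add sub mul where T: "field_tables L \<pi> Q e \<gamma> z0 z1 add sub mul"
    using exists_field_tables[OF L subfieldE(1)[OF K] Qe Q1 g] by (elim exE) (rule that)
  \<comment> \<open>The program is fixed before n and the matrices are introduced, so that a single
    one serves all sizes.\<close>
  obtain c where main: "(\<forall>\<omega>. length \<omega> = r n \<longrightarrow> halts_within c (initial_state n A B C \<omega>)
        ((real n)\<^sup>2 * (4710400000 * (log 2 (real n * real q / \<epsilon>)) ^ 4))) \<and>
      (card {\<omega>. length \<omega> = r n \<and> \<not> outputs c (initial_state n A B C \<omega>) (MMV_answer F n A B C)})\<^sup>2
        \<le> num_nonzero F n (mat_diff F (mat_prod F n A B) C)"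
    if "1 \<le> n" "A \<in> square_matrices F n" "B \<in> square_matrices F n" "C \<in> square_matrices F n" for n A B C
  proof (rule that)
    fix n A B C assume n: "1 \<le> n"
      and ABC: "A \<in> square_matrices F n" "B \<in> square_matrices F n" "C \<in> square_matrices F n"
    note Lam = logarithms_le[OF d eps n q2]
    have rL: "real (r n) \<le> log 2 (real n * real q / \<epsilon>)" using Lam(2) by (simp add: r_def)
    have "real (floorlog 2 q) \<le> 2 * log 2 (real n * real q / \<epsilon>)"
      using floorlog_le_log[of q] q2 Lam(1,5) by linarith
    then have eL: "real e \<le> 4 * log 2 (real n * real q / \<epsilon>)" by (simp add: e_def)
    show "(\<forall>\<omega>. length \<omega> = r n \<longrightarrow> halts_within (field_tables.verifier e \<gamma> z0 z1 add sub mul l) (initial_state n A B C \<omega>)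
        ((real n)\<^sup>2 * (4710400000 * (log 2 (real n * real q / \<epsilon>)) ^ 4))) \<and>
      (card {\<omega>. length \<omega> = r n \<and> \<not> outputs (field_tables.verifier e \<gamma> z0 z1 add sub mul l) (initial_state n A B C \<omega>) (MMV_answer F n A B C)})\<^sup>2
        \<le> num_nonzero F n (mat_diff F (mat_prod F n A B) C)"
      by (rule field_tables.verifier_main[OF T F qQ hom inj tower l n Lam(1) rL Lam(3,4) eL ABC])
  qed
  have "runs_in_time F r c (\<lambda>n. (real n)\<^sup>2 * (4710400000 * (log 2 (real n * real q / \<epsilon>)) ^ 4))"
    unfolding runs_in_time_def
  proof (intro allI impI ballI)
    fix n :: nat and A B C and \<omega> :: "bool list"
    assume "1 \<le> n" "A \<in> square_matrices F n" "B \<in> square_matrices F n" "C \<in> square_matrices F n"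
      and w: "length \<omega> = r n"
    from conjunct1[OF main[OF this(1-4)]] w
    show "halts_within c (initial_state n A B C \<omega>)
      ((real n)\<^sup>2 * (4710400000 * (log 2 (real n * real q / \<epsilon>)) ^ 4))" by blast
  qed
  moreover have "solves_MMV F (\<lambda>n. real n powr \<delta>) r c (1 - \<epsilon>)"
    unfolding solves_MMV_def
  proof (intro allI impI ballI, clarify)
    fix n :: nat and A B C assume n: "1 \<le> n" and P: "(A, B, C) \<in> MMV_promise F (\<lambda>n. real n powr \<delta>) n"
    then have sq: "A \<in> square_matrices F n" "B \<in> square_matrices F n" "C \<in> square_matrices F n"
      by (auto simp: MMV_promise_def)
    show "1 - \<epsilon> \<le> measure_pmf.prob (pmf_of_set {\<omega>. length \<omega> = r n})
      {\<omega>. outputs c (initial_state n A B C \<omega>) (MMV_answer F n A B C)}"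
      by (rule verifier_success[OF P _ conjunct2[OF main[OF n sq]]])
        (use logarithms_le(6)[OF d eps n q2] in \<open>simp add: r_def\<close>)
  qed
  ultimately show ?thesis by blast
qed

theorem theorem3p5:
  fixes \<delta> :: real
  assumes "0 \<le> \<delta>" and "\<delta> \<le> 2"
  shows "\<exists>P :: real poly. \<forall>(F :: nat ring) (q :: nat) (\<epsilon> :: real).
    field F \<and> carrier F = {..<q} \<and> \<epsilon> > 0 \<longrightarrow>
    (let r = (\<lambda>n :: nat. nat \<lceil>\<delta> / 2 * log 2 (real n) + log 2 (1 / \<epsilon>)\<rceil>) in
      \<exists>c :: com.
        runs_in_time F r c (\<lambda>n. (real n)\<^sup>2 * poly P (log 2 (real n * real q / \<epsilon>))) \<and>
        solves_MMV F (\<lambda>n. real n powr \<delta>) r c (1 - \<epsilon>))"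
proof -
  \<comment> \<open>The square of 1 + x^2 is at least x^4 and at least 1 for every real x. The
    latter is needed when \<epsilon> is so large that the logarithm is zero or negative.\<close>
  define P :: "real poly" where "P = [:4710400000:] * [:1, 0, 1:]\<^sup>2"
  have P: "poly P x = 4710400000 * (1 + x\<^sup>2)\<^sup>2" for x
    by (simp add: P_def power2_eq_square algebra_simps)
  have P1: "1 \<le> poly P x" and P4: "4710400000 * x ^ 4 \<le> poly P x" for x
  proof -
    have "(x\<^sup>2)\<^sup>2 + 1 \<le> (1 + x\<^sup>2)\<^sup>2" by (simp add: power2_sum)
    moreover have "(x\<^sup>2)\<^sup>2 = x ^ 4" by (simp flip: power_mult)
    moreover have "0 \<le> (x\<^sup>2)\<^sup>2" by simp
    ultimately show "1 \<le> poly P x" "4710400000 * x ^ 4 \<le> poly P x" unfolding P by linarith+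
  qed
  show ?thesis
    unfolding Let_def
  proof (intro exI[of _ P] allI impI)
    fix F :: "nat ring" and q :: nat and \<epsilon> :: real
    assume A: "field F \<and> carrier F = {..<q} \<and> \<epsilon> > 0"
    let ?r = "\<lambda>n :: nat. nat \<lceil>\<delta> / 2 * log 2 (real n) + log 2 (1 / \<epsilon>)\<rceil>"
    show "\<exists>c. runs_in_time F ?r c (\<lambda>n. (real n)\<^sup>2 * poly P (log 2 (real n * real q / \<epsilon>))) \<and>
      solves_MMV F (\<lambda>n. real n powr \<delta>) ?r c (1 - \<epsilon>)"
    proof (cases "\<epsilon> < 1")
      case True
      obtain c where c: "runs_in_time F ?r c (\<lambda>n. (real n)\<^sup>2 * (4710400000 * (log 2 (real n * real q / \<epsilon>)) ^ 4))"
        "solves_MMV F (\<lambda>n. real n powr \<delta>) ?r c (1 - \<epsilon>)"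
        using exists_verifier[of F q \<delta> \<epsilon>] A assms True by blast
      have "(real n)\<^sup>2 * (4710400000 * x ^ 4) \<le> (real n)\<^sup>2 * poly P x" for n x
        using P4 by (intro mult_left_mono) auto
      then have "runs_in_time F ?r c (\<lambda>n. (real n)\<^sup>2 * poly P (log 2 (real n * real q / \<epsilon>)))"
        using c(1) unfolding runs_in_time_def halts_within_def by (meson order_trans)
      then show ?thesis using c(2) by blast
    next
      \<comment> \<open>For \<epsilon> \<ge> 1 the required success probability is at most 0, so any
        program that halts in time will do; \<open>Skip\<close> costs 1.\<close>
      case False
      have "runs_in_time F ?r Skip (\<lambda>n. (real n)\<^sup>2 * poly P (log 2 (real n * real q / \<epsilon>)))"
        unfolding runs_in_time_def halts_within_def
      proof (intro allI impI ballI)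
        fix n :: nat and A B C \<omega> assume "1 \<le> n"
        then have "1 * 1 \<le> (real n)\<^sup>2 * poly P (log 2 (real n * real q / \<epsilon>))"
          using P1 by (intro mult_mono) auto
        then show "\<exists>t s'. exec Skip (initial_state n A B C \<omega>) t s' \<and>
          real t \<le> (real n)\<^sup>2 * poly P (log 2 (real n * real q / \<epsilon>))"
          using exec.Skip by force
      qed
      moreover have "solves_MMV F (\<lambda>n. real n powr \<delta>) ?r Skip (1 - \<epsilon>)"
        unfolding solves_MMV_def using False by (auto intro: order_trans[of _ 0])
      ultimately show ?thesis by blast
    qed
  qed
qed

end
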